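(* Let $0<\alpha_2<\alpha_1<1$, $c_1\ge 0$, $c_2\ge 0$ with $c_1+c_2=1$, and let $\frac{\mathrm d^{\alpha}}{\mathrm dt^{\alpha}}$ denote the Caputo fractional derivative of order $\alpha$. Then the state probabilities $p_0^{\alpha_1,\alpha_2}(t)$ and $p_{n,s}^{\alpha_1,\alpha_2}(t)$, $n\ge1$, $1\le s\le k$, of the mixed time-changed Erlang queue solve, for $t>0$, the system $$\Big(c_1\tfrac{\mathrm d^{\alpha_1}}{\mathrm dt^{\alpha_1}}+c_2\tfrac{\mathrm d^{\alpha_2}}{\mathrm dt^{\alpha_2}}\Big)p_0^{\alpha_1,\alpha_2}(t)=-\lambda p_0^{\alpha_1,\alpha_2}(t)+k\mu\, p_{1,1}^{\alpha_1,\alpha_2}(t),$$ $$\Big(c_1\tfrac{\mathrm d^{\alpha_1}}{\mathrm dt^{\alpha_1}}+c_2\tfrac{\mathrm d^{\alpha_2}}{\mathrm dt^{\alpha_2}}\Big)p_{1,s}^{\alpha_1,\alpha_2}(t)=-(\lambda+k\mu)p_{1,s}^{\alpha_1,\alpha_2}(t)+k\mu\, p_{1,s+1}^{\alpha_1,\alpha_2}(t),\quad 1\le s\le k-1,$$ $$\Big(c_1\tfrac{\mathrm d^{\alpha_1}}{\mathrm dt^{\alpha_1}}+c_2\tfrac{\mathrm d^{\alpha_2}}{\mathrm dt^{\alpha_2}}\Big)p_{1,k}^{\alpha_1,\alpha_2}(t)=-(\lambda+k\mu)p_{1,k}^{\alpha_1,\alpha_2}(t)+k\mu\, p_{2,1}^{\alpha_1,\alpha_2}(t)+\lambda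 p_0^{\alpha_1,\alpha_2}(t),$$ $$\Big(c_1\tfrac{\mathrm d^{\alpha_1}}{\mathrm dt^{\alpha_1}}+c_2\tfrac{\mathrm d^{\alpha_2}}{\mathrm dt^{\alpha_2}}\Big)p_{n,s}^{\alpha_1,\alpha_2}(t)=-(\lambda+k\mu)p_{n,s}^{\alpha_1,\alpha_2}(t)+k\mu\, p_{n,s+1}^{\alpha_1,\alpha_2}(t)+\lambda p_{n-1,s}^{\alpha_1,\alpha_2}(t),\quad 1\le s\le k-1,\ n\ge2,$$ $$\Big(c_1\tfrac{\mathrm d^{\alpha_1}}{\mathrm dt^{\alpha_1}}+c_2\tfrac{\mathrm d^{\alpha_2}}{\mathrm dt^{\alpha_2}}\Big)p_{n,k}^{\alpha_1,\alpha_2}(t)=-(\lambda+k\mu)p_{n,k}^{\alpha_1,\alpha_2}(t)+k\mu\, p_{n+1,1}^{\alpha_1,\alpha_2}(t)+\lambda p_{n-1,k}^{\alpha_1,\alpha_2}(t),\quad n\ge2,$$ with $p_0^{\alpha_1,\alpha_2}(0)=1$ and $p_{n,s}^{\alpha_1,\alpha_2}(0)=0$ for $1\le s\le k$, $n\ge1$.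
   Context: Parameters: $\lambda>0$, $\mu>0$, $k\in\mathbb N=\{1,2,\dots\}$. Erlang queue: single-server queue with Poisson arrivals of rate $\lambda$, each service consisting of $k$ successive phases, each exponential with parameter $k\mu$, all independent. $\mathcal Q(t)=(\mathcal N(t),\mathcal S(t))$, where $\mathcal N(t)$ is the number of customers in the system and $\mathcal S(t)$ is the phase of the customer being served if $\mathcal N(t)>0$ (phases are counted down: service starts at phase $k$ and ends upon completion of phase $1$), with $\mathcal S(t)=0$ if $\mathcal N(t)=0$. Thus $\mathcal Q$ is the continuous-time Markov chain on $\mathcal H_0=\mathcal H\cup\{(0,0)\}$, $\mathcal H=\{(n,s)\in\mathbb N\times\mathbb N: s\le k\}$, with $\mathcal Q(0)=(0,0)$ and transition rates: $(0,0)\to(1,k)$ at rate $\lambda$; $(n,s)\to(n+1,s)$ at rate $\lambda$; $(n,s)\to(n,s-1)$ at rate $k\mu$ if $s\ge2$; $(n,1)\to(n-1,k)$ at rate $k\mu$ if $n\ge2$; $(1,1)\to(0,0)$ at rate $k\mu$. Inverse mixed stable subordinator: $\{D_{\alpha_1,\alpha_2}(t)\}_{t\ge0}$ is the nondecreasing Lévy process (started at $0$) with $\mathbb E(e^{-zD_{\alpha_1,\alpha_2}(t)})=e^{-t(c_1z^{\alpha_1}+c_2z^{\alpha_2})}$, $z>0$; $Y_{\alpha_1,\alpha_2}(t)=\inf\{s\ge0:D_{\alpha_1,\alpha_2}(s)>t\}$, $t>0$, $Y_{\alpha_1,\alpha_2}(0)=0$. Mixed time-changed Erlang queue: $\mathcal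 Q^{\alpha_1,\alpha_2}(t)=\mathcal Q(Y_{\alpha_1,\alpha_2}(t))$, with $\mathcal Q$ and $Y_{\alpha_1,\alpha_2}$ independent. State probabilities: $p_0^{\alpha_1,\alpha_2}(t)=\Pr(\mathcal Q^{\alpha_1,\alpha_2}(t)=(0,0)\mid \mathcal Q^{\alpha_1,\alpha_2}(0)=(0,0))$ and $p_{n,s}^{\alpha_1,\alpha_2}(t)=\Pr(\mathcal Q^{\alpha_1,\alpha_2}(t)=(n,s)\mid \mathcal Q^{\alpha_1,\alpha_2}(0)=(0,0))$, $(n,s)\in\mathcal H$. Caputo derivative for $0<\alpha<1$: $\frac{\mathrm d^\alpha}{\mathrm dt^\alpha}g(t)=\frac1{\Gamma(1-\alpha)}\int_0^t(t-y)^{-\alpha}g'(y)\,\mathrm dy$. *)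

theory Defs
  imports "HOL-Probability.Probability"
begin

text \<open>The classical Caputo derivative of order \<open>\<alpha> \<in> (0,1)\<close>. The set integral has the default value
  \<open>0\<close> and \<open>deriv\<close> is unspecified where the analytic object does not exist, so
  existence is recorded separately in \<open>caputo_differentiable\<close>.\<close>

definition caputo_deriv :: "real \<Rightarrow> (real \<Rightarrow> real) \<Rightarrow> real \<Rightarrow> real" where
  "caputo_deriv \<alpha> g t =
     1 / Gamma (1 - \<alpha>) * (LINT y:{0<..<t}|lborel. (t - y) powr (- \<alpha>) * deriv g y)"

definition caputo_differentiable :: "real \<Rightarrow> (real \<Rightarrow> real) \<Rightarrow> real \<Rightarrow> bool" where
  "caputo_differentiable \<alpha> g t \<longleftrightarrow>
     (\<forall>y\<in>{0<..<t}. g differentiable (at y)) \<and>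
     set_integrable lborel {0<..<t} (\<lambda>y. (t - y) powr (- \<alpha>) * deriv g y)"

text \<open>Only the values \<open>q i j\<close> with \<open>i \<noteq> j\<close> are used; the total exit rate from \<open>i\<close> is the
  sum of the rates out of \<open>i\<close>.\<close>

definition transition_function ::
    "'s set \<Rightarrow> ('s \<Rightarrow> 's \<Rightarrow> real) \<Rightarrow> (real \<Rightarrow> 's \<Rightarrow> 's \<Rightarrow> real) \<Rightarrow> bool" where
  "transition_function S q P \<longleftrightarrow>
     (\<forall>t\<ge>0. \<forall>i\<in>S. \<forall>j\<in>S. 0 \<le> P t i j) \<and>
     (\<forall>t\<ge>0. \<forall>i\<in>S. (P t i has_sum 1) S) \<and>
     (\<forall>i\<in>S. \<forall>j\<in>S. P 0 i j = (if i = j then 1 else 0)) \<and>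
     (\<forall>s\<ge>0. \<forall>t\<ge>0. \<forall>i\<in>S. \<forall>j\<in>S. ((\<lambda>l. P s i l * P t l j) has_sum P (s + t) i j) S) \<and>
     (\<forall>i\<in>S. \<forall>j\<in>S. i \<noteq> j \<longrightarrow> ((\<lambda>h. P h i j / h) \<longlongrightarrow> q i j) (at_right 0)) \<and>
     (\<forall>i\<in>S. ((\<lambda>h. (1 - P h i i) / h) \<longlongrightarrow> (\<Sum>\<^sub>\<infinity>j\<in>S - {i}. q i j)) (at_right 0))"

text \<open>A time-homogeneous continuous-time Markov chain on the countable discrete space \<open>S\<close> with
  rates \<open>q\<close>, started at \<open>x0\<close>, with right-continuous paths.\<close>

definition markov_jump_process ::
    "'a measure \<Rightarrow> 's set \<Rightarrow> ('s \<Rightarrow> 's \<Rightarrow> real) \<Rightarrow> 's \<Rightarrow> (real \<Rightarrow> 'a \<Rightarrow> 's) \<Rightarrow> bool" where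
  "markov_jump_process M S q x0 X \<longleftrightarrow>
     countable S \<and>
     (\<forall>t\<ge>0. X t \<in> measurable M (count_space UNIV)) \<and>
     (\<forall>t\<ge>0. \<forall>\<omega>\<in>space M. X t \<omega> \<in> S) \<and>
     (\<forall>\<omega>\<in>space M. X 0 \<omega> = x0) \<and>
     (\<forall>\<omega>\<in>space M. \<forall>t\<ge>0. eventually (\<lambda>u. X u \<omega> = X t \<omega>) (at_right t)) \<and>
     (\<exists>P. transition_function S q P \<and>
       (\<forall>(n::nat) (t :: nat \<Rightarrow> real) x. \<forall>j\<in>S.
          0 \<le> t 0 \<and> strict_mono t \<and> (\<forall>i\<le>n. x i \<in> S) \<and>
          \<P>(\<omega> in M. \<forall>i\<le>n. X (t i) \<omega> = x i) > 0 \<longrightarrow>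
          \<P>(\<omega> in M. X (t (Suc n)) \<omega> = j \<bar> \<forall>i\<le>n. X (t i) \<omega> = x i)
            = P (t (Suc n) - t n) (x n) j))"

text \<open>Stochastic continuity is not listed, as it follows from right-continuity at \<open>0\<close> and
  stationarity of the increments.\<close>

definition levy_process :: "'a measure \<Rightarrow> (real \<Rightarrow> 'a \<Rightarrow> real) \<Rightarrow> bool" where
  "levy_process M D \<longleftrightarrow>
     (\<forall>t\<ge>0. D t \<in> borel_measurable M) \<and>
     (\<forall>\<omega>\<in>space M. D 0 \<omega> = 0) \<and>
     (\<forall>(n::nat) (t :: nat \<Rightarrow> real). 0 \<le> t 0 \<and> mono t \<longrightarrow>
        prob_space.indep_vars M (\<lambda>_. borel) (\<lambda>i \<omega>. D (t (Suc i)) \<omega> - D (t i) \<omega>) {..<n}) \<and>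
     (\<forall>s t. 0 \<le> s \<and> s \<le> t \<longrightarrow>
        distr M borel (\<lambda>\<omega>. D t \<omega> - D s \<omega>) = distr M borel (D (t - s))) \<and>
     (\<forall>\<omega>\<in>space M. \<forall>t\<ge>0. continuous (at_right t) (\<lambda>u. D u \<omega>)) \<and>
     (\<forall>\<omega>\<in>space M. \<forall>t>0. \<exists>l. ((\<lambda>u. D u \<omega>) \<longlongrightarrow> l) (at_left t))"

definition mixed_stable_subordinator ::
    "'a measure \<Rightarrow> real \<Rightarrow> real \<Rightarrow> real \<Rightarrow> real \<Rightarrow> (real \<Rightarrow> 'a \<Rightarrow> real) \<Rightarrow> bool" where
  "mixed_stable_subordinator M c1 \<alpha>1 c2 \<alpha>2 D \<longleftrightarrow>
     levy_process M D \<and>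
     (\<forall>\<omega>\<in>space M. mono_on {0..} (\<lambda>t. D t \<omega>)) \<and>
     (\<forall>t\<ge>0. \<forall>z>0. prob_space.expectation M (\<lambda>\<omega>. exp (- z * D t \<omega>))
        = exp (- t * (c1 * z powr \<alpha>1 + c2 * z powr \<alpha>2)))"

text \<open>For the subordinators above \<open>D s \<rightarrow> \<infinity>\<close> almost surely, so the value \<open>0\<close> for an
  empty set is a convention on a null set. It is needed because \<open>Inf {}\<close> is an unspecified,
  possibly negative real, at which a process on \<open>[0,\<infinity>)\<close> must not be evaluated.\<close>

definition inverse_subordinator :: "(real \<Rightarrow> 'a \<Rightarrow> real) \<Rightarrow> real \<Rightarrow> 'a \<Rightarrow> real" where
  "inverse_subordinator D t \<omega> =
     (if t = 0 \<or> {s. 0 \<le> s \<and> D s \<omega> > t} = {} then 0 else Inf {s. 0 \<le> s \<and> D s \<omega> > t})"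

definition time_change :: "(real \<Rightarrow> 'a \<Rightarrow> 's) \<Rightarrow> (real \<Rightarrow> 'a \<Rightarrow> real) \<Rightarrow> real \<Rightarrow> 'a \<Rightarrow> 's" where
  "time_change X Y t \<omega> = X (Y t \<omega>) \<omega>"

text \<open>Independence of the sigma-algebras generated by the two processes; the library constant
  \<open>indep_var\<close> needs both random elements to have the same value type.\<close>

definition independent_processes ::
    "'a measure \<Rightarrow> (real \<Rightarrow> 'a \<Rightarrow> 's) \<Rightarrow> (real \<Rightarrow> 'a \<Rightarrow> real) \<Rightarrow> bool" where
  "independent_processes M X Y \<longleftrightarrow>
     prob_space.indep_set M
       (sets (vimage_algebra (space M) (\<lambda>\<omega>. \<lambda>t\<in>{0..}. X t \<omega>) (Pi\<^sub>M {0..} (\<lambda>_. count_space UNIV))))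
       (sets (vimage_algebra (space M) (\<lambda>\<omega>. \<lambda>t\<in>{0..}. Y t \<omega>) (Pi\<^sub>M {0..} (\<lambda>_. borel))))"

definition erlang_states :: "nat \<Rightarrow> (nat \<times> nat) set" where
  "erlang_states k = {(n, s). 1 \<le> n \<and> 1 \<le> s \<and> s \<le> k} \<union> {(0, 0)}"

definition erlang_rate :: "real \<Rightarrow> real \<Rightarrow> nat \<Rightarrow> nat \<times> nat \<Rightarrow> nat \<times> nat \<Rightarrow> real" where
  "erlang_rate \<Lambda> \<mu> k = (\<lambda>(n, s) y.
     if (n, s) = (0, 0) then (if y = (1, k) then \<Lambda> else 0)
     else if y = (n + 1, s) then \<Lambda>
     else if 2 \<le> s \<and> y = (n, s - 1) then real k * \<mu>
     else if 2 \<le> n \<and> s = 1 \<and> y = (n - 1, k) then real k * \<mu>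
     else if n = 1 \<and> s = 1 \<and> y = (0, 0) then real k * \<mu>
     else 0)"

definition erlang_queue ::
    "'a measure \<Rightarrow> real \<Rightarrow> real \<Rightarrow> nat \<Rightarrow> (real \<Rightarrow> 'a \<Rightarrow> nat \<times> nat) \<Rightarrow> bool" where
  "erlang_queue M \<Lambda> \<mu> k Q \<longleftrightarrow>
     markov_jump_process M (erlang_states k) (erlang_rate \<Lambda> \<mu> k) (0, 0) Q"

definition state_prob :: "'a measure \<Rightarrow> (real \<Rightarrow> 'a \<Rightarrow> nat \<times> nat) \<Rightarrow> nat \<times> nat \<Rightarrow> real \<Rightarrow> real" where
  "state_prob M X x t = \<P>(\<omega> in M. X t \<omega> = x \<bar> X 0 \<omega> = (0, 0))"

end

theory Submission
  imports Defs
begin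

text \<open>Let \<open>A\<close> be the forward generator of the queue, a bounded operator, and \<open>\<phi> z = c1 z powr \<alpha>1 + c2 z powr \<alpha>2\<close>.
  Evaluated at an independent exponential time of rate \<open>z\<close>, the inverse subordinator is exponentially
  distributed with rate \<open>\<phi> z\<close>. With the Kolmogorov forward equation this shows that the vector \<open>v\<close> of the
  Laplace transforms of the state probabilities, multiplied by \<open>z\<close>, satisfies \<open>\<phi> z v = \<phi> z \<delta> + A v\<close>, where \<open>\<delta>\<close> is the
  unit vector of the initial state. On the other hand the fractional system has a solution given by an
  explicit series in the powers \<open>t powr (n a + m (a - b))\<close>, which converges so fast, thanks to the Gamma
  function in the denominators, that it can be differentiated, Caputo differentiated and Laplace
  transformed term by term. Its Laplace transform satisfies the same equation, which has only one bounded
  solution as soon as \<open>\<phi> z\<close> exceeds the norm of \<open>A\<close>. By uniqueness of Laplace transforms the state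
  probabilities equal the series for \<open>t > 0\<close>, and therefore inherit its regularity.\<close>

section \<open>Fractional power series\<close>

text \<open>The Caputo derivative in use is classical: the state probabilities must be
  differentiable at every positive time, with a derivative integrable against the kernel. The law of
  \<open>Y\<close> is known through Laplace transforms only and shows neither, hence the detour
  through an explicit function. The double series is a resolvent expansion. Solving for
  \<open>v\<close> gives the sum over n of \<phi>(z)^(-n) A^n \<delta>, and for orders a > b with
  weights \<open>c\<close>, \<open>d\<close> the factor \<phi>(z)^(-n) = z^(-n a) (c + d z^(-(a -
  b)))^(-n) is expanded in powers of z^(-(a - b)). This divides by \<open>c\<close>, so the weight
  of the leading order has to be positive. Bounded rates enter three times: for the forward
  equation, for the geometric growth of the coefficients, and for the uniqueness of the bounded
  solution. Right-continuity of \<open>Y\<close> is immediate from its definition as an infimum,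
  whereas continuity would require strictly increasing paths of \<open>D\<close>. The uniqueness
  theorem for Laplace transforms is therefore proved for right-continuous functions.\<close>

lemma has_bochner_integral_nonneg_lborel:
  fixes f :: "real \<Rightarrow> real"
  assumes "(f has_integral I) A" "\<And>x. x \<in> A \<Longrightarrow> 0 \<le> f x" "A \<in> sets borel"
    "f \<in> borel_measurable borel"
  shows "has_bochner_integral lborel (\<lambda>x. indicator A x * f x) I"
proof (rule has_bochner_integral_nn_integral)
  show "(\<lambda>x. indicator A x * f x) \<in> borel_measurable lborel" using assms(3,4) by measurable
  show "AE x in lborel. 0 \<le> indicator A x * f x"
    using assms(2) by (auto simp: indicator_def)
  show "0 \<le> I" using has_integral_nonneg[OF assms(1)] assms(2) by auto
  show "(\<integral>\<^sup>+ x. ennreal (indicator A x * f x) \<partial>lborel) = ennreal I"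
    using nn_integral_has_integral_lebesgue[OF assms(2,1)] by simp
qed

text \<open>Euler's integral is cut down to the interval from \<rho> to \<rho> + 1, where the
  integrand is at least the left-hand side. The parameter \<rho> stays free: matched to the size of
  t, it makes 1/Gamma beat any power of t.\<close>

lemma Gamma_ge_powr:
  fixes x \<rho> :: real
  assumes "1 \<le> \<rho>" "0 < x"
  shows "\<rho> powr (x - 1) * exp (- \<rho> - 1) \<le> Gamma x"
proof -
  have ge1: "\<rho> powr (y - 1) * exp (- \<rho> - 1) \<le> Gamma y" if "1 \<le> y" for y :: real
  proof -
    let ?c = "\<rho> powr (y - 1) * exp (- \<rho> - 1)"
    have "((\<lambda>t. if t \<in> {\<rho>..\<rho>+1} then ?c else 0) has_integral ?c) {0..}"
    proof -
      have "((\<lambda>t. ?c) has_integral ?c) {\<rho>..\<rho>+1}"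
        using has_integral_const_real[of ?c \<rho> "\<rho>+1"] by simp
      then show ?thesis
        using assms by (subst has_integral_restrict) auto
    qed
    moreover have "((\<lambda>t. t powr (y - 1) / exp t) has_integral Gamma y) {0..}"
      using Gamma_integral_real that by auto
    ultimately show ?thesis
    proof (rule has_integral_le)
      fix t :: real assume "t \<in> {0..}"
      have "\<rho> powr (y - 1) * exp (- \<rho> - 1) \<le> t powr (y - 1) * exp (- t)" if "t \<in> {\<rho>..\<rho>+1}"
        using that assms \<open>1 \<le> y\<close> by (intro mult_mono powr_mono2) auto
      then show "(if t \<in> {\<rho>..\<rho>+1} then ?c else 0) \<le> t powr (y - 1) / exp t"
        by (auto simp: exp_minus divide_inverse)
    qed
  qed
  show ?thesis
  proof (cases "1 \<le> x")
    case True then show ?thesis by (rule ge1)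
  next
    case False
    \<comment> \<open>For x < 1 the power in the integrand decreases, so the bound is taken at x + 1
      and brought back by Gamma (x + 1) = x Gamma x.\<close>
    have "\<rho> powr (x - 1) * exp (- \<rho> - 1) \<le> \<rho> powr (x + 1 - 1) * exp (- \<rho> - 1)"
      using assms by (intro mult_right_mono powr_mono) auto
    also have "\<dots> \<le> Gamma (x + 1)" using assms by (intro ge1) auto
    also have "\<dots> = x * Gamma x" using assms Gamma_plus1[of x] nonpos_Ints_nonpos[of x] by fastforce
    also have "\<dots> \<le> Gamma x" using False assms Gamma_real_pos[of x] by (simp add: mult_left_le_one_le)
    finally show ?thesis .
  qed
qed

text \<open>The case x = 0 is included on purpose: \<open>Gamma 0\<close> is 0 and so is its
  inverse, which agrees with the entire function 1/Gamma.\<close>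

lemma inverse_Gamma_le:
  fixes x \<rho> :: real
  assumes "1 \<le> \<rho>" "0 \<le> x"
  shows "inverse (Gamma x) \<le> exp (\<rho> + 1) * \<rho> * \<rho> powr (- x)" and "0 \<le> inverse (Gamma x)"
proof -
  show "0 \<le> inverse (Gamma x)"
    using assms Gamma_real_pos[of x] by (cases "x = 0") (auto intro: less_imp_le)
  show "inverse (Gamma x) \<le> exp (\<rho> + 1) * \<rho> * \<rho> powr (- x)"
  proof (cases "x = 0")
    case False
    then have "inverse (Gamma x) \<le> inverse (\<rho> powr (x - 1) * exp (- \<rho> - 1))"
      using assms Gamma_ge_powr[of \<rho> x] by (intro le_imp_inverse_le) auto
    also have "\<dots> = exp (\<rho> + 1) * \<rho> * \<rho> powr (- x)"
      using assms by (simp add: powr_diff powr_minus exp_diff exp_add exp_minus field_simps)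
    finally show ?thesis .
  qed (use assms in auto)
qed

text \<open>The Beta integral after the substitution y = t u. It says that the Caputo derivative of
  order \<alpha> maps t^\<gamma> / Gamma (1 + \<gamma>) to t^(\<gamma> - \<alpha>) / Gamma (1 +
  \<gamma> - \<alpha>).\<close>

lemma has_bochner_integral_powr_convolution:
  fixes t \<alpha> \<gamma> :: real
  assumes "0 < t" "\<alpha> < 1" "0 < \<gamma>"
  shows "has_bochner_integral lborel
    (\<lambda>y. indicator {0<..<t} y * ((t - y) powr (- \<alpha>) * y powr (\<gamma> - 1)))
    (Gamma \<gamma> * Gamma (1 - \<alpha>) / Gamma (1 + \<gamma> - \<alpha>) * t powr (\<gamma> - \<alpha>))"
proof -
  have "((\<lambda>u. u powr (\<gamma> - 1) * (1 - u) powr ((1 - \<alpha>) - 1)) has_integral Beta \<gamma> (1 - \<alpha>)) {0..1}"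
    using assms by (intro has_integral_Beta_real) auto
  then have "((\<lambda>u. u powr (\<gamma> - 1) * (1 - u) powr (-\<alpha>)) has_integral Beta \<gamma> (1 - \<alpha>)) {0<..<1}"
    by (simp add: has_integral_Icc_iff_Ioo)
  then have "has_bochner_integral lborel
     (\<lambda>u. indicator {0<..<1} u * (u powr (\<gamma> - 1) * (1 - u) powr (-\<alpha>))) (Beta \<gamma> (1 - \<alpha>))"
    by (rule has_bochner_integral_nonneg_lborel) auto
  from lborel_has_bochner_integral_real_affine_iff[THEN iffD1, OF _ this, of "inverse t" 0]
  have "has_bochner_integral lborel (\<lambda>y. indicator {0<..<1} (inverse t * y) *
      ((inverse t * y) powr (\<gamma> - 1) * (1 - inverse t * y) powr (-\<alpha>))) (t * Beta \<gamma> (1 - \<alpha>))"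
    using assms by simp
  then have "has_bochner_integral lborel (\<lambda>y. t powr (\<gamma> - 1 - \<alpha>) * (indicator {0<..<1} (inverse t * y) *
      ((inverse t * y) powr (\<gamma> - 1) * (1 - inverse t * y) powr (-\<alpha>))))
      (t powr (\<gamma> - 1 - \<alpha>) * (t * Beta \<gamma> (1 - \<alpha>)))"
    by (rule has_bochner_integral_mult_right)
  also have "(\<lambda>y. t powr (\<gamma> - 1 - \<alpha>) * (indicator {0<..<1} (inverse t * y) *
      ((inverse t * y) powr (\<gamma> - 1) * (1 - inverse t * y) powr (-\<alpha>)))) =
    (\<lambda>y. indicator {0<..<t} y * ((t - y) powr (- \<alpha>) * y powr (\<gamma> - 1)))"
  proof
    fix y
    have ind: "(indicator {0<..<1} (inverse t * y) :: real) = indicator {0<..<t} y"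
      using assms by (auto simp: indicator_def field_simps)
    have "t powr (\<gamma> - 1 - \<alpha>) * ((inverse t * y) powr (\<gamma> - 1) * (1 - inverse t * y) powr (-\<alpha>))
        = (t - y) powr (- \<alpha>) * y powr (\<gamma> - 1)" if "0 < y" "y < t"
    proof -
      have h1: "(1 - inverse t * y) = inverse t * (t - y)" using assms by (simp add: field_simps)
      have h2: "(inverse t * y) powr (\<gamma> - 1) = inverse t powr (\<gamma> - 1) * y powr (\<gamma> - 1)"
        using that assms by (simp add: powr_mult)
      have h3: "(inverse t * (t - y)) powr (-\<alpha>) = inverse t powr (-\<alpha>) * (t - y) powr (-\<alpha>)"
        using that assms by (simp add: powr_mult)
      have k: "t powr (\<gamma> - 1 - \<alpha>) * inverse t powr (\<gamma> - 1) * inverse t powr (-\<alpha>) = 1"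
        using assms by (simp add: inverse_powr powr_add[symmetric] powr_minus[symmetric])
      have "t powr (\<gamma> - 1 - \<alpha>) * ((inverse t * y) powr (\<gamma> - 1) * (1 - inverse t * y) powr (-\<alpha>))
         = (t powr (\<gamma> - 1 - \<alpha>) * inverse t powr (\<gamma> - 1) * inverse t powr (-\<alpha>)) *
           ((t - y) powr (- \<alpha>) * y powr (\<gamma> - 1))"
        unfolding h1 h2 h3 by (simp only: ac_simps)
      then show ?thesis by (simp only: k mult_1)
    qed
    then show "t powr (\<gamma> - 1 - \<alpha>) * (indicator {0<..<1} (inverse t * y) *
      ((inverse t * y) powr (\<gamma> - 1) * (1 - inverse t * y) powr (-\<alpha>))) =
     indicator {0<..<t} y * ((t - y) powr (- \<alpha>) * y powr (\<gamma> - 1))"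
      unfolding ind by (auto simp: indicator_def)
  qed
  also have "t powr (\<gamma> - 1 - \<alpha>) * (t * Beta \<gamma> (1 - \<alpha>)) =
      Gamma \<gamma> * Gamma (1 - \<alpha>) / Gamma (1 + \<gamma> - \<alpha>) * t powr (\<gamma> - \<alpha>)"
  proof -
    have "t powr (\<gamma> - 1 - \<alpha>) * t = t powr (\<gamma> - \<alpha>)"
      using assms powr_add[of t "\<gamma> - 1 - \<alpha>" 1] by simp
    then show ?thesis by (simp add: Beta_def algebra_simps)
  qed
  finally show ?thesis .
qed

lemma has_bochner_integral_exp_powr:
  fixes z \<gamma> :: real
  assumes "0 < z" "0 \<le> \<gamma>"
  shows "has_bochner_integral lborel (\<lambda>t. indicator {0<..} t * (exp (- z * t) * t powr \<gamma>))
    (Gamma (1 + \<gamma>) * z powr (- \<gamma>) / z)"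
proof -
  have "((\<lambda>u. u powr (\<gamma> + 1 - 1) / exp u) has_integral Gamma (\<gamma> + 1)) {0..}"
    using assms by (intro Gamma_integral_real) auto
  then have "has_bochner_integral lborel (\<lambda>u. indicator {0..} u * (u powr (\<gamma> + 1 - 1) / exp u)) (Gamma (\<gamma> + 1))"
    by (rule has_bochner_integral_nonneg_lborel) auto
  from lborel_has_bochner_integral_real_affine_iff[THEN iffD1, OF _ this, of "z" 0]
  have "has_bochner_integral lborel (\<lambda>t. z powr (-\<gamma>) * (indicator {0..} (z * t) * ((z * t) powr \<gamma> / exp (z * t))))
     (z powr (-\<gamma>) * (Gamma (\<gamma> + 1) / z))"
    using assms by (intro has_bochner_integral_mult_right) (simp add: divide_inverse_commute)
  moreover have "AE t in lborel. z powr (-\<gamma>) * (indicator {0..} (z * t) * ((z * t) powr \<gamma> / exp (z * t))) =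
     indicator {0<..} t * (exp (- z * t) * t powr \<gamma>)"
    using AE_lborel_singleton[of 0]
  proof eventually_elim
    case (elim t)
    then show ?case using assms
      by (auto simp: indicator_def powr_mult powr_minus exp_minus field_simps zero_le_mult_iff)
  qed
  ultimately have "has_bochner_integral lborel (\<lambda>t. indicator {0<..} t * (exp (- z * t) * t powr \<gamma>))
      (z powr (-\<gamma>) * (Gamma (\<gamma> + 1) / z))"
    by (subst (asm) has_bochner_integral_cong_AE) auto
  then show ?thesis by (simp add: algebra_simps)
qed

text \<open>Each term of the series has a constant sign in t. Hence the integral of its norm is the
  norm of its integral, and the exchange of sum and integral needs no further estimate.\<close>

lemma abs_mult_nonneg_sgn: "0 \<le> K \<Longrightarrow> \<bar>v * K\<bar> = sgn v * (v * K)" for v K :: real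
  by (cases "0 \<le> v") (auto simp: abs_mult sgn_if)

text \<open>\<open>summable_weights\<close> says that the termwise Laplace transform, with terms w
  z^(-\<gamma>) up to a factor 1/z, converges absolutely at z = B. Through the Gamma bound this
  single condition controls the series and its derivatives at all positive times.\<close>

locale fractional_series =
  fixes w \<gamma> :: "nat \<Rightarrow> real" and B :: real
  assumes exponent_nonneg: "\<And>i. 0 \<le> \<gamma> i"
    and B_ge_1: "1 \<le> B"
    and summable_weights: "summable (\<lambda>i. \<bar>w i\<bar> * B powr (- \<gamma> i))"
begin

definition fsum :: "real \<Rightarrow> real" where
  "fsum t = (\<Sum>i. w i * (t powr \<gamma> i * inverse (Gamma (\<gamma> i + 1))))"

text \<open>The termwise derivative of \<open>fsum\<close>. A constant term drops out by itself,
  because \<open>inverse (Gamma 0)\<close> is 0.\<close>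

definition fsum' :: "real \<Rightarrow> real" where
  "fsum' t = (\<Sum>i. w i * (t powr (\<gamma> i - 1) * inverse (Gamma (\<gamma> i))))"

text \<open>Taking \<rho> = B T turns T^\<gamma> \<rho>^(-\<gamma>) into B^(-\<gamma>), the weight
  of the summability assumption. The shift \<delta> is 1 for the series, 0 for its derivative and 1
  - \<alpha> for its Caputo derivative.\<close>

lemma term_bound:
  assumes "1 \<le> T" "0 \<le> t" "t \<le> T" "0 \<le> \<delta>"
  shows "norm (w i * (t powr \<gamma> i * inverse (Gamma (\<gamma> i + \<delta>))))
    \<le> exp (B * T + 1) * (B * T) * (\<bar>w i\<bar> * B powr (- \<gamma> i))"
proof -
  define \<rho> where "\<rho> = B * T"
  have \<rho>: "1 \<le> \<rho>" using assms B_ge_1 mult_mono[of 1 B 1 T] by (simp add: \<rho>_def)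
  have "inverse (Gamma (\<gamma> i + \<delta>)) \<le> exp (\<rho> + 1) * \<rho> * \<rho> powr (- (\<gamma> i + \<delta>))"
    using inverse_Gamma_le(1)[OF \<rho>, of "\<gamma> i + \<delta>"] exponent_nonneg[of i] assms by simp
  also have "\<dots> \<le> exp (\<rho> + 1) * \<rho> * \<rho> powr (- \<gamma> i)"
    using \<rho> assms by (intro mult_left_mono powr_mono) auto
  finally have 1: "inverse (Gamma (\<gamma> i + \<delta>)) \<le> exp (\<rho> + 1) * \<rho> * \<rho> powr (- \<gamma> i)" .
  have 0: "0 \<le> inverse (Gamma (\<gamma> i + \<delta>))"
    using inverse_Gamma_le(2)[of 1] exponent_nonneg[of i] assms by auto
  have "t powr \<gamma> i \<le> T powr \<gamma> i"
    using assms exponent_nonneg[of i] by (intro powr_mono2) auto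
  then have "t powr \<gamma> i * inverse (Gamma (\<gamma> i + \<delta>)) \<le> T powr \<gamma> i * (exp (\<rho> + 1) * \<rho> * \<rho> powr (- \<gamma> i))"
    using 0 1 by (intro mult_mono) auto
  also have "\<dots> = exp (\<rho> + 1) * \<rho> * B powr (- \<gamma> i)"
    using assms B_ge_1 by (simp add: \<rho>_def powr_mult powr_minus field_simps)
  finally have "\<bar>w i\<bar> * (t powr \<gamma> i * inverse (Gamma (\<gamma> i + \<delta>)))
      \<le> \<bar>w i\<bar> * (exp (\<rho> + 1) * \<rho> * B powr (- \<gamma> i))"
    by (intro mult_left_mono) auto
  then show ?thesis using 0 by (simp add: abs_mult \<rho>_def[symmetric] ac_simps)
qed

lemma summable_norm_term:
  assumes "0 \<le> t" "0 \<le> \<delta>"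
  shows "summable (\<lambda>i. norm (w i * (t powr \<gamma> i * inverse (Gamma (\<gamma> i + \<delta>)))))"
proof (rule summable_comparison_test')
  show "summable (\<lambda>i. exp (B * max 1 t + 1) * (B * max 1 t) * (\<bar>w i\<bar> * B powr (- \<gamma> i)))"
    by (intro summable_mult summable_weights)
  show "norm (norm (w i * (t powr \<gamma> i * inverse (Gamma (\<gamma> i + \<delta>)))))
    \<le> exp (B * max 1 t + 1) * (B * max 1 t) * (\<bar>w i\<bar> * B powr (- \<gamma> i))" if "i \<ge> 0" for i
    unfolding real_norm_def abs_idempotent using assms
    by (intro term_bound[unfolded real_norm_def]) auto
qed

text \<open>The derivative may be singular at 0, so uniform convergence is shown on the interval
  from t/2 to 2t only. A derivative term is the case \<delta> = 0 of \<open>term_bound\<close>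
  divided by x, which produces the factor 2/t.\<close>

lemma fsum_has_derivative:
  assumes "0 < t"
  shows "(fsum has_field_derivative fsum' t) (at t)"
  unfolding fsum_def fsum'_def
proof (rule has_field_derivative_series'(2))
  show "convex {t/2..2*t}" by simp
  show "t \<in> {t/2..2*t}" "t \<in> interior {t/2..2*t}" using assms by auto
  show "summable (\<lambda>i. w i * (t powr \<gamma> i * inverse (Gamma (\<gamma> i + 1))))"
    using summable_norm_term[of t 1] assms by (auto intro: summable_norm_cancel[of "\<lambda>i. w i * (t powr \<gamma> i * inverse (Gamma (\<gamma> i + 1)))"])
  show "((\<lambda>t. w i * (t powr \<gamma> i * inverse (Gamma (\<gamma> i + 1)))) has_field_derivative
     w i * (x powr (\<gamma> i - 1) * inverse (Gamma (\<gamma> i)))) (at x within {t/2..2*t})"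
    if "x \<in> {t/2..2*t}" for i x
  proof (cases "\<gamma> i = 0")
    case True
    have "((\<lambda>t. w i * (t powr \<gamma> i * inverse (Gamma (\<gamma> i + 1)))) has_field_derivative 0) (at x within {t/2..2*t})"
    proof (rule has_field_derivative_transform_within[where f="\<lambda>_. w i * inverse (Gamma (\<gamma> i + 1))" and d=1])
    qed (use that assms in \<open>auto simp: True\<close>)
    then show ?thesis by (simp add: True)
  next
    case False
    then have "0 < \<gamma> i" using exponent_nonneg[of i] by simp
    then have "Gamma (\<gamma> i + 1) = \<gamma> i * Gamma (\<gamma> i)"
      using Gamma_plus1[of "\<gamma> i"] nonpos_Ints_nonpos[of "\<gamma> i"] by fastforce
    moreover have "x > 0" using that assms by auto
    moreover have "((\<lambda>t. w i * (t powr \<gamma> i * inverse (Gamma (\<gamma> i + 1)))) has_field_derivative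
        w i * ((\<gamma> i * x powr (\<gamma> i - 1)) * inverse (Gamma (\<gamma> i + 1)))) (at x within {t/2..2*t})"
      using \<open>x > 0\<close>
      by (intro DERIV_cmult DERIV_cmult_right has_field_derivative_at_within[OF has_real_derivative_powr])
    moreover have "w i * ((\<gamma> i * x powr (\<gamma> i - 1)) * inverse (\<gamma> i * Gamma (\<gamma> i)))
        = w i * (x powr (\<gamma> i - 1) * inverse (Gamma (\<gamma> i)))"
      using False by simp
    ultimately show ?thesis by metis
  qed
  show "uniformly_convergent_on {t/2..2*t}
     (\<lambda>n x. \<Sum>i<n. w i * (x powr (\<gamma> i - 1) * inverse (Gamma (\<gamma> i))))"
  proof (rule Weierstrass_m_test')
    define T where "T = max 1 (2*t)"
    show "summable (\<lambda>i. exp (B * T + 1) * (B * T) * (\<bar>w i\<bar> * B powr (- \<gamma> i)) * (2/t))"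
      by (intro summable_mult summable_mult2 summable_weights)
    fix i x assume x: "x \<in> {t/2..2*t}"
    have "norm (w i * (x powr (\<gamma> i - 1) * inverse (Gamma (\<gamma> i)))) =
        norm (w i * (x powr \<gamma> i * inverse (Gamma (\<gamma> i + 0)))) * inverse x"
      using x assms by (simp add: powr_diff abs_mult field_simps)
    also have "\<dots> \<le> exp (B * T + 1) * (B * T) * (\<bar>w i\<bar> * B powr (- \<gamma> i)) * (2/t)"
    proof (intro mult_mono term_bound)
      show "inverse x \<le> 2 / t" using x assms by (simp add: field_simps)
    qed (use x assms B_ge_1 in \<open>auto simp: T_def\<close>)
    finally show "norm (w i * (x powr (\<gamma> i - 1) * inverse (Gamma (\<gamma> i))))
      \<le> exp (B * T + 1) * (B * T) * (\<bar>w i\<bar> * B powr (- \<gamma> i)) * (2/t)" .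
  qed
qed

lemma isCont_fsum: "0 < t \<Longrightarrow> isCont fsum t"
  using fsum_has_derivative DERIV_isCont by blast

lemma summable_caputo_terms:
  assumes "0 < t" "0 < \<alpha>" "\<alpha> < 1"
  shows "summable (\<lambda>i. norm (if \<gamma> i = 0 then 0
    else w i * (t powr (\<gamma> i - \<alpha>) * inverse (Gamma (1 + \<gamma> i - \<alpha>)))))"
proof (rule summable_comparison_test')
  show "summable (\<lambda>i. norm (w i * (t powr \<gamma> i * inverse (Gamma (\<gamma> i + (1 - \<alpha>))))) * t powr (- \<alpha>))"
    using assms by (intro summable_mult2 summable_norm_term) auto
  show "norm (norm (if \<gamma> i = 0 then 0 else w i * (t powr (\<gamma> i - \<alpha>) * inverse (Gamma (1 + \<gamma> i - \<alpha>)))))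
      \<le> norm (w i * (t powr \<gamma> i * inverse (Gamma (\<gamma> i + (1 - \<alpha>))))) * t powr (- \<alpha>)" for i
    using assms by (simp add: powr_diff powr_minus abs_mult field_simps)
qed

text \<open>Terms of exponent 0 are set to 0 because the Caputo derivative annihilates constants;
  the formula for positive exponents would give a multiple of t^(-\<alpha>) there instead.\<close>

lemma caputo_fsum:
  assumes "0 < t" "0 < \<alpha>" "\<alpha> < 1"
  shows "caputo_differentiable \<alpha> fsum t" (is ?diff)
    and "(\<lambda>i. if \<gamma> i = 0 then 0 else w i * (t powr (\<gamma> i - \<alpha>) * inverse (Gamma (1 + \<gamma> i - \<alpha>))))
           sums caputo_deriv \<alpha> fsum t"
proof -
  define f where "f i y = w i * inverse (Gamma (\<gamma> i)) *
    (indicator {0<..<t} y * ((t - y) powr (- \<alpha>) * y powr (\<gamma> i - 1)))" for i y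
  define c where "c i = (if \<gamma> i = 0 then 0
    else w i * (t powr (\<gamma> i - \<alpha>) * inverse (Gamma (1 + \<gamma> i - \<alpha>))))" for i
  have pos: "0 < Gamma (1 - \<alpha>)" using assms by simp
  have hf: "has_bochner_integral lborel (\<lambda>y. f i y) (Gamma (1 - \<alpha>) * c i)" for i
  proof (cases "\<gamma> i = 0")
    case False
    then have g: "0 < \<gamma> i" using exponent_nonneg[of i] by simp
    show ?thesis
      unfolding f_def
      using has_bochner_integral_mult_right[OF has_bochner_integral_powr_convolution[OF assms(1,3) g],
          of "w i * inverse (Gamma (\<gamma> i))"] Gamma_real_pos[OF g] g
      by (simp add: c_def field_simps)
  qed (auto simp: f_def c_def)
  have nf: "norm (f i y) = sgn (w i) * f i y" for i y
  proof -
    have "0 \<le> inverse (Gamma (\<gamma> i)) * (indicator {0<..<t} y * ((t - y) powr (- \<alpha>) * y powr (\<gamma> i - 1)))"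
      using inverse_Gamma_le(2)[of 1 "\<gamma> i"] exponent_nonneg[of i] by (intro mult_nonneg_nonneg) auto
    then show ?thesis
      unfolding f_def mult.assoc real_norm_def by (rule abs_mult_nonneg_sgn)
  qed
  have hnf: "has_bochner_integral lborel (\<lambda>y. norm (f i y)) (Gamma (1 - \<alpha>) * norm (c i))" for i
  proof -
    have "0 \<le> inverse (Gamma (1 + \<gamma> i - \<alpha>))"
      using assms exponent_nonneg[of i] Gamma_real_pos[of "1 + \<gamma> i - \<alpha>"] by auto
    then have "norm (c i) = sgn (w i) * c i"
      unfolding c_def real_norm_def
      by (cases "\<gamma> i = 0") (simp, simp only: if_False, intro abs_mult_nonneg_sgn mult_nonneg_nonneg powr_ge_zero)
    then show ?thesis
      using has_bochner_integral_mult_right[OF hf[of i], of "sgn (w i)"]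
      unfolding nf by (simp add: mult_ac)
  qed
  have sc: "summable (\<lambda>i. norm (c i))"
    unfolding c_def using assms by (rule summable_caputo_terms)
  have sf: "summable (\<lambda>i. norm (f i y))" for y
  proof (cases "y \<in> {0<..<t}")
    case True
    have "summable (\<lambda>i. norm (w i * (y powr \<gamma> i * inverse (Gamma (\<gamma> i + 0)))) * (inverse y * (t - y) powr (-\<alpha>)))"
      using True by (intro summable_mult2 summable_norm_term) auto
    also have "(\<lambda>i. norm (w i * (y powr \<gamma> i * inverse (Gamma (\<gamma> i + 0)))) * (inverse y * (t - y) powr (-\<alpha>)))
      = (\<lambda>i. norm (f i y))"
      using True by (auto simp: f_def fun_eq_iff abs_mult powr_diff divide_inverse)
    finally show ?thesis .
  qed (simp add: f_def)
  \<comment> \<open>The sum of the integrable terms \<open>f i\<close> is exactly the Caputo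
    integrand, so integrability of the sum is the analytic half of
    \<open>caputo_differentiable\<close>.\<close>
  have s: "(\<Sum>i. f i y) = indicator {0<..<t} y * ((t - y) powr (- \<alpha>) * deriv fsum y)" for y
  proof (cases "y \<in> {0<..<t}")
    case True
    have sm: "summable (\<lambda>i. w i * (y powr (\<gamma> i - 1) * inverse (Gamma (\<gamma> i))))"
    proof -
      have "summable (\<lambda>i. norm (w i * (y powr \<gamma> i * inverse (Gamma (\<gamma> i + 0)))) * inverse y)"
        using True by (intro summable_mult2 summable_norm_term) auto
      then have "summable (\<lambda>i. norm (w i * (y powr (\<gamma> i - 1) * inverse (Gamma (\<gamma> i)))))"
        using True by (simp add: abs_mult powr_diff divide_inverse mult_ac)
      then show ?thesis by (rule summable_norm_cancel)
    qed
    have "deriv fsum y = fsum' y" using True by (intro DERIV_imp_deriv fsum_has_derivative) auto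
    moreover have "(\<Sum>i. f i y) = (\<Sum>i. (t - y) powr (- \<alpha>) * (w i * (y powr (\<gamma> i - 1) * inverse (Gamma (\<gamma> i)))))"
      using True by (simp add: f_def mult_ac)
    ultimately show ?thesis using True sm by (simp add: fsum'_def suminf_mult)
  qed (simp add: f_def)
  note int = integrable_suminf[of lborel f] sums_integral[of lborel f]
  have I: "integrable lborel (f i)" "integral\<^sup>L lborel (f i) = Gamma (1 - \<alpha>) * c i" for i
    using hf[of i] by (auto simp: has_bochner_integral_iff)
  have N: "summable (\<lambda>i. \<integral>y. norm (f i y) \<partial>lborel)"
    using hnf sc by (simp add: has_bochner_integral_iff summable_mult)
  have "integrable lborel (\<lambda>y. \<Sum>i. f i y)"
    by (rule int(1)) (use I sf N in auto)
  then show ?diff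
    using fsum_has_derivative
    by (auto simp: caputo_differentiable_def set_integrable_def s real_differentiable_def) blast
  have "(\<lambda>i. integral\<^sup>L lborel (f i)) sums (\<integral>y. (\<Sum>i. f i y) \<partial>lborel)"
    by (rule int(2)) (use I sf N in auto)
  then have "(\<lambda>i. Gamma (1 - \<alpha>) * c i) sums (LINT y:{0<..<t}|lborel. (t - y) powr (- \<alpha>) * deriv fsum y)"
    by (simp add: I(2) s set_lebesgue_integral_def)
  from sums_mult[OF this, of "1 / Gamma (1 - \<alpha>)"]
  have "c sums caputo_deriv \<alpha> fsum t" using pos by (simp add: caputo_deriv_def)
  then show "(\<lambda>i. if \<gamma> i = 0 then 0 else w i * (t powr (\<gamma> i - \<alpha>) * inverse (Gamma (1 + \<gamma> i - \<alpha>))))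
           sums caputo_deriv \<alpha> fsum t"
    by (simp add: c_def[abs_def])
qed

lemma summable_laplace_terms:
  assumes "B \<le> z"
  shows "summable (\<lambda>i. norm (w i * z powr (- \<gamma> i)))"
proof (rule summable_comparison_test'[OF summable_weights])
  fix i
  have "z powr (- \<gamma> i) \<le> B powr (- \<gamma> i)"
    using assms B_ge_1 exponent_nonneg[of i] by (intro powr_mono2') auto
  then show "norm (norm (w i * z powr (- \<gamma> i))) \<le> \<bar>w i\<bar> * B powr (- \<gamma> i)"
    by (simp add: abs_mult mult_left_mono)
qed

lemma laplace_fsum:
  assumes "B \<le> z"
  shows "set_integrable lborel {0<..} (\<lambda>t. exp (- z * t) * fsum t)"
    and "(\<lambda>i. w i * z powr (- \<gamma> i)) sums (z * (LINT t:{0<..}|lborel. exp (- z * t) * fsum t))"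
proof -
  have z: "0 < z" using assms B_ge_1 by simp
  define f where "f i t = w i * inverse (Gamma (\<gamma> i + 1)) *
    (indicator {0<..} t * (exp (- z * t) * t powr \<gamma> i))" for i t
  have G: "0 < Gamma (\<gamma> i + 1)" for i using exponent_nonneg[of i] by (intro Gamma_real_pos) auto
  have hf: "has_bochner_integral lborel (\<lambda>t. f i t) (w i * z powr (- \<gamma> i) / z)" for i
  proof -
    have "w i * inverse (Gamma (\<gamma> i + 1)) * (Gamma (1 + \<gamma> i) * z powr (- \<gamma> i) / z) = w i * z powr (- \<gamma> i) / z"
      using G[of i] by (simp add: add.commute[of 1])
    from has_bochner_integral_mult_right[OF has_bochner_integral_exp_powr[OF z exponent_nonneg[of i]],
        of "w i * inverse (Gamma (\<gamma> i + 1))", unfolded this]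
    show ?thesis unfolding f_def .
  qed
  have nf: "norm (f i t) = sgn (w i) * f i t" for i t
  proof -
    have "0 \<le> inverse (Gamma (\<gamma> i + 1)) * (indicator {0<..} t * (exp (- z * t) * t powr \<gamma> i))"
      using G[of i] by (intro mult_nonneg_nonneg) auto
    then show ?thesis
      unfolding f_def mult.assoc real_norm_def by (rule abs_mult_nonneg_sgn)
  qed
  have hnf: "has_bochner_integral lborel (\<lambda>t. norm (f i t)) (norm (w i * z powr (- \<gamma> i)) / z)" for i
    using has_bochner_integral_mult_right[OF hf[of i], of "sgn (w i)"]
      abs_mult_nonneg_sgn[of "z powr (- \<gamma> i)" "w i"]
    unfolding nf by simp
  have sf: "summable (\<lambda>i. norm (f i t))" for t
  proof (cases "0 < t")
    case True
    have "summable (\<lambda>i. norm (w i * (t powr \<gamma> i * inverse (Gamma (\<gamma> i + 1)))) * exp (- z * t))"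
      using True by (intro summable_mult2 summable_norm_term) auto
    also have "(\<lambda>i. norm (w i * (t powr \<gamma> i * inverse (Gamma (\<gamma> i + 1)))) * exp (- z * t))
      = (\<lambda>i. norm (f i t))"
      using True by (auto simp: f_def fun_eq_iff abs_mult)
    finally show ?thesis .
  qed (simp add: f_def)
  have s: "(\<Sum>i. f i t) = indicator {0<..} t * (exp (- z * t) * fsum t)" for t
  proof (cases "0 < t")
    case True
    have "summable (\<lambda>i. w i * (t powr \<gamma> i * inverse (Gamma (\<gamma> i + 1))))"
      using summable_norm_term[of t 1] True by (auto intro: summable_norm_cancel[of "\<lambda>i. w i * (t powr \<gamma> i * inverse (Gamma (\<gamma> i + 1)))"])
    then have "(\<Sum>i. exp (- z * t) * (w i * (t powr \<gamma> i * inverse (Gamma (\<gamma> i + 1))))) = exp (- z * t) * fsum t"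
      unfolding fsum_def by (rule suminf_mult)
    then show ?thesis using True by (simp add: f_def mult_ac)
  qed (simp add: f_def)
  have I: "integrable lborel (f i)" "integral\<^sup>L lborel (f i) = w i * z powr (- \<gamma> i) / z" for i
    using hf[of i] by (auto simp: has_bochner_integral_iff)
  have N: "summable (\<lambda>i. \<integral>y. norm (f i y) \<partial>lborel)"
    using hnf summable_laplace_terms[OF assms] by (simp add: has_bochner_integral_iff summable_divide)
  have "integrable lborel (\<lambda>t. \<Sum>i. f i t)"
    by (rule integrable_suminf) (use I sf N in auto)
  then show "set_integrable lborel {0<..} (\<lambda>t. exp (- z * t) * fsum t)"
    by (simp add: set_integrable_def s)
  have "(\<lambda>i. integral\<^sup>L lborel (f i)) sums (\<integral>t. (\<Sum>i. f i t) \<partial>lborel)"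
    by (rule sums_integral) (use I sf N in auto)
  then have "(\<lambda>i. w i * z powr (- \<gamma> i) / z) sums (LINT t:{0<..}|lborel. exp (- z * t) * fsum t)"
    by (simp add: I(2) s set_lebesgue_integral_def)
  from sums_mult[OF this, of z]
  show "(\<lambda>i. w i * z powr (- \<gamma> i)) sums (z * (LINT t:{0<..}|lborel. exp (- z * t) * fsum t))"
    using z by simp
qed

end

text \<open>Agreement at positive times is all that can be offered: since
  \<open>0 powr 0 = 0\<close>, every term of the series vanishes at time 0, whereas the probability
  of the initial state is 1 there. It suffices because only derivatives at positive times
  enter.\<close>

lemma caputo_cong:
  assumes "\<And>y. 0 < y \<Longrightarrow> f y = g y"
  shows "caputo_deriv \<alpha> f t = caputo_deriv \<alpha> g t"
    and "caputo_differentiable \<alpha> f t \<longleftrightarrow> caputo_differentiable \<alpha> g t"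
proof -
  have ev: "eventually (\<lambda>x. f x = g x) (nhds y)" if "0 < y" for y
    using eventually_nhds_in_open[of "{0<..}" y] that assms by (auto elim!: eventually_mono)
  have d: "deriv f y = deriv g y" if "0 < y" for y
    using ev[OF that] by (rule deriv_cong_ev) simp
  have D: "f differentiable (at y) \<longleftrightarrow> g differentiable (at y)" if "0 < y" for y
    using DERIV_cong_ev[OF refl ev[OF that] refl] by (auto simp: real_differentiable_def)
  show "caputo_deriv \<alpha> f t = caputo_deriv \<alpha> g t"
    unfolding caputo_deriv_def by (auto intro!: arg_cong[where f="\<lambda>x. _ * x"] set_lebesgue_integral_cong simp: d)
  show "caputo_differentiable \<alpha> f t \<longleftrightarrow> caputo_differentiable \<alpha> g t"
    unfolding caputo_differentiable_def
    by (intro conj_cong set_integrable_cong ball_cong) (auto simp: d D)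
qed

section \<open>Uniqueness of Laplace transforms\<close>

text \<open>With x = exp (- t), the monomial x^i shifts the Laplace variable from z to z + i, so the
  vanishing transforms are vanishing moments.\<close>

lemma real_polynomial_function_integral_zero:
  fixes h :: "real \<Rightarrow> real"
  assumes int: "set_integrable lborel {0<..} (\<lambda>t. exp (- z * t) * h t)"
    and zero: "\<And>n::nat. (LINT t:{0<..}|lborel. exp (- (z + real n) * t) * h t) = 0"
    and p: "real_polynomial_function p"
  shows "(LINT t:{0<..}|lborel. exp (- z * t) * h t * p (exp (- t))) = 0"
proof -
  obtain a n where a: "p = (\<lambda>x. \<Sum>i\<le>n. a i * x ^ i)"
    using p real_polynomial_function_iff_sum by blast
  have eq: "exp (- z * t) * h t * (a i * exp (- t) ^ i) = a i * (exp (- (z + real i) * t) * h t)" for t i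
  proof -
    have "exp (- (z + real i) * t) = exp (- z * t) * exp (- t) ^ i"
      by (simp add: exp_of_nat_mult[symmetric] exp_add[symmetric] algebra_simps)
    then show ?thesis by simp
  qed
  have int': "set_integrable lborel {0<..} (\<lambda>t. exp (- (z + real i) * t) * h t)" for i
  proof (rule set_integrable_bound[OF int])
    show "set_borel_measurable lborel {0<..} (\<lambda>t. exp (- (z + real i) * t) * h t)"
    proof -
      have "set_borel_measurable lborel {0<..} (\<lambda>t. exp (- z * t) * h t)"
        using int unfolding set_integrable_def set_borel_measurable_def by (rule borel_measurable_integrable)
      then have "(\<lambda>t. exp (- real i * t) * (indicator {0<..} t *\<^sub>R (exp (- z * t) * h t))) \<in> borel_measurable lborel"
        unfolding set_borel_measurable_def by measurable
      also have "(\<lambda>t. exp (- real i * t) * (indicator {0<..} t *\<^sub>R (exp (- z * t) * h t))) =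
          (\<lambda>t. indicator {0<..} t *\<^sub>R (exp (- (z + real i) * t) * h t))"
      proof
        fix t
        have "exp (- real i * t) * exp (- z * t) = exp (- (z + real i) * t)"
          by (simp add: exp_add[symmetric] algebra_simps)
        then show "exp (- real i * t) * (indicator {0<..} t *\<^sub>R (exp (- z * t) * h t)) =
            indicator {0<..} t *\<^sub>R (exp (- (z + real i) * t) * h t)"
          by (metis mult.assoc mult_scaleR_right)
      qed
      finally show ?thesis unfolding set_borel_measurable_def .
    qed
    show "AE t in lborel. t \<in> {0<..} \<longrightarrow> norm (exp (- (z + real i) * t) * h t) \<le> norm (exp (- z * t) * h t)"
    proof (intro AE_I2 impI)
      fix t :: real assume "t \<in> {0<..}"
      then have "- (z + real i) * t \<le> - z * t" by (intro mult_right_mono) auto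
      then show "norm (exp (- (z + real i) * t) * h t) \<le> norm (exp (- z * t) * h t)"
        unfolding real_norm_def abs_mult abs_exp_cancel by (intro mult_right_mono) auto
    qed
  qed
  have "(LINT t:{0<..}|lborel. exp (- z * t) * h t * p (exp (- t)))
     = (LINT t:{0<..}|lborel. (\<Sum>i\<le>n. a i * (exp (- (z + real i) * t) * h t)))"
    unfolding a sum_distrib_left eq ..
  also have "\<dots> = (\<Sum>i\<le>n. (LINT t:{0<..}|lborel. a i * (exp (- (z + real i) * t) * h t)))"
    unfolding set_lebesgue_integral_def scaleR_sum_right
    using int' by (intro Bochner_Integration.integral_sum) (auto simp: set_integrable_def[symmetric] simp del: real_scaleR_def)
  also have "\<dots> = 0" unfolding set_integral_mult_right zero by simp
  finally show ?thesis .
qed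

text \<open>Weierstrass approximation on the unit interval, the range of exp (- t), extends the
  vanishing from polynomials to continuous test functions.\<close>

lemma continuous_integral_zero:
  fixes h :: "real \<Rightarrow> real"
  assumes int: "set_integrable lborel {0<..} (\<lambda>t. exp (- z * t) * h t)"
    and zero: "\<And>n::nat. (LINT t:{0<..}|lborel. exp (- (z + real n) * t) * h t) = 0"
    and \<psi>: "continuous_on {0..1} \<psi>" "\<psi> \<in> borel_measurable borel"
  shows "(LINT t:{0<..}|lborel. exp (- z * t) * h t * \<psi> (exp (- t))) = 0"
proof -
  define H where "H t = indicator {0<..} t * (exp (- z * t) * h t)" for t
  have H: "integrable lborel H" using int by (simp add: set_integrable_def H_def[abs_def])
  define C where "C = (\<integral>t. \<bar>H t\<bar> \<partial>lborel)"
  have "\<bar>LINT t:{0<..}|lborel. exp (- z * t) * h t * \<psi> (exp (- t))\<bar> \<le> 0 + e" if "e > 0" for e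
  proof -
    have C: "0 \<le> C" unfolding C_def by (intro integral_nonneg_AE) auto
    \<comment> \<open>The error is at most d times the total mass \<open>C\<close> of
      \<open>H\<close>; adding 1 avoids a division by zero.\<close>
    define d where "d = e / (C + 1)"
    have d: "0 < d" using that C by (simp add: d_def)
    obtain p where p: "real_polynomial_function p" "\<And>x. x \<in> {0..1} \<Longrightarrow> \<bar>\<psi> x - p x\<bar> < d"
      using Stone_Weierstrass_real_polynomial_function[of "{0..1}" \<psi> d] \<psi>(1) d by (auto simp: compact_Icc)
    have pm: "p \<in> borel_measurable borel"
      using p(1) by (intro borel_measurable_continuous_onI continuous_on_polymonial_function)
        (simp add: real_polynomial_function_eq)
    have bnd: "\<bar>H t * \<psi> (exp (- t)) - H t * p (exp (- t))\<bar> \<le> d * \<bar>H t\<bar>" for t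
    proof (cases "0 < t")
      case True
      then have "\<bar>\<psi> (exp (-t)) - p (exp (-t))\<bar> \<le> d" using p(2)[of "exp (-t)"] by (auto intro: less_imp_le)
      then show ?thesis
        using mult_left_mono[of "\<bar>\<psi> (exp (- t)) - p (exp (- t))\<bar>" d "\<bar>H t\<bar>"]
        by (simp add: right_diff_distrib[symmetric] abs_mult mult.commute)
    qed (simp add: H_def)
    have i1: "integrable lborel (\<lambda>t. H t * \<psi> (exp (- t)) - H t * p (exp (- t)))"
    proof (rule Bochner_Integration.integrable_bound[where f="\<lambda>t. d * \<bar>H t\<bar>"])
      show "(\<lambda>t. H t * \<psi> (exp (- t)) - H t * p (exp (- t))) \<in> borel_measurable lborel"
        using \<psi>(2) pm H[THEN borel_measurable_integrable] by measurable
    qed (use bnd H d in \<open>auto simp: abs_mult\<close>)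
    have "bounded (p ` {0..1})"
      using p(1) by (intro compact_imp_bounded compact_continuous_image continuous_on_polymonial_function compact_Icc)
        (simp add: real_polynomial_function_eq)
    then obtain K where K: "\<And>x. x \<in> {0..1} \<Longrightarrow> \<bar>p x\<bar> \<le> K"
      unfolding bounded_iff by (metis imageI real_norm_def)
    have i2: "integrable lborel (\<lambda>t. H t * p (exp (- t)))"
    proof (rule Bochner_Integration.integrable_bound[where f="\<lambda>t. K * \<bar>H t\<bar>"])
      show "(\<lambda>t. H t * p (exp (- t))) \<in> borel_measurable lborel"
        using pm H[THEN borel_measurable_integrable] by measurable
      have "\<bar>H t * p (exp (- t))\<bar> \<le> \<bar>K * H t\<bar>" for t
        using K[of "exp (- t)"] by (cases "0 < t") (auto simp: H_def abs_mult mult.commute intro!: mult_right_mono)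
      then show "AE t in lborel. norm (H t * p (exp (- t))) \<le> norm (K * \<bar>H t\<bar>)"
        by (auto simp: abs_mult)
    qed (use H in auto)
    have "(LINT t:{0<..}|lborel. exp (- z * t) * h t * \<psi> (exp (- t))) =
        (\<integral>t. (H t * \<psi> (exp (- t)) - H t * p (exp (- t))) + H t * p (exp (- t)) \<partial>lborel)"
      by (simp add: set_lebesgue_integral_def H_def mult.assoc)
    also have "\<dots> = (\<integral>t. H t * \<psi> (exp (- t)) - H t * p (exp (- t)) \<partial>lborel) + (\<integral>t. H t * p (exp (- t)) \<partial>lborel)"
      using i1 i2 by (rule Bochner_Integration.integral_add)
    also have "(\<integral>t. H t * p (exp (- t)) \<partial>lborel) = 0"
      using real_polynomial_function_integral_zero[OF int zero p(1)]
      by (simp add: set_lebesgue_integral_def H_def mult.assoc)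
    finally have "\<bar>LINT t:{0<..}|lborel. exp (- z * t) * h t * \<psi> (exp (- t))\<bar>
       = \<bar>\<integral>t. H t * \<psi> (exp (- t)) - H t * p (exp (- t)) \<partial>lborel\<bar>" by simp
    also have "\<dots> \<le> (\<integral>t. \<bar>H t * \<psi> (exp (- t)) - H t * p (exp (- t))\<bar> \<partial>lborel)"
      using integral_norm_bound[of lborel "\<lambda>t. H t * \<psi> (exp (- t)) - H t * p (exp (- t))"] by simp
    also have "\<dots> \<le> (\<integral>t. d * \<bar>H t\<bar> \<partial>lborel)"
      using i1 H bnd by (intro integral_mono) auto
    also have "\<dots> = d * C" by (simp add: C_def)
    also have "\<dots> \<le> e" using that C by (simp add: d_def field_simps)
    finally show ?thesis by simp
  qed
  then have "\<bar>LINT t:{0<..}|lborel. exp (- z * t) * h t * \<psi> (exp (- t))\<bar> \<le> 0"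
    by (rule field_le_epsilon)
  then show ?thesis by simp
qed

text \<open>If \<open>h t \<noteq> 0\<close>, right-continuity gives \<open>h\<close> a constant sign on some \<open>(t, b)\<close>, which is tested against
  a tent function supported there.\<close>

lemma laplace_unique:
  fixes h :: "real \<Rightarrow> real"
  assumes int: "set_integrable lborel {0<..} (\<lambda>t. exp (- z * t) * h t)"
    and zero: "\<And>n::nat. (LINT t:{0<..}|lborel. exp (- (z + real n) * t) * h t) = 0"
    and cont: "\<And>t. 0 < t \<Longrightarrow> continuous (at_right t) h"
    and t: "0 < t"
  shows "h t = 0"
proof (rule ccontr)
  assume "h t \<noteq> 0"
  define g where "g = (\<lambda>s. sgn (h t) * h s)"
  have "g t > 0" using \<open>h t \<noteq> 0\<close> by (simp add: g_def sgn_mult_self_eq abs_sgn[symmetric] mult.commute)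
  moreover have "continuous (at_right t) g" unfolding g_def using cont[OF t] by (intro continuous_intros)
  ultimately have "eventually (\<lambda>s. g s > 0) (at_right t)"
    unfolding continuous_within by (auto dest: order_tendstoD(1))
  then obtain b where b: "t < b" "\<And>s. t < s \<Longrightarrow> s < b \<Longrightarrow> g s > 0"
    unfolding eventually_at_right_field by blast
  \<comment> \<open>The tent is built in the variable x = exp (- s), where the interval from t to b
    becomes the one from exp (- b) to exp (- t).\<close>
  define \<psi> where "\<psi> x = max 0 (min (x - exp (- b)) (exp (- t) - x))" for x :: real
  have \<psi>c: "continuous_on A \<psi>" for A unfolding \<psi>_def by (intro continuous_intros)
  have z0: "(LINT s:{0<..}|lborel. exp (- z * s) * h s * \<psi> (exp (- s))) = 0"
    by (rule continuous_integral_zero[OF int zero \<psi>c borel_measurable_continuous_onI[OF \<psi>c]])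
  define G where "G s = indicator {0<..} s * (exp (- z * s) * g s * \<psi> (exp (- s)))" for s
  have G0: "(\<integral>s. G s \<partial>lborel) = 0"
  proof -
    have "(\<integral>s. G s \<partial>lborel) = sgn (h t) * (LINT s:{0<..}|lborel. exp (- z * s) * h s * \<psi> (exp (- s)))"
      unfolding set_lebesgue_integral_def integral_mult_right_zero[symmetric]
      by (intro Bochner_Integration.integral_cong) (auto simp: G_def g_def)
    then show ?thesis unfolding z0 by simp
  qed
  have \<psi>0: "\<psi> (exp (- s)) = 0" if "s \<notin> {t<..<b}" for s
  proof -
    have "exp (- s) - exp (- b) \<le> 0 \<or> exp (- t) - exp (- s) \<le> 0" using that by auto
    then show ?thesis unfolding \<psi>_def by linarith
  qed
  have \<psi>1: "0 < \<psi> (exp (- s))" if "s \<in> {t<..<b}" for s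
    using that by (auto simp: \<psi>_def)
  have Gpos: "0 < G s" if "s \<in> {t<..<b}" for s
    using that t b(2)[of s] \<psi>1[OF that] by (simp add: G_def)
  have Gnn: "0 \<le> G s" for s
    using Gpos[of s] \<psi>0[of s] by (cases "s \<in> {t<..<b}") (auto simp: G_def)
  have Gint: "integrable lborel G"
  proof (rule Bochner_Integration.integrable_bound)
    show "integrable lborel (\<lambda>s. indicator {0<..} s *\<^sub>R (exp (- z * s) * h s))"
      using int by (simp add: set_integrable_def)
    have "(\<lambda>s. indicator {0<..} s *\<^sub>R (exp (- z * s) * h s) * (sgn (h t) * \<psi> (exp (- s)))) \<in> borel_measurable lborel"
      using int[unfolded set_integrable_def, THEN borel_measurable_integrable]
        borel_measurable_continuous_onI[OF \<psi>c] by measurable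
    also have "(\<lambda>s. indicator {0<..} s *\<^sub>R (exp (- z * s) * h s) * (sgn (h t) * \<psi> (exp (- s)))) = G"
      by (auto simp: G_def g_def)
    finally show "G \<in> borel_measurable lborel" .
    show "AE s in lborel. norm (G s) \<le> norm (indicator {0<..} s *\<^sub>R (exp (- z * s) * h s))"
    proof (intro AE_I2)
      fix s :: real
      have "\<bar>\<psi> (exp (- s))\<bar> \<le> 1" if "0 < s"
      proof -
        have "exp (- s) \<le> 1" "0 < exp (- b)" using that by auto
        then show ?thesis unfolding \<psi>_def by linarith
      qed
      then have "\<bar>sgn (h t)\<bar> * \<bar>\<psi> (exp (- s))\<bar> \<le> 1" if "0 < s"
        using that by (auto simp: abs_sgn_eq)
      then have "(exp (- z * s) * \<bar>h s\<bar>) * (\<bar>sgn (h t)\<bar> * \<bar>\<psi> (exp (- s))\<bar>) \<le> exp (- z * s) * \<bar>h s\<bar>" if "0 < s"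
        using that by (intro mult_left_le) auto
      then show "norm (G s) \<le> norm (indicator {0<..} s *\<^sub>R (exp (- z * s) * h s))"
        by (cases "0 < s") (auto simp: G_def g_def abs_mult mult_ac)
    qed
  qed
  have "AE s in lborel. G s = 0"
    using integral_nonneg_eq_0_iff_AE[OF Gint] Gnn G0 by simp
  then have "AE s in lborel. s \<notin> {t<..<b}"
    by eventually_elim (use Gpos in force)
  then have "emeasure lborel {t<..<b} = 0"
    by (subst (asm) AE_iff_measurable[of "{t<..<b}"]) auto
  then show False using b(1) by simp
qed

section \<open>The forward equation for bounded rates\<close>

text \<open>At the last point where v is nonpositive, a negative right derivative would produce a
  later one. A one-sided statement is needed because the semigroup property gives right derivatives
  of \<open>P\<close> directly.\<close>

lemma right_derivative_nonpos:
  fixes v :: "real \<Rightarrow> real"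
  assumes "a \<le> b" "continuous_on {a..b} v" "v a \<le> 0"
    and D: "\<And>s. a \<le> s \<Longrightarrow> s < b \<Longrightarrow> \<exists>D<0. ((\<lambda>h. (v (s + h) - v s) / h) \<longlongrightarrow> D) (at_right 0)"
  shows "v b \<le> 0"
proof (rule ccontr)
  assume b: "\<not> v b \<le> 0"
  define K where "K = {a..b} \<inter> v -` {..0}"
  have "closed K"
    unfolding K_def using assms(2) by (intro continuous_closed_preimage) auto
  then have "compact K"
    using compact_Int_closed[of "{a..b}" K] by (simp add: K_def Int_assoc[symmetric])
  moreover have "a \<in> K" using assms by (auto simp: K_def)
  ultimately obtain s where s: "s \<in> K" "\<And>r. r \<in> K \<Longrightarrow> r \<le> s"
    using compact_attains_sup[of K] by auto
  have "a \<le> s" "s < b" "v s \<le> 0"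
    using s(1) b by (auto simp: K_def intro: le_neq_trans)
  then obtain D where "D < 0" "((\<lambda>h. (v (s + h) - v s) / h) \<longlongrightarrow> D) (at_right 0)"
    using D by blast
  then have "eventually (\<lambda>h. (v (s + h) - v s) / h < 0) (at_right 0)"
    by (auto dest: order_tendstoD(2))
  moreover have "eventually (\<lambda>h. h < b - s) (at_right 0)" "eventually (\<lambda>h. (0::real) < h) (at_right 0)"
    using \<open>s < b\<close> by (auto simp: eventually_at_right_field intro: exI[of _ "b - s"] exI[of _ 1])
  ultimately have "eventually (\<lambda>h. v (s + h) < v s \<and> 0 < h \<and> h < b - s) (at_right 0)"
    by eventually_elim (auto simp: divide_less_0_iff)
  then obtain h where h: "v (s + h) < v s" "0 < h" "h < b - s"
    using eventually_happens[of _ "at_right (0::real)"] by (auto simp: trivial_limit_at_right_real)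
  then have "s + h \<in> K" using \<open>a \<le> s\<close> \<open>v s \<le> 0\<close> by (auto simp: K_def)
  then show False using s(2) h by force
qed

text \<open>The difference of g and the integral of f has right derivative 0. Subtracting a small
  slope d makes it strictly negative, as the preceding lemma demands; the signs \<sigma> = 1 and
  \<sigma> = -1 give both inequalities.\<close>

lemma right_derivative_antiderivative:
  fixes g f :: "real \<Rightarrow> real"
  assumes g: "continuous_on {0..} g" and f: "continuous_on {0..} f"
    and D: "\<And>s. 0 \<le> s \<Longrightarrow> ((\<lambda>h. (g (s + h) - g s) / h) \<longlongrightarrow> f s) (at_right 0)"
    and t: "0 \<le> t"
  shows "g t = g 0 + integral {0..t} f"
proof -
  define G where "G s = integral {0..s} f" for s
  have G: "((\<lambda>h. (G (s + h) - G s) / h) \<longlongrightarrow> f s) (at_right 0)" if "0 \<le> s" for s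
  proof -
    have "(G has_real_derivative f s) (at s within {0..s+1})"
      unfolding G_def using that
      by (intro integral_has_real_derivative continuous_on_subset[OF f]) auto
    then have "(G has_real_derivative f s) (at s within {s..s+1})"
      using that by (auto intro: DERIV_subset)
    then have "(G has_real_derivative f s) (at_right s)"
      unfolding has_field_derivative_iff using at_within_Icc_at_right[of s "s+1"] by simp
    then have "((\<lambda>y. (G y - G s) / (y - s)) \<longlongrightarrow> f s) (at_right s)"
      by (simp add: has_field_derivative_iff)
    then show ?thesis
      by (subst (asm) filterlim_at_right_to_0) (simp add: add.commute)
  qed
  have Gc: "continuous_on {0..t} G"
    unfolding G_def using t
    by (intro indefinite_integral_continuous_1 integrable_continuous_real continuous_on_subset[OF f]) auto
  have main: "\<sigma> * (g t - G t - (g 0 - G 0)) \<le> 0 + e" if "e > 0" for e \<sigma> :: real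
  proof -
    define d where "d = e / (t + 1)"
    have d: "0 < d" using that t by (simp add: d_def)
    have "\<sigma> * (g t - G t - (g 0 - G 0)) - d * t \<le> 0"
    proof (rule right_derivative_nonpos[where a=0 and v="\<lambda>s. \<sigma> * (g s - G s - (g 0 - G 0)) - d * s"])
      show "continuous_on {0..t} (\<lambda>s. \<sigma> * (g s - G s - (g 0 - G 0)) - d * s)"
        by (intro continuous_intros Gc continuous_on_subset[OF g]) auto
      fix s :: real assume s: "0 \<le> s"
      have "((\<lambda>h. \<sigma> * ((g (s + h) - g s) / h - (G (s + h) - G s) / h) - d) \<longlongrightarrow> \<sigma> * (f s - f s) - d) (at_right 0)"
        by (intro tendsto_diff tendsto_mult_left tendsto_const D[OF s] G[OF s])
      moreover have "eventually (\<lambda>h. \<sigma> * ((g (s + h) - g s) / h - (G (s + h) - G s) / h) - d =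
         ((\<sigma> * (g (s + h) - G (s + h) - (g 0 - G 0)) - d * (s + h)) -
          (\<sigma> * (g s - G s - (g 0 - G 0)) - d * s)) / h) (at_right 0)"
        using eventually_at_right_less[of "0::real"]
      proof eventually_elim
        case (elim h)
        then show ?case by (simp add: field_simps)
      qed
      ultimately have "((\<lambda>h. ((\<sigma> * (g (s + h) - G (s + h) - (g 0 - G 0)) - d * (s + h)) -
          (\<sigma> * (g s - G s - (g 0 - G 0)) - d * s)) / h) \<longlongrightarrow> - d) (at_right 0)"
        by (subst (asm) tendsto_cong) simp_all
      then show "\<exists>D<0. ((\<lambda>h. ((\<sigma> * (g (s + h) - G (s + h) - (g 0 - G 0)) - d * (s + h)) -
          (\<sigma> * (g s - G s - (g 0 - G 0)) - d * s)) / h) \<longlongrightarrow> D) (at_right 0)"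
        using d by (intro exI[of _ "- d"]) auto
    qed (use t in auto)
    moreover have "d * t \<le> e" using that t by (simp add: d_def field_simps)
    ultimately show ?thesis by simp
  qed
  have "g t - G t - (g 0 - G 0) \<le> 0" "- (g t - G t - (g 0 - G 0)) \<le> 0"
    using field_le_epsilon[OF main[of _ 1]] field_le_epsilon[OF main[of _ "-1"]] by simp_all
  then show ?thesis by (simp add: G_def)
qed

lemma has_sum_member_le:
  fixes f :: "'s \<Rightarrow> real"
  assumes "(f has_sum a) S" "\<And>x. x \<in> S \<Longrightarrow> 0 \<le> f x" "F \<subseteq> S" "finite F"
  shows "sum f F \<le> a"
proof (rule has_sum_mono2[OF has_sum_finite[OF assms(4)] assms(1) assms(3)])
  show "0 \<le> f x" if "x \<in> S - F" for x using assms(2) that by auto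
qed

text \<open>The common bound \<open>qb\<close> on the exit rates is what makes \<open>P\<close>
  Lipschitz in time, uniformly in the states, and dominates its difference quotients.\<close>

locale bounded_transition_function =
  fixes S :: "'s set" and q :: "'s \<Rightarrow> 's \<Rightarrow> real" and P :: "real \<Rightarrow> 's \<Rightarrow> 's \<Rightarrow> real" and qb :: real
  assumes transition: "transition_function S q P"
    and exit_le: "\<And>i. i \<in> S \<Longrightarrow> (\<Sum>\<^sub>\<infinity>j\<in>S - {i}. q i j) \<le> qb"
begin

abbreviation exit :: "'s \<Rightarrow> real" where
  "exit i \<equiv> (\<Sum>\<^sub>\<infinity>j\<in>S - {i}. q i j)"

lemma P_nonneg: "0 \<le> t \<Longrightarrow> i \<in> S \<Longrightarrow> j \<in> S \<Longrightarrow> 0 \<le> P t i j"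
  and P_sum: "0 \<le> t \<Longrightarrow> i \<in> S \<Longrightarrow> (P t i has_sum 1) S"
  and P_0: "i \<in> S \<Longrightarrow> j \<in> S \<Longrightarrow> P 0 i j = (if i = j then 1 else 0)"
  and P_add: "0 \<le> s \<Longrightarrow> 0 \<le> t \<Longrightarrow> i \<in> S \<Longrightarrow> j \<in> S \<Longrightarrow> ((\<lambda>l. P s i l * P t l j) has_sum P (s + t) i j) S"
  and P_rate: "i \<in> S \<Longrightarrow> j \<in> S \<Longrightarrow> i \<noteq> j \<Longrightarrow> ((\<lambda>h. P h i j / h) \<longlongrightarrow> q i j) (at_right 0)"
  and P_exit: "i \<in> S \<Longrightarrow> ((\<lambda>h. (1 - P h i i) / h) \<longlongrightarrow> exit i) (at_right 0)"
  using transition unfolding transition_function_def by simp_all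

lemma P_le_1: "0 \<le> t \<Longrightarrow> i \<in> S \<Longrightarrow> j \<in> S \<Longrightarrow> P t i j \<le> 1"
  using has_sum_member_le[OF P_sum[of t i], of "{j}"] P_nonneg by auto

lemma P_offdiag_le: "0 \<le> t \<Longrightarrow> i \<in> S \<Longrightarrow> j \<in> S \<Longrightarrow> i \<noteq> j \<Longrightarrow> P t i j \<le> 1 - P t i i"
  using has_sum_member_le[OF P_sum[of t i], of "{i, j}"] P_nonneg by auto

text \<open>Only the path that is found in i at every multiple of u is kept from the
  Chapman-Kolmogorov sum.\<close>

lemma P_diag_power:
  assumes "0 \<le> u" "i \<in> S"
  shows "P u i i ^ n \<le> P (real n * u) i i"
proof (induction n)
  case 0
  then show ?case using assms P_0 by simp
next
  case (Suc n)
  have "P u i i ^ Suc n \<le> P u i i * P (real n * u) i i"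
    using Suc assms P_nonneg[of u i i] by (simp add: mult_left_mono)
  also have "\<dots> \<le> P (u + real n * u) i i"
  proof -
    have "(\<Sum>l\<in>{i}. P u i l * P (real n * u) l i) \<le> P (u + real n * u) i i"
      using assms by (intro has_sum_member_le[OF P_add] mult_nonneg_nonneg P_nonneg) auto
    then show ?thesis by simp
  qed
  finally show ?case by (simp add: algebra_simps)
qed

text \<open>Turns the rate, a limit at 0, into a bound for all times: t is cut into n + 1 equal
  steps, Bernoulli's inequality bounds the power of the one-step probability from below, and n tends
  to infinity.\<close>

lemma P_diag_ge:
  assumes t: "0 \<le> t" and i: "i \<in> S"
  shows "1 - P t i i \<le> exit i * t"
proof (cases "t = 0")
  case False
  then have "0 < t" using t by simp
  have "((\<lambda>n. t / real (Suc n)) \<longlongrightarrow> 0) sequentially"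
    using lim_const_over_n[of t] by (rule LIMSEQ_Suc)
  then have "filterlim (\<lambda>n. t / real (Suc n)) (at_right 0) sequentially"
    using \<open>0 < t\<close> by (auto simp: filterlim_at simp del: of_nat_Suc)
  from filterlim_compose[OF P_exit[OF i] this]
  have "(\<lambda>n. ((1 - P (t / real (Suc n)) i i) / (t / real (Suc n))) * t) \<longlonglongrightarrow> exit i * t"
    by (rule tendsto_mult_right)
  moreover have "1 - P t i i \<le> ((1 - P (t / real (Suc n)) i i) / (t / real (Suc n))) * t" for n
  proof -
    define p where "p = P (t / real (Suc n)) i i"
    have "1 + real (Suc n) * (p - 1) \<le> (1 + (p - 1)) ^ Suc n"
      using P_nonneg[of "t / real (Suc n)" i i] t i by (intro Bernoulli_inequality) (simp add: p_def)
    also have "\<dots> \<le> P t i i"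
      using P_diag_power[of "t / real (Suc n)" i "Suc n"] t i by (simp add: p_def del: of_nat_Suc power_Suc)
    finally have "1 - P t i i \<le> real (Suc n) * (1 - p)" by (simp add: algebra_simps)
    also have "\<dots> = ((1 - p) / (t / real (Suc n))) * t" using \<open>0 < t\<close> by (simp del: of_nat_Suc)
    finally show ?thesis by (simp add: p_def)
  qed
  ultimately show ?thesis by (intro LIMSEQ_le_const) auto
qed (use P_0 i in auto)

lemma P_diag_ge': "0 \<le> t \<Longrightarrow> i \<in> S \<Longrightarrow> 1 - P t i i \<le> qb * t"
  using P_diag_ge[of t i] exit_le[of i] mult_right_mono[of "exit i" qb t] by linarith

lemma P_offdiag_le': "0 \<le> t \<Longrightarrow> i \<in> S \<Longrightarrow> j \<in> S \<Longrightarrow> i \<noteq> j \<Longrightarrow> P t i j \<le> qb * t"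
  using P_offdiag_le[of t i j] P_diag_ge'[of t i] by linarith

lemma P_split:
  assumes "0 \<le> t" "0 \<le> h" "i \<in> S" "x \<in> S"
  shows "((\<lambda>l. P t i l * P h l x) has_sum (P (t + h) i x - P t i x * P h x x)) (S - {x})"
  using has_sum_Diff[OF P_add[of t h i x] has_sum_finite[of "{x}"]] assms by simp

text \<open>The increment is inflow into x minus outflow from x. Both are nonnegative and at most
  \<open>qb * h\<close>, so their difference is too in absolute value.\<close>

lemma P_lipschitz:
  assumes "0 \<le> t" "0 \<le> h" "i \<in> S" "x \<in> S"
  shows "\<bar>P (t + h) i x - P t i x\<bar> \<le> qb * h"
proof -
  have "P t i x - P t i x * P h x x = P t i x * (1 - P h x x)" by (simp add: algebra_simps)
  also have "\<dots> \<le> 1 * (qb * h)"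
    using assms P_diag_ge'[of h x] P_le_1 P_nonneg by (intro mult_mono) auto
  finally have 1: "P t i x - P t i x * P h x x \<le> qb * h" by simp
  have 2: "0 \<le> P (t + h) i x - P t i x * P h x x"
    using P_split[OF assms] by (rule has_sum_nonneg) (use assms P_nonneg in auto)
  have nn: "0 \<le> qb * h" using P_diag_ge'[of h x] P_le_1[of h x x] assms by linarith
  have "((\<lambda>l. P t i l) has_sum (1 - P t i x)) (S - {x})"
    using has_sum_Diff[OF P_sum[of t i] has_sum_finite[of "{x}"]] assms by simp
  then have "((\<lambda>l. P t i l * (qb * h)) has_sum ((1 - P t i x) * (qb * h))) (S - {x})"
    by (rule has_sum_cmult_left)
  with P_split[OF assms] have "P (t + h) i x - P t i x * P h x x \<le> (1 - P t i x) * (qb * h)"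
    by (rule has_sum_mono) (use assms P_nonneg P_offdiag_le' in \<open>auto intro!: mult_left_mono\<close>)
  also have "\<dots> \<le> 1 * (qb * h)" using nn assms P_nonneg by (intro mult_right_mono) auto
  finally have 3: "P (t + h) i x - P t i x * P h x x \<le> qb * h" by simp
  have 4: "P t i x * P h x x \<le> P t i x" using assms P_nonneg P_le_1 by (simp add: mult_left_le)
  show ?thesis using 1 2 3 4 by linarith
qed

lemma continuous_on_P:
  assumes "i \<in> S" "x \<in> S"
  shows "continuous_on {0..} (\<lambda>t. P t i x)"
proof -
  have "0 \<le> qb" using P_diag_ge'[of 1 i] P_le_1[of 1 i i] assms by simp
  have "\<bar>P s i x - P t i x\<bar> \<le> qb * \<bar>s - t\<bar>" if "0 \<le> t" "0 \<le> s" for s t :: real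
    using P_lipschitz[of t "s - t" i x] P_lipschitz[of s "t - s" i x] that assms
    by (cases "t \<le> s") (auto simp: abs_minus_commute)
  then have "qb-lipschitz_on {0..} (\<lambda>t. P t i x)"
    using \<open>0 \<le> qb\<close> by (intro lipschitz_onI) (auto simp: dist_real_def)
  then show ?thesis by (rule lipschitz_on_continuous_on)
qed

text \<open>The off-diagonal difference quotients \<open>P h l x / h\<close> are bounded by \<open>qb\<close>, so the passage to the
  limit under the sum over \<open>l\<close> is dominated by the probability vector \<open>P t i\<close>.\<close>

lemma P_right_derivative:
  assumes "0 \<le> t" "i \<in> S" "x \<in> S"
    and N: "finite N" "N \<subseteq> S - {x}" "\<And>l. l \<in> S - {x} - N \<Longrightarrow> q l x = 0"
  shows "((\<lambda>h. (P (t + h) i x - P t i x) / h) \<longlongrightarrow> (\<Sum>l\<in>N. P t i l * q l x) - P t i x * exit x) (at_right 0)"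
proof -
  \<comment> \<open>Nonnegative sums are rewritten as integrals over a counting measure, which makes
    dominated convergence applicable.\<close>
  have cs: "integrable (count_space A) f \<and> integral\<^sup>L (count_space A) f = a"
    if "(f has_sum a) A" "\<And>l. l \<in> A \<Longrightarrow> 0 \<le> f l" for f :: "'s \<Rightarrow> real" and a A
  proof -
    have "(\<lambda>l. norm (f l)) summable_on A"
      using that summable_on_cong[of A "\<lambda>l. norm (f l)" f] by (auto simp: summable_on_def)
    then have "Infinite_Set_Sum.abs_summable_on f A"
      by (rule abs_summable_equivalent[THEN iffD1])
    then have "integrable (count_space A) f" "infsetsum f A = infsum f A"
      by (auto simp: Infinite_Set_Sum.abs_summable_on_def infsetsum_infsum)
    then show ?thesis using that by (simp add: infsetsum_def infsumI)
  qed
  let ?A = "S - {x}"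
  have sum_t: "(P t i has_sum (1 - P t i x)) ?A"
    using has_sum_Diff[OF P_sum[of t i] has_sum_finite[of "{x}"]] assms by simp
  have "((\<lambda>h. \<integral>l. P t i l * (P h l x / h) \<partial>count_space ?A) \<longlongrightarrow> (\<integral>l. P t i l * q l x \<partial>count_space ?A)) (at_right 0)"
    unfolding tendsto_at_iff_sequentially comp_def
  proof (intro allI impI)
    fix X :: "nat \<Rightarrow> real" assume X: "\<forall>n. X n \<in> {0<..} - {0}" "X \<longlonglongrightarrow> 0"
    then have X': "filterlim X (at_right 0) sequentially" by (auto simp: filterlim_at less_imp_neq[symmetric] intro!: always_eventually)
    show "(\<lambda>n. \<integral>l. P t i l * (P (X n) l x / X n) \<partial>count_space ?A) \<longlonglongrightarrow> (\<integral>l. P t i l * q l x \<partial>count_space ?A)"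
    proof (rule integral_dominated_convergence[where w="\<lambda>l. P t i l * qb"])
      show "integrable (count_space ?A) (\<lambda>l. P t i l * qb)"
        using cs[OF sum_t] P_nonneg[OF assms(1,2)] by (intro integrable_mult_left) auto
      show "AE l in count_space ?A. (\<lambda>n. P t i l * (P (X n) l x / X n)) \<longlonglongrightarrow> P t i l * q l x"
        unfolding AE_count_space
      proof
        fix l assume "l \<in> ?A"
        then have "((\<lambda>h. P h l x / h) \<longlongrightarrow> q l x) (at_right 0)" using assms(3) by (intro P_rate) auto
        from filterlim_compose[OF this X']
        show "(\<lambda>n. P t i l * (P (X n) l x / X n)) \<longlonglongrightarrow> P t i l * q l x"
          by (rule tendsto_mult_left)
      qed
      fix n
      have "0 < X n" using X by auto
      then show "AE l in count_space ?A. norm (P t i l * (P (X n) l x / X n)) \<le> P t i l * qb"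
        unfolding AE_count_space
      proof (intro ballI)
        fix l assume "l \<in> ?A"
        then have "0 \<le> P t i l" "0 \<le> P (X n) l x" "P (X n) l x / X n \<le> qb"
          using assms P_offdiag_le'[of "X n" l x] P_nonneg \<open>0 < X n\<close> by (auto simp: pos_divide_le_eq)
        then show "norm (P t i l * (P (X n) l x / X n)) \<le> P t i l * qb"
          using \<open>0 < X n\<close> mult_left_mono[of "P (X n) l x / X n" qb "P t i l"] by (simp add: abs_mult)
      qed
    qed simp_all
  qed
  note lim = this
  \<comment> \<open>Only the limit reduces to the finitely many predecessors \<open>N\<close>; for h
    > 0 all states may contribute.\<close>
  have lim_eq: "(\<integral>l. P t i l * q l x \<partial>count_space ?A) = (\<Sum>l\<in>N. P t i l * q l x)"
  proof -
    have "(\<integral>l. P t i l * q l x \<partial>count_space ?A) = (\<Sum>l | l \<in> ?A \<and> P t i l * q l x \<noteq> 0. P t i l * q l x)"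
      by (rule lebesgue_integral_count_space_finite_support)
         (auto intro: finite_subset[OF _ N(1)] N(3))
    also have "\<dots> = (\<Sum>l\<in>N. P t i l * q l x)"
      using N by (intro sum.mono_neutral_left) auto
    finally show ?thesis .
  qed
  have "((\<lambda>h. (\<integral>l. P t i l * (P h l x / h) \<partial>count_space ?A) - P t i x * ((1 - P h x x) / h))
      \<longlongrightarrow> (\<Sum>l\<in>N. P t i l * q l x) - P t i x * exit x) (at_right 0)"
    by (rule tendsto_diff[OF lim[unfolded lim_eq] tendsto_mult_left[OF P_exit[OF assms(3)]]])
  moreover have "eventually (\<lambda>h. (\<integral>l. P t i l * (P h l x / h) \<partial>count_space ?A) - P t i x * ((1 - P h x x) / h)
      = (P (t + h) i x - P t i x) / h) (at_right 0)"
    using eventually_at_right_less[of "0::real"]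
  proof eventually_elim
    case (elim h)
    have "((\<lambda>l. P t i l * (P h l x / h)) has_sum ((P (t + h) i x - P t i x * P h x x) * (1 / h))) ?A"
      using has_sum_cmult_left[OF P_split[of t h i x], of "1 / h"] elim assms by simp
    then have "(\<integral>l. P t i l * (P h l x / h) \<partial>count_space ?A) = (P (t + h) i x - P t i x * P h x x) * (1 / h)"
      using elim assms by (intro cs[THEN conjunct2]) (auto intro!: P_nonneg mult_nonneg_nonneg divide_nonneg_nonneg)
    then show ?case using elim by (simp add: field_simps)
  qed
  ultimately show ?thesis by (rule Lim_transform_eventually)
qed

text \<open>The right derivative is a continuous function of time, so \<open>P\<close> is its
  antiderivative and hence differentiable from both sides.\<close>

lemma forward_equation:
  assumes "0 < t" "i \<in> S" "x \<in> S"
    and N: "finite N" "N \<subseteq> S - {x}" "\<And>l. l \<in> S - {x} - N \<Longrightarrow> q l x = 0"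
  shows "((\<lambda>t. P t i x) has_real_derivative (\<Sum>l\<in>N. P t i l * q l x) - P t i x * exit x) (at t)"
proof -
  define f where "f t = (\<Sum>l\<in>N. P t i l * q l x) - P t i x * exit x" for t
  have f: "continuous_on {0..} f"
    unfolding f_def using assms by (intro continuous_intros continuous_on_P) auto
  have eq: "P s i x = P 0 i x + integral {0..s} f" if "0 \<le> s" for s
    using assms that f
    by (intro right_derivative_antiderivative continuous_on_P) (auto simp: f_def intro!: P_right_derivative)
  have "((\<lambda>s. P 0 i x + integral {0..s} f) has_real_derivative 0 + f t) (at t within {0..t+1})"
    using assms(1) by (intro DERIV_add DERIV_const integral_has_real_derivative continuous_on_subset[OF f]) auto
  then have "((\<lambda>s. P 0 i x + integral {0..s} f) has_real_derivative f t) (at t)"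
    using assms(1) at_within_interior[of t "{0..t+1}"] by auto
  then have "((\<lambda>t. P t i x) has_real_derivative f t) (at t)"
  proof (rule has_field_derivative_transform_within_open[where S="{0<..}"])
    show "P 0 i x + integral {0..s} f = P s i x" if "s \<in> {0<..}" for s
      by (rule eq[symmetric]) (use that in auto)
  qed (use assms in auto)
  then show ?thesis by (simp add: f_def)
qed

end

section \<open>Laplace transforms of inverse subordinators\<close>

lemma integrable_exp_Ioi:
  fixes w :: real
  assumes "0 < w"
  shows "set_integrable lborel {0<..} (\<lambda>t. exp (- w * t))"
proof -
  have "integrable lborel (\<lambda>t. exponential_density w t)"
    using prob_space.prob_space[OF prob_space_exponential_density[OF assms]]
      prob_space.emeasure_space_1[OF prob_space_exponential_density[OF assms]] assms
    by (intro integrableI_nonneg) (auto simp: emeasure_density exponential_density_nonneg top_unique)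
  then have "integrable lborel (\<lambda>t. exponential_density w t * (1 / w))"
    by (rule integrable_mult_left)
  then have "set_integrable lborel {0<..} (\<lambda>t. exponential_density w t * (1 / w))"
    unfolding set_integrable_def by (rule integrable_mult_indicator[rotated]) auto
  then show ?thesis
    by (rule set_integrable_cong[THEN iffD1, rotated -1])
       (use assms in \<open>auto simp: exponential_density_def mult.commute\<close>)
qed

lemma integrable_exp_bounded:
  fixes w :: real
  assumes "0 < w" "f \<in> borel_measurable borel" "\<And>t. 0 < t \<Longrightarrow> \<bar>f t\<bar> \<le> B"
  shows "set_integrable lborel {0<..} (\<lambda>t. exp (- w * t) * f t)"
proof (rule set_integrable_bound)
  show "set_integrable lborel {0<..} (\<lambda>t. B * exp (- w * t))"
    by (intro set_integrable_mult_right integrable_exp_Ioi assms)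
  show "set_borel_measurable lborel {0<..} (\<lambda>t. exp (- w * t) * f t)"
    unfolding set_borel_measurable_def using assms(2) by measurable
  show "AE t in lborel. t \<in> {0<..} \<longrightarrow> norm (exp (- w * t) * f t) \<le> norm (B * exp (- w * t))"
    using assms(3) by (intro AE_I2) (fastforce simp: abs_mult mult.commute intro!: mult_right_mono)
qed

text \<open>The fundamental theorem of calculus for exp (- w t) g(t), which runs from g(0) to 0
  because g is bounded.\<close>

lemma laplace_derivative:
  fixes g g' :: "real \<Rightarrow> real"
  assumes w: "0 < w"
    and g: "continuous_on {0..} g" "\<And>t. 0 < t \<Longrightarrow> (g has_real_derivative g' t) (at t)"
    and g': "continuous_on {0..} g'"
    and bounds: "\<And>t. 0 \<le> t \<Longrightarrow> \<bar>g t\<bar> \<le> B" "\<And>t. 0 \<le> t \<Longrightarrow> \<bar>g' t\<bar> \<le> B'"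
  shows "w * (LINT t:{0<..}|lborel. exp (- w * t) * g t) = g 0 + (LINT t:{0<..}|lborel. exp (- w * t) * g' t)"
proof -
  have int: "set_integrable lborel {0<..} (\<lambda>t. exp (- w * t) * f t)"
    if f: "continuous_on {0..} f" and b: "\<And>t. 0 \<le> t \<Longrightarrow> \<bar>f t\<bar> \<le> C" for f :: "real \<Rightarrow> real" and C
  proof -
    \<comment> \<open>Freezing f at its value at 0 for negative arguments makes it continuous, hence
      measurable, on the whole line.\<close>
    have "set_integrable lborel {0<..} (\<lambda>t. exp (- w * t) * f (max 0 t))"
      by (rule integrable_exp_bounded[OF w borel_measurable_continuous_onI, of _ C])
         (auto intro!: continuous_on_compose2[OF f] continuous_intros b)
    then show ?thesis by (rule set_integrable_cong[THEN iffD1, rotated -1]) auto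
  qed
  have ig: "set_integrable lborel {0<..} (\<lambda>t. exp (- w * t) * g t)" using int[OF g(1) bounds(1)] .
  have ig': "set_integrable lborel {0<..} (\<lambda>t. exp (- w * t) * g' t)" using int[OF g' bounds(2)] .
  define f where "f t = exp (- w * t) * g' t - w * (exp (- w * t) * g t)" for t
  have iF: "set_integrable lborel {0<..} f"
    unfolding f_def using ig ig' by (intro set_integral_diff(1) set_integrable_mult_right)
  have E: "einterval 0 \<infinity> = {0<..}" by (auto simp: einterval_def zero_ereal_def)
  have cont: "isCont h x" if "continuous_on {0..} h" "0 < x" for h :: "real \<Rightarrow> real" and x
    using that continuous_on_interior[of "{0..}" h x] by simp
  have "(LBINT t=0..\<infinity>. f t) = 0 - g 0"
  proof (rule interval_integral_FTC_integrable[where F="\<lambda>t. exp (- w * t) * g t"])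
    fix x assume "0 < ereal x"
    then have x: "0 < x" by (simp add: zero_ereal_def)
    show "((\<lambda>t. exp (- w * t) * g t) has_vector_derivative f x) (at x)"
      unfolding has_real_derivative_iff_has_vector_derivative[symmetric] f_def
      by (rule derivative_eq_intros g(2)[OF x] refl | simp)+
    show "isCont f x"
      unfolding f_def using cont[OF g(1) x] cont[OF g' x] by (intro continuous_intros)
  next
    show "(((\<lambda>t. exp (- w * t) * g t) \<circ> real_of_ereal) \<longlongrightarrow> g 0) (at_right 0)"
    proof -
      have "continuous_on {0..} (\<lambda>t. exp (- w * t) * g t)" by (intro continuous_intros g)
      then have "((\<lambda>t. exp (- w * t) * g t) \<longlongrightarrow> exp (- w * 0) * g 0) (at 0 within {0..})"
        unfolding continuous_on_def by (auto dest!: bspec[of _ _ 0])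
      then have "((\<lambda>t. exp (- w * t) * g t) \<longlongrightarrow> g 0) (at_right 0)"
        by (simp add: at_within_Ici_at_right)
      then show ?thesis
        by (simp add: zero_ereal_def ereal_tendsto_simps)
    qed
    show "(((\<lambda>t. exp (- w * t) * g t) \<circ> real_of_ereal) \<longlongrightarrow> 0) (at_left \<infinity>)"
    proof -
      have "((\<lambda>t. exp (- w * t) * g t) \<longlongrightarrow> 0) at_top"
      proof (rule Lim_null_comparison)
        show "eventually (\<lambda>t. norm (exp (- w * t) * g t) \<le> B * exp (- w * t)) at_top"
          using eventually_ge_at_top[of 0]
          by eventually_elim (use bounds(1) in \<open>fastforce simp: abs_mult mult.commute intro: mult_right_mono\<close>)
        have "filterlim (\<lambda>t. - w * t) at_bot at_top"
          using w by (intro filterlim_tendsto_neg_mult_at_bot[OF tendsto_const _ filterlim_ident]) auto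
        then have "((\<lambda>t. exp (- w * t)) \<longlongrightarrow> 0) at_top"
          by (rule filterlim_compose[OF exp_at_bot])
        then show "((\<lambda>t. B * exp (- w * t)) \<longlongrightarrow> 0) at_top"
          by (rule tendsto_mult_right_zero)
      qed
      then show ?thesis by (simp add: ereal_tendsto_simps)
    qed
  qed (use iF E in auto)
  moreover have "(LBINT t=0..\<infinity>. f t) = (LINT t:{0<..}|lborel. f t)"
    by (simp add: interval_lebesgue_integral_def E)
  moreover have "(LINT t:{0<..}|lborel. f t) = (LINT t:{0<..}|lborel. exp (- w * t) * g' t) -
      w * (LINT t:{0<..}|lborel. exp (- w * t) * g t)"
    unfolding f_def using ig ig'
    by (subst set_integral_diff(2)) (auto intro: set_integrable_mult_right)
  ultimately show ?thesis by simp
qed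

text \<open>The first point strictly above t of the grid of mesh 1 / (n + 1), for t at least 0. It
  takes countably many values and approaches t from the right, the side on which all paths are
  continuous.\<close>

definition grid_up :: "nat \<Rightarrow> real \<Rightarrow> real" where
  "grid_up n t = (real (nat \<lfloor>real (Suc n) * t\<rfloor>) + 1) / real (Suc n)"

lemma grid_up_bounds:
  assumes "0 \<le> t"
  shows "t < grid_up n t" "grid_up n t \<le> t + 1 / real (Suc n)"
proof -
  have "real (nat \<lfloor>real (Suc n) * t\<rfloor>) = of_int \<lfloor>real (Suc n) * t\<rfloor>" using assms by simp
  moreover have "real (Suc n) * t < of_int \<lfloor>real (Suc n) * t\<rfloor> + 1" "of_int \<lfloor>real (Suc n) * t\<rfloor> \<le> real (Suc n) * t"
    by linarith+
  ultimately show "t < grid_up n t" "grid_up n t \<le> t + 1 / real (Suc n)"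
    unfolding grid_up_def by (auto simp: field_simps simp del: of_nat_Suc)
qed

lemma filterlim_grid_up:
  assumes "0 \<le> t"
  shows "filterlim (\<lambda>n. grid_up n t) (at_right t) sequentially"
proof -
  have lim: "(\<lambda>n. t + 1 / real (Suc n)) \<longlonglongrightarrow> t + 0"
    using lim_const_over_n[of 1, THEN LIMSEQ_Suc] by (intro tendsto_add tendsto_const) simp
  have "(\<lambda>n. grid_up n t) \<longlonglongrightarrow> t"
  proof (rule tendsto_sandwich[where f="\<lambda>_. t" and h="\<lambda>n. t + 1 / real (Suc n)", rotated 2])
    show "eventually (\<lambda>n. t \<le> grid_up n t) sequentially"
      by (intro always_eventually allI less_imp_le grid_up_bounds(1) assms)
    show "eventually (\<lambda>n. grid_up n t \<le> t + 1 / real (Suc n)) sequentially"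
      by (intro always_eventually allI grid_up_bounds(2) assms)
  qed (use lim in simp_all)
  then show ?thesis
    using grid_up_bounds(1)[OF assms] unfolding filterlim_at
    by (intro conjI always_eventually allI) (auto simp: less_imp_neq[symmetric])
qed

locale subordinator = prob_space M for M :: "'a measure" +
  fixes D :: "real \<Rightarrow> 'a \<Rightarrow> real" and \<phi> :: "real \<Rightarrow> real"
  assumes D_measurable: "\<And>t. 0 \<le> t \<Longrightarrow> D t \<in> borel_measurable M"
    and D_0: "\<And>\<omega>. \<omega> \<in> space M \<Longrightarrow> D 0 \<omega> = 0"
    and D_mono: "\<And>\<omega>. \<omega> \<in> space M \<Longrightarrow> mono_on {0..} (\<lambda>t. D t \<omega>)"
    and D_right_cont: "\<And>\<omega> t. \<omega> \<in> space M \<Longrightarrow> 0 \<le> t \<Longrightarrow> continuous (at_right t) (\<lambda>u. D u \<omega>)"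
    and D_laplace: "\<And>t z. 0 \<le> t \<Longrightarrow> 0 < z \<Longrightarrow> expectation (\<lambda>\<omega>. exp (- z * D t \<omega>)) = exp (- t * \<phi> z)"
    and \<phi>_pos: "\<And>z. 0 < z \<Longrightarrow> 0 < \<phi> z"
    and Y_measurable: "\<And>t. 0 \<le> t \<Longrightarrow> inverse_subordinator D t \<in> borel_measurable M"
begin

abbreviation Y :: "real \<Rightarrow> 'a \<Rightarrow> real" where
  "Y \<equiv> inverse_subordinator D"

lemma D_monoD: "\<omega> \<in> space M \<Longrightarrow> 0 \<le> r \<Longrightarrow> r \<le> s \<Longrightarrow> D r \<omega> \<le> D s \<omega>"
  using D_mono[of \<omega>] by (auto simp: mono_on_def)

lemma D_nonneg: "\<omega> \<in> space M \<Longrightarrow> 0 \<le> s \<Longrightarrow> 0 \<le> D s \<omega>"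
  using D_monoD[of \<omega> 0 s] D_0[of \<omega>] by simp

lemma bdd_below_passage: "bdd_below {s. 0 \<le> s \<and> D s \<omega> > t}"
  by (intro bdd_belowI[of _ 0]) auto

lemma Y_nonneg: "0 \<le> Y t \<omega>"
  by (auto simp: inverse_subordinator_def intro!: cInf_greatest)

lemma Y_greater_imp: "0 \<le> s \<Longrightarrow> s < Y t \<omega> \<Longrightarrow> D s \<omega> \<le> t"
  using cInf_lower[of s "{s. 0 \<le> s \<and> D s \<omega> > t}"] bdd_below_passage[of t \<omega>]
  by (cases "t < D s \<omega>") (auto simp: inverse_subordinator_def split: if_splits)

text \<open>By right-continuity \<open>D\<close> stays below t slightly beyond s, so the first
  passage occurs strictly later than s. The existence assumption excludes the default value 0 of
  \<open>Y\<close>. Together with \<open>Y_greater_imp\<close> only the tie D s = t remains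
  undecided.\<close>

lemma less_imp_Y_greater:
  assumes \<omega>: "\<omega> \<in> space M" and s: "0 \<le> s" "D s \<omega> < t" and ex: "\<exists>r\<ge>0. t < D r \<omega>"
  shows "s < Y t \<omega>"
proof -
  have "((\<lambda>u. D u \<omega>) \<longlongrightarrow> D s \<omega>) (at_right s)"
    using D_right_cont[OF \<omega> s(1)] by (simp add: continuous_within)
  then have "eventually (\<lambda>u. D u \<omega> < t) (at_right s)"
    using s(2) by (rule order_tendstoD(2))
  then obtain b where b: "s < b" "\<And>u. s < u \<Longrightarrow> u < b \<Longrightarrow> D u \<omega> < t"
    unfolding eventually_at_right_field by blast
  obtain u where u: "s < u" "u < b" using dense[OF b(1)] by blast
  have "u \<le> Inf {s. 0 \<le> s \<and> D s \<omega> > t}"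
  proof (rule cInf_greatest)
    fix r assume "r \<in> {s. 0 \<le> s \<and> D s \<omega> > t}"
    then show "u \<le> r" using D_monoD[OF \<omega>, of r u] b(2)[of u] u by force
  qed (use ex in auto)
  moreover have "t \<noteq> 0" using s D_nonneg[OF \<omega> s(1)] by simp
  ultimately show ?thesis using u ex by (auto simp: inverse_subordinator_def)
qed

text \<open>A point s with D s > t that nearly attains the infimum is also admissible for every u
  between t and D s. Time 0 is excluded because \<open>Y\<close> is set to 0 there by
  definition.\<close>

lemma Y_right_cont:
  assumes t: "0 < t"
  shows "((\<lambda>u. Y u \<omega>) \<longlongrightarrow> Y t \<omega>) (at_right t)"
proof (cases "{s. 0 \<le> s \<and> D s \<omega> > t} = {}")
  case True
  then have "{s. 0 \<le> s \<and> D s \<omega> > u} = {}" if "t < u" for u using that by force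
  then have "eventually (\<lambda>u. Y u \<omega> = 0) (at_right t)"
    using eventually_at_right_less[of t] by (auto simp: inverse_subordinator_def elim!: eventually_mono)
  moreover have "Y t \<omega> = 0" using True by (simp add: inverse_subordinator_def)
  ultimately show ?thesis by (simp add: tendsto_eventually)
next
  case False
  show ?thesis
  proof (rule tendstoI)
    fix e :: real assume "0 < e"
    have Yt: "Y t \<omega> = Inf {s. 0 \<le> s \<and> D s \<omega> > t}"
      unfolding inverse_subordinator_def by (rule if_not_P) (use False t in blast)
    then have "Inf {s. 0 \<le> s \<and> D s \<omega> > t} < Y t \<omega> + e" using \<open>0 < e\<close> by simp
    then obtain s where s: "0 \<le> s" "D s \<omega> > t" "s < Y t \<omega> + e"
      using cInf_lessD[OF False] by auto
    have "dist (Y u \<omega>) (Y t \<omega>) < e" if "t < u" "u < D s \<omega>" for u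
    proof -
      have su: "s \<in> {s. 0 \<le> s \<and> D s \<omega> > u}" using s that by simp
      have "u \<noteq> 0" using that t by simp
      then have Yu: "Y u \<omega> = Inf {s. 0 \<le> s \<and> D s \<omega> > u}"
        unfolding inverse_subordinator_def by (intro if_not_P) (use su in blast)
      have "Y u \<omega> \<le> s" unfolding Yu by (rule cInf_lower[OF su bdd_below_passage])
      moreover have "Y t \<omega> \<le> Y u \<omega>"
        unfolding Yt Yu by (rule cInf_superset_mono) (use su that bdd_below_passage in auto)
      ultimately show ?thesis using s by (simp add: dist_real_def)
    qed
    then show "eventually (\<lambda>u. dist (Y u \<omega>) (Y t \<omega>) < e) (at_right t)"
      using s(2) unfolding eventually_at_right_field by blast
  qed
qed

text \<open>A Chernoff bound: being below N at time n has probability at most e^N times E exp (- D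
  n) = exp (- n \<phi>(1)), which tends to 0.\<close>

lemma D_unbounded: "AE \<omega> in M. \<forall>t. \<exists>r\<ge>0. t < D r \<omega>"
proof -
  have "AE \<omega> in M. \<exists>n. real N < D (real n) \<omega>" for N :: nat
  proof -
    define A where "A = {\<omega>\<in>space M. \<forall>n. D (real n) \<omega> \<le> real N}"
    have [measurable]: "D (real n) \<in> borel_measurable M" for n by (intro D_measurable) simp
    have A[measurable]: "A \<in> sets M" unfolding A_def by measurable
    have "prob A * exp (- real N) \<le> exp (- (real n * \<phi> 1))" for n
    proof -
      have "prob A * exp (- real N) = expectation (\<lambda>\<omega>. indicator A \<omega> * exp (- real N))"
        by simp
      also have "\<dots> \<le> expectation (\<lambda>\<omega>. exp (- 1 * D (real n) \<omega>))"
      proof (rule integral_mono)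
        show "integrable M (\<lambda>\<omega>. exp (- 1 * D (real n) \<omega>))"
          by (rule integrable_const_bound[where B=1]) (auto intro!: AE_I2 D_nonneg)
        show "indicator A \<omega> * exp (- real N) \<le> exp (- 1 * D (real n) \<omega>)" if "\<omega> \<in> space M" for \<omega>
          by (auto simp: A_def indicator_def)
      qed (auto intro!: integrable_mult_left integrable_real_indicator simp: less_top[symmetric])
      also have "\<dots> = exp (- real n * \<phi> 1)" by (rule D_laplace) auto
      finally show ?thesis by simp
    qed
    moreover have "(\<lambda>n. exp (- (real n * \<phi> 1))) \<longlonglongrightarrow> 0"
    proof (rule filterlim_compose[OF exp_at_bot])
      have "filterlim (\<lambda>n. \<phi> 1 * real n) at_top sequentially"
        using \<phi>_pos[of 1] by (intro filterlim_tendsto_pos_mult_at_top[OF tendsto_const _ filterlim_real_sequentially]) auto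
      then show "filterlim (\<lambda>n. - (real n * \<phi> 1)) at_bot sequentially"
        by (simp add: filterlim_uminus_at_top mult.commute)
    qed
    ultimately have "prob A * exp (- real N) \<le> 0"
      by (intro LIMSEQ_le_const) auto
    then have "prob A = 0" by (simp add: mult_le_0_iff order_antisym)
    then have "AE \<omega> in M. \<omega> \<notin> A" by (simp add: prob_eq_0)
    then show ?thesis
      using AE_space by eventually_elim (auto simp: A_def not_le)
  qed
  then have "AE \<omega> in M. \<forall>N::nat. \<exists>n. real N < D (real n) \<omega>" by (simp add: AE_all_countable)
  then show ?thesis
  proof eventually_elim
    case (elim \<omega>)
    show ?case
    proof
      fix t
      obtain N where "t \<le> real N" using real_arch_simple by blast
      moreover obtain n where "real N < D (real n) \<omega>" using elim by blast
      ultimately show "\<exists>r\<ge>0. t < D r \<omega>" by (intro exI[of _ "real n"]) auto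
    qed
  qed
qed

text \<open>\<open>Y\<close> as a function on the product of time and sample space, made harmless
  for nonpositive times, which the exponential law does not charge.\<close>

definition Z :: "real \<times> 'a \<Rightarrow> real" where
  "Z = (\<lambda>(t, \<omega>). if 0 < t then Y t \<omega> else 0)"

text \<open>Measurability at each fixed time is lifted to joint measurability by approximating the
  time from the right on a countable grid.\<close>

lemma Z_measurable: "Z \<in> borel_measurable (borel \<Otimes>\<^sub>M M)"
proof (rule borel_measurable_LIMSEQ_real)
  define U where "U n = (\<lambda>p. if 0 < fst p then Y (grid_up n (fst p)) (snd p) else 0)" for n :: nat
  show "(\<lambda>n. U n p) \<longlonglongrightarrow> Z p" if "p \<in> space (borel \<Otimes>\<^sub>M M)" for p
    using filterlim_compose[OF Y_right_cont filterlim_grid_up]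
    by (cases "0 < fst p") (auto simp: U_def Z_def split_beta)
  show "U n \<in> borel_measurable (borel \<Otimes>\<^sub>M M)" for n
  proof -
    have [measurable]: "Y ((real j + 1) / real (Suc n)) \<in> borel_measurable M" for j
      by (intro Y_measurable) simp
    have "(\<lambda>p. Y ((real (nat \<lfloor>real (Suc n) * fst p\<rfloor>) + 1) / real (Suc n)) (snd p)) \<in> borel_measurable (borel \<Otimes>\<^sub>M M)"
      by (rule measurable_compose_countable[where f="\<lambda>j p. Y ((real j + 1) / real (Suc n)) (snd p)"]) measurable
    then show ?thesis unfolding U_def grid_up_def by measurable
  qed
qed

end

section \<open>Evaluation at an independent exponential time\<close>

lemma exponential_measure_greater:
  assumes "0 < z" "0 \<le> a"
  shows "emeasure (density lborel (exponential_density z)) {a<..} = ennreal (exp (- z * a))"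
proof -
  interpret E: prob_space "density lborel (exponential_density z)"
    by (rule prob_space_exponential_density[OF assms(1)])
  have "distributed (density lborel (exponential_density z)) lborel (\<lambda>x. x) (exponential_density z)"
    unfolding distributed_def by (auto simp: distr_id2)
  from E.exponential_distributedD_gt[OF this assms(2,1)]
  have "E.prob {a<..} = exp (- z * a)" by (simp add: greaterThan_def mult.commute)
  then show ?thesis by (simp add: E.emeasure_eq_measure)
qed

lemma AE_exponential_pos:
  "AE t in density lborel (exponential_density z). 0 < t \<and> t \<noteq> c" if "0 < z"
proof -
  have "AE t in lborel. t \<noteq> 0" "AE t in lborel. t \<noteq> c" by (rule AE_lborel_singleton)+
  then have "AE t in lborel. 0 < ennreal (exponential_density z t) \<longrightarrow> 0 < t \<and> t \<noteq> c"
    by eventually_elim (auto simp: exponential_density_def split: if_splits)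
  then show ?thesis by (subst AE_density) auto
qed

lemma integral_exponential_density:
  fixes f :: "real \<Rightarrow> real"
  assumes "0 < z" "f \<in> borel_measurable borel"
  shows "integral\<^sup>L (density lborel (exponential_density z)) f = z * (LINT t:{0<..}|lborel. exp (- z * t) * f t)"
proof -
  have "integral\<^sup>L (density lborel (exponential_density z)) f = (\<integral>t. exponential_density z t * f t \<partial>lborel)"
    using assms exponential_density_nonneg[OF assms(1)] by (subst integral_real_density) auto
  also have "\<dots> = (\<integral>t. z * (indicator {0<..} t *\<^sub>R (exp (- z * t) * f t)) \<partial>lborel)"
  proof (rule integral_cong_AE)
    show "AE t in lborel. exponential_density z t * f t = z * (indicator {0<..} t *\<^sub>R (exp (- z * t) * f t))"
      using AE_lborel_singleton[of 0]
      by eventually_elim (auto simp: exponential_density_def indicator_def mult.commute)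
  qed (use assms in measurable)
  finally show ?thesis by (simp add: set_lebesgue_integral_def)
qed

context subordinator
begin

text \<open>Up to null sets \<open>Y t > s\<close> means \<open>D s < t\<close>, so the tail of \<open>Z\<close> is the Laplace transform of \<open>D s\<close>.\<close>

lemma distr_Z:
  assumes z: "0 < z"
  shows "distr (density lborel (exponential_density z) \<Otimes>\<^sub>M M) borel Z = density lborel (exponential_density (\<phi> z))"
proof -
  let ?E = "density lborel (exponential_density z)"
  interpret E: prob_space ?E by (rule prob_space_exponential_density[OF z])
  interpret EM: pair_prob_space ?E M ..
  have Zm[measurable]: "Z \<in> borel_measurable (?E \<Otimes>\<^sub>M M)"
    using Z_measurable by (subst measurable_cong_sets[OF sets_pair_measure_cong refl]) auto
  have gt: "emeasure (?E \<Otimes>\<^sub>M M) {p \<in> space (?E \<Otimes>\<^sub>M M). a < Z p} = ennreal (exp (- a * \<phi> z))"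
    if a: "0 \<le> a" for a
  proof -
    have [measurable]: "D a \<in> borel_measurable M" by (rule D_measurable[OF a])
    have "emeasure (?E \<Otimes>\<^sub>M M) {p \<in> space (?E \<Otimes>\<^sub>M M). a < Z p} =
       (\<integral>\<^sup>+ \<omega>. emeasure ?E ((\<lambda>t. (t, \<omega>)) -` {p \<in> space (?E \<Otimes>\<^sub>M M). a < Z p}) \<partial>M)"
      by (rule EM.emeasure_pair_measure_alt2) measurable
    also have "\<dots> = (\<integral>\<^sup>+ \<omega>. ennreal (exp (- z * D a \<omega>)) \<partial>M)"
    proof (rule nn_integral_cong_AE)
      show "AE \<omega> in M. emeasure ?E ((\<lambda>t. (t, \<omega>)) -` {p \<in> space (?E \<Otimes>\<^sub>M M). a < Z p}) = ennreal (exp (- z * D a \<omega>))"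
        using D_unbounded AE_space
      proof eventually_elim
        case (elim \<omega>)
        have "emeasure ?E ((\<lambda>t. (t, \<omega>)) -` {p \<in> space (?E \<Otimes>\<^sub>M M). a < Z p}) = emeasure ?E {D a \<omega><..}"
        proof (rule emeasure_eq_AE)
          show "AE t in ?E. t \<in> (\<lambda>t. (t, \<omega>)) -` {p \<in> space (?E \<Otimes>\<^sub>M M). a < Z p} \<longleftrightarrow> t \<in> {D a \<omega><..}"
            \<comment> \<open>The exponential law has no atoms, so the tie t = D a, which the two
              passage lemmas leave open, may be discarded.\<close>
            using AE_exponential_pos[OF z, of "D a \<omega>"]
          proof eventually_elim
            case (elim t)
            then show ?case
              using Y_greater_imp[OF a, of t \<omega>] less_imp_Y_greater[of \<omega> a t] \<open>\<omega> \<in> space M\<close> \<open>\<forall>t. \<exists>r\<ge>0. t < D r \<omega>\<close> a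
              by (auto simp: Z_def space_pair_measure)
          qed
          show "(\<lambda>t. (t, \<omega>)) -` {p \<in> space (?E \<Otimes>\<^sub>M M). a < Z p} \<in> sets ?E"
            by (rule sets_Pair2) measurable
        qed auto
        also have "\<dots> = ennreal (exp (- z * D a \<omega>))"
          using elim by (intro exponential_measure_greater z D_nonneg a)
        finally show ?case .
      qed
    qed
    also have "\<dots> = ennreal (expectation (\<lambda>\<omega>. exp (- z * D a \<omega>)))"
      using z a by (intro nn_integral_eq_integral integrable_const_bound[where B=1])
        (auto intro!: AE_I2 mult_nonneg_nonneg D_nonneg simp: D_measurable)
    finally show ?thesis unfolding D_laplace[OF a z] .
  qed
  have "distributed (?E \<Otimes>\<^sub>M M) lborel Z (exponential_density (\<phi> z))"
  proof (subst EM.exponential_distributed_iff[OF \<phi>_pos[OF z]], intro conjI allI impI)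
    fix a :: real assume a: "0 \<le> a"
    have "measure (?E \<Otimes>\<^sub>M M) {p \<in> space (?E \<Otimes>\<^sub>M M). a < Z p} = exp (- a * \<phi> z)"
      using gt[OF a] by (simp add: measure_def)
    moreover have S: "{p \<in> space (?E \<Otimes>\<^sub>M M). Z p \<le> a} \<in> sets (?E \<Otimes>\<^sub>M M)" by measurable
    have "measure (?E \<Otimes>\<^sub>M M) {p \<in> space (?E \<Otimes>\<^sub>M M). \<not> Z p \<le> a} =
        1 - measure (?E \<Otimes>\<^sub>M M) {p \<in> space (?E \<Otimes>\<^sub>M M). Z p \<le> a}"
      by (rule EM.prob_neg[OF S])
    ultimately show "measure (?E \<Otimes>\<^sub>M M) {p \<in> space (?E \<Otimes>\<^sub>M M). Z p \<le> a} = 1 - exp (- a * \<phi> z)"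
      by (simp add: not_le)
  qed measurable
  then show ?thesis
    unfolding distributed_def by (simp add: distr_cong[OF refl sets_lborel[symmetric]])
qed

text \<open>Both sides are the expectation of G(\<open>Z\<close>) under the product measure: Fubini
  gives the left-hand side, the exponential law of \<open>Z\<close> the right-hand side.\<close>

lemma laplace_Y:
  fixes G :: "real \<Rightarrow> real"
  assumes z: "0 < z" and G: "G \<in> borel_measurable borel" "\<And>s. \<bar>G s\<bar> \<le> B"
  shows "set_integrable lborel {0<..} (\<lambda>t. exp (- z * t) * expectation (\<lambda>\<omega>. G (Y t \<omega>)))"
    and "z * (LINT t:{0<..}|lborel. exp (- z * t) * expectation (\<lambda>\<omega>. G (Y t \<omega>)))
       = \<phi> z * (LINT s:{0<..}|lborel. exp (- \<phi> z * s) * G s)"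
proof -
  let ?E = "density lborel (exponential_density z)"
  interpret E: prob_space ?E by (rule prob_space_exponential_density[OF z])
  interpret EM: pair_prob_space ?E M ..
  have Zm[measurable]: "Z \<in> borel_measurable (?E \<Otimes>\<^sub>M M)"
    using Z_measurable by (subst measurable_cong_sets[OF sets_pair_measure_cong refl]) auto
  note Z_measurable[measurable] G(1)[measurable]
  define F where "F t = expectation (\<lambda>\<omega>. G (Z (t, \<omega>)))" for t
  have Fm: "F \<in> borel_measurable borel"
    unfolding F_def by measurable
  have Fb: "\<bar>F t\<bar> \<le> B" for t
  proof -
    have "(\<lambda>\<omega>. G (Z (t, \<omega>))) \<in> borel_measurable M" by measurable
    then have i: "integrable M (\<lambda>\<omega>. G (Z (t, \<omega>)))"
      using G(2) by (intro integrable_const_bound[where B=B]) auto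
    have "\<bar>F t\<bar> \<le> expectation (\<lambda>\<omega>. \<bar>G (Z (t, \<omega>))\<bar>)"
      unfolding F_def by (rule integral_abs_bound)
    also have "\<dots> \<le> expectation (\<lambda>\<omega>. B)"
      using i G(2) by (intro integral_mono) auto
    finally show ?thesis by (simp add: prob_space)
  qed
  have FY: "F t = expectation (\<lambda>\<omega>. G (Y t \<omega>))" if "t \<in> {0<..}" for t
    using that by (simp add: F_def Z_def)
  show "set_integrable lborel {0<..} (\<lambda>t. exp (- z * t) * expectation (\<lambda>\<omega>. G (Y t \<omega>)))"
  proof (rule set_integrable_cong[THEN iffD1, rotated -1])
    show "set_integrable lborel {0<..} (\<lambda>t. exp (- z * t) * F t)"
      by (rule integrable_exp_bounded[OF z Fm Fb])
  qed (auto simp: FY)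
  have "z * (LINT t:{0<..}|lborel. exp (- z * t) * expectation (\<lambda>\<omega>. G (Y t \<omega>))) =
      z * (LINT t:{0<..}|lborel. exp (- z * t) * F t)"
    by (intro arg_cong[where f="\<lambda>x. z * x"] set_lebesgue_integral_cong) (auto simp: FY)
  also have "\<dots> = integral\<^sup>L ?E F" using integral_exponential_density[OF z Fm] by simp
  also have "\<dots> = (\<integral>p. G (Z p) \<partial>(?E \<Otimes>\<^sub>M M))"
    unfolding F_def using G(2)
    by (intro EM.integral_fst' EM.integrable_const_bound[where B=B]) auto
  also have "\<dots> = integral\<^sup>L (distr (?E \<Otimes>\<^sub>M M) borel Z) G"
    by (rule integral_distr[symmetric]) measurable
  also have "\<dots> = \<phi> z * (LINT s:{0<..}|lborel. exp (- \<phi> z * s) * G s)"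
    unfolding distr_Z[OF z] by (rule integral_exponential_density[OF \<phi>_pos[OF z] G(1)])
  finally show "z * (LINT t:{0<..}|lborel. exp (- z * t) * expectation (\<lambda>\<omega>. G (Y t \<omega>)))
       = \<phi> z * (LINT s:{0<..}|lborel. exp (- \<phi> z * s) * G s)" .
qed

lemma expectation_Y_right_cont:
  fixes G :: "real \<Rightarrow> real"
  assumes G: "continuous_on UNIV G" "\<And>s. \<bar>G s\<bar> \<le> B" and t: "0 < t"
  shows "continuous (at_right t) (\<lambda>t. expectation (\<lambda>\<omega>. G (Y t \<omega>)))"
  unfolding continuous_within tendsto_at_iff_sequentially comp_def
proof (intro allI impI)
  fix X :: "nat \<Rightarrow> real" assume X: "\<forall>n. X n \<in> {t<..} - {t}" "X \<longlonglongrightarrow> t"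
  then have X': "filterlim X (at_right t) sequentially"
    unfolding filterlim_at by (intro conjI always_eventually) auto
  have Gm[measurable]: "G \<in> borel_measurable borel" by (rule borel_measurable_continuous_onI[OF G(1)])
  have Ym[measurable]: "Y s \<in> borel_measurable M" if "0 \<le> s" for s by (rule Y_measurable[OF that])
  show "(\<lambda>n. expectation (\<lambda>\<omega>. G (Y (X n) \<omega>))) \<longlonglongrightarrow> expectation (\<lambda>\<omega>. G (Y t \<omega>))"
  proof (rule integral_dominated_convergence[where w="\<lambda>_. B"])
    show "(\<lambda>\<omega>. G (Y t \<omega>)) \<in> borel_measurable M"
      using t by (intro measurable_compose[OF Ym Gm]) simp
    show "(\<lambda>\<omega>. G (Y (X n) \<omega>)) \<in> borel_measurable M" for n
      using X(1)[rule_format, of n] t by (intro measurable_compose[OF Ym Gm]) simp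
    show "AE \<omega> in M. (\<lambda>n. G (Y (X n) \<omega>)) \<longlonglongrightarrow> G (Y t \<omega>)"
    proof (rule AE_I2)
      fix \<omega>
      have "isCont G (Y t \<omega>)" using G(1) by (simp add: continuous_on_eq_continuous_at)
      then show "(\<lambda>n. G (Y (X n) \<omega>)) \<longlonglongrightarrow> G (Y t \<omega>)"
        by (rule isCont_tendsto_compose[OF _ filterlim_compose[OF Y_right_cont[OF t] X']])
    qed
  qed (use G(2) in auto)
qed

end

section \<open>Time change by an independent process\<close>

context prob_space
begin

text \<open>Evaluation at a random index with countably many values is reduced to fixed indices by
  splitting on the value of \<open>J\<close>.\<close>

lemma expectation_suminf_index:
  fixes h :: "nat \<Rightarrow> 'a \<Rightarrow> real" and J :: "'a \<Rightarrow> nat"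
  assumes J[measurable]: "J \<in> measurable M (count_space UNIV)"
    and h[measurable]: "\<And>j. h j \<in> borel_measurable M" and b: "\<And>j \<omega>. \<bar>h j \<omega>\<bar> \<le> 1"
  shows "expectation (\<lambda>\<omega>. h (J \<omega>) \<omega>) = (\<Sum>j. expectation (\<lambda>\<omega>. indicator {\<omega>\<in>space M. J \<omega> = j} \<omega> * h j \<omega>))"
proof -
  let ?A = "\<lambda>j. {\<omega>\<in>space M. J \<omega> = j}"
  let ?f = "\<lambda>j \<omega>. indicator (?A j) \<omega> * h j \<omega>"
  have i: "integrable M (?f j)" for j
    by (rule integrable_const_bound[where B=1]) (use b in \<open>auto simp: indicator_def\<close>)
  have f: "?f j \<omega> = (if j = J \<omega> then h (J \<omega>) \<omega> else 0)" if "\<omega> \<in> space M" for j \<omega>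
    using that by auto
  have sums: "(\<lambda>j. ?f j \<omega>) sums h (J \<omega>) \<omega>" if "\<omega> \<in> space M" for \<omega>
    unfolding f[OF that] using sums_single[of "J \<omega>" "\<lambda>_. h (J \<omega>) \<omega>"] by (simp add: eq_commute)
  have "expectation (\<lambda>\<omega>. h (J \<omega>) \<omega>) = expectation (\<lambda>\<omega>. \<Sum>j. ?f j \<omega>)"
    by (rule Bochner_Integration.integral_cong) (simp_all add: sums[THEN sums_unique])
  also have "\<dots> = (\<Sum>j. expectation (?f j))"
  proof (rule integral_suminf[OF i])
    show "AE \<omega> in M. summable (\<lambda>j. norm (?f j \<omega>))"
    proof (rule AE_I2)
      fix \<omega> assume "\<omega> \<in> space M"
      have "(\<lambda>j. norm (?f j \<omega>)) = (\<lambda>j. if j = J \<omega> then norm (h (J \<omega>) \<omega>) else 0)"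
        using f[OF \<open>\<omega> \<in> space M\<close>] by auto
      then show "summable (\<lambda>j. norm (?f j \<omega>))" by simp
    qed
    have "(\<lambda>j. prob (?A j)) sums prob (\<Union>j. ?A j)"
      by (rule finite_measure_UNION) (auto simp: disjoint_family_on_def)
    then have "summable (\<lambda>j. prob (?A j))" by (rule sums_summable)
    then show "summable (\<lambda>j. expectation (\<lambda>\<omega>. norm (?f j \<omega>)))"
    proof (rule summable_comparison_test')
      fix j
      have "expectation (\<lambda>\<omega>. norm (?f j \<omega>)) \<le> expectation (indicator (?A j))"
        using b by (intro integral_mono integrable_norm i) (auto simp: indicator_def less_top[symmetric])
      then show "norm (expectation (\<lambda>\<omega>. norm (?f j \<omega>))) \<le> prob (?A j)"
        by simp
    qed
  qed
  finally show ?thesis .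
qed

end

lemma independent_processesD:
  assumes "prob_space M" "independent_processes M X Y" "0 \<le> s" "0 \<le> t" "B \<in> sets borel"
  shows "measure M ({\<omega>\<in>space M. X s \<omega> \<in> A} \<inter> {\<omega>\<in>space M. Y t \<omega> \<in> B})
       = measure M {\<omega>\<in>space M. X s \<omega> \<in> A} * measure M {\<omega>\<in>space M. Y t \<omega> \<in> B}"
    and "Y t \<in> borel_measurable M"
proof -
  interpret prob_space M by fact
  let ?VX = "vimage_algebra (space M) (\<lambda>\<omega>. \<lambda>t\<in>{0..}. X t \<omega>) (Pi\<^sub>M {0..} (\<lambda>_. count_space UNIV))"
  let ?VY = "vimage_algebra (space M) (\<lambda>\<omega>. \<lambda>t\<in>{0..}. Y t \<omega>) (Pi\<^sub>M {0..} (\<lambda>_. borel))"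
  have ind: "indep_set (sets ?VX) (sets ?VY)" using assms(2) by (simp add: independent_processes_def)
  have VX: "{\<omega>\<in>space M. X s \<omega> \<in> A} \<in> sets ?VX"
  proof -
    have "{f \<in> space (Pi\<^sub>M {0..} (\<lambda>_. count_space UNIV)). f s \<in> A} \<in> sets (Pi\<^sub>M {0::real..} (\<lambda>_. count_space UNIV))"
      using assms(3) by (intro measurable_sets_Collect[OF measurable_component_singleton[of s]]) auto
    from in_vimage_algebra[OF this, of "\<lambda>\<omega>. \<lambda>t\<in>{0..}. X t \<omega>" "space M"]
    show ?thesis
      by (rule back_subst[where P="\<lambda>S. S \<in> sets ?VX"]) (use assms(3) in \<open>auto simp: space_PiM\<close>)
  qed
  have VY: "{\<omega>\<in>space M. Y t \<omega> \<in> B} \<in> sets ?VY" if "B \<in> sets borel" for B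
  proof -
    have "{f \<in> space (Pi\<^sub>M {0..} (\<lambda>_. borel)). f t \<in> B} \<in> sets (Pi\<^sub>M {0::real..} (\<lambda>_. borel :: real measure))"
      using assms(4) that by (intro measurable_sets_Collect[OF measurable_component_singleton[of t]]) auto
    from in_vimage_algebra[OF this, of "\<lambda>\<omega>. \<lambda>t\<in>{0..}. Y t \<omega>" "space M"]
    show ?thesis
      by (rule back_subst[where P="\<lambda>S. S \<in> sets ?VY"]) (use assms(4) in \<open>auto simp: space_PiM\<close>)
  qed
  show "measure M ({\<omega>\<in>space M. X s \<omega> \<in> A} \<inter> {\<omega>\<in>space M. Y t \<omega> \<in> B})
       = measure M {\<omega>\<in>space M. X s \<omega> \<in> A} * measure M {\<omega>\<in>space M. Y t \<omega> \<in> B}"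
    by (rule indep_setD[OF ind VX VY[OF assms(5)]])
  show "Y t \<in> borel_measurable M"
  proof (rule measurableI)
    fix B :: "real set" assume "B \<in> sets borel"
    then show "Y t -` B \<inter> space M \<in> sets M"
      using VY[of B] indep_setD_ev2[OF ind] by (auto simp: vimage_def Int_def conj_commute)
  qed simp
qed

text \<open>The random time is replaced by the grid point above it, so that independence is needed
  only for fixed times and countably many events. In the limit, right-constant paths handle the
  process and continuity handles g. Measurability of the time-changed process is obtained on the
  way.\<close>

lemma prob_time_change:
  fixes X :: "real \<Rightarrow> 'a \<Rightarrow> 's" and Y :: "real \<Rightarrow> 'a \<Rightarrow> real" and g :: "real \<Rightarrow> real"
  assumes "prob_space M" "independent_processes M X Y"
    and Xm: "\<And>t. 0 \<le> t \<Longrightarrow> X t \<in> measurable M (count_space UNIV)"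
    and Xr: "\<And>\<omega> t. \<omega> \<in> space M \<Longrightarrow> 0 \<le> t \<Longrightarrow> eventually (\<lambda>u. X u \<omega> = X t \<omega>) (at_right t)"
    and Yn: "\<And>\<omega>. \<omega> \<in> space M \<Longrightarrow> 0 \<le> Y t \<omega>" and t: "0 \<le> t"
    and g: "continuous_on UNIV g" "\<And>s. \<bar>g s\<bar> \<le> 1"
      "\<And>s. 0 \<le> s \<Longrightarrow> measure M {\<omega>\<in>space M. X s \<omega> = x} = g s"
  shows "{\<omega>\<in>space M. time_change X Y t \<omega> = x} \<in> sets M"
    and "measure M {\<omega>\<in>space M. time_change X Y t \<omega> = x} = integral\<^sup>L M (\<lambda>\<omega>. g (Y t \<omega>))"
proof -
  interpret prob_space M by fact
  have Ym[measurable]: "Y t \<in> borel_measurable M"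
    using independent_processesD(2)[OF assms(1,2) t t, of UNIV] by simp
  have gm[measurable]: "g \<in> borel_measurable borel" by (rule borel_measurable_continuous_onI[OF g(1)])
  define J where "J n \<omega> = nat \<lfloor>real (Suc n) * Y t \<omega>\<rfloor>" for n \<omega>
  have Jm[measurable]: "J n \<in> measurable M (count_space UNIV)" for n
    unfolding J_def by measurable
  define pt where "pt n j = (real j + 1) / real (Suc n)" for n j :: nat
  have pt: "pt n (J n \<omega>) = grid_up n (Y t \<omega>)" for n \<omega> by (simp add: pt_def J_def grid_up_def)
  have pt0: "0 \<le> pt n j" for n j by (simp add: pt_def)
  define I where "I s \<omega> = (if X s \<omega> = x then 1 else 0 :: real)" for s \<omega>
  have Im[measurable]: "I s \<in> borel_measurable M" if "0 \<le> s" for s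
    unfolding I_def using Xm[OF that] by measurable
  have Ib: "\<bar>I s \<omega>\<bar> \<le> 1" for s \<omega> by (simp add: I_def)
  have step: "expectation (\<lambda>\<omega>. I (grid_up n (Y t \<omega>)) \<omega>) = expectation (\<lambda>\<omega>. g (grid_up n (Y t \<omega>)))" for n
  proof -
    have "expectation (\<lambda>\<omega>. I (pt n (J n \<omega>)) \<omega>) =
        (\<Sum>j. expectation (\<lambda>\<omega>. indicator {\<omega>\<in>space M. J n \<omega> = j} \<omega> * I (pt n j) \<omega>))"
      by (rule expectation_suminf_index[OF Jm Im[OF pt0] Ib])
    also have "\<dots> = (\<Sum>j. expectation (\<lambda>\<omega>. indicator {\<omega>\<in>space M. J n \<omega> = j} \<omega> * g (pt n j)))"
    proof (rule suminf_cong)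
      fix j
      let ?B = "{y. nat \<lfloor>real (Suc n) * y\<rfloor> = j}"
      have B: "?B \<in> sets borel" by measurable
      have X: "{\<omega>\<in>space M. X (pt n j) \<omega> \<in> {x}} \<in> sets M"
        using measurable_sets[OF Xm[OF pt0[of n j]], of "{x}"] by (simp add: vimage_def Int_def conj_commute)
      have JB: "{\<omega>\<in>space M. J n \<omega> = j} = {\<omega>\<in>space M. Y t \<omega> \<in> ?B}" by (simp add: J_def)
      have "expectation (\<lambda>\<omega>. indicator {\<omega>\<in>space M. J n \<omega> = j} \<omega> * I (pt n j) \<omega>) =
          expectation (indicator ({\<omega>\<in>space M. X (pt n j) \<omega> \<in> {x}} \<inter> {\<omega>\<in>space M. Y t \<omega> \<in> ?B}))"
        by (intro Bochner_Integration.integral_cong) (auto simp: I_def JB indicator_def)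
      also have "\<dots> = prob ({\<omega>\<in>space M. X (pt n j) \<omega> \<in> {x}} \<inter> {\<omega>\<in>space M. Y t \<omega> \<in> ?B})"
        by (simp add: Int_absorb2 subset_iff)
      also have "\<dots> = prob {\<omega>\<in>space M. X (pt n j) \<omega> \<in> {x}} * prob {\<omega>\<in>space M. Y t \<omega> \<in> ?B}"
        by (rule independent_processesD(1)[OF assms(1,2) pt0 t B])
      also have "\<dots> = g (pt n j) * prob {\<omega>\<in>space M. J n \<omega> = j}"
        unfolding JB using g(3)[OF pt0[of n j]] by simp
      also have "\<dots> = expectation (\<lambda>\<omega>. indicator {\<omega>\<in>space M. J n \<omega> = j} \<omega> * g (pt n j))"
        by (simp add: mult.commute)
      finally show "expectation (\<lambda>\<omega>. indicator {\<omega>\<in>space M. J n \<omega> = j} \<omega> * I (pt n j) \<omega>) =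
        expectation (\<lambda>\<omega>. indicator {\<omega>\<in>space M. J n \<omega> = j} \<omega> * g (pt n j))" .
    qed
    also have "\<dots> = expectation (\<lambda>\<omega>. g (pt n (J n \<omega>)))"
      \<comment> \<open>The same decomposition, now with deterministic summands, reassembles the
        expectation.\<close>
      by (rule expectation_suminf_index[OF Jm, of "\<lambda>j _. g (pt n j)", symmetric]) (use g(2) in auto)
    finally show ?thesis by (simp add: pt)
  qed
  have Ilim: "(\<lambda>n. I (grid_up n (Y t \<omega>)) \<omega>) \<longlonglongrightarrow> I (Y t \<omega>) \<omega>" if "\<omega> \<in> space M" for \<omega>
  proof -
    have "eventually (\<lambda>n. X (grid_up n (Y t \<omega>)) \<omega> = X (Y t \<omega>) \<omega>) sequentially"
      by (rule filterlim_iff[THEN iffD1, rule_format, OF filterlim_grid_up[OF Yn[OF that]] Xr[OF that Yn[OF that]]])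
    then show ?thesis
      by (intro tendsto_eventually) (auto simp: I_def elim!: eventually_mono)
  qed
  have Inm: "(\<lambda>\<omega>. I (grid_up n (Y t \<omega>)) \<omega>) \<in> borel_measurable M" for n
    unfolding pt[symmetric] by (rule measurable_compose_countable[OF Im[OF pt0] Jm])
  have IYm: "(\<lambda>\<omega>. I (Y t \<omega>) \<omega>) \<in> borel_measurable M"
    by (rule borel_measurable_LIMSEQ_real[OF Ilim Inm])
  have "{\<omega>\<in>space M. I (Y t \<omega>) \<omega> = 1} \<in> sets M" using IYm by measurable
  moreover have eq: "{\<omega>\<in>space M. I (Y t \<omega>) \<omega> = 1} = {\<omega>\<in>space M. time_change X Y t \<omega> = x}"
    by (auto simp: I_def time_change_def)
  ultimately show S: "{\<omega>\<in>space M. time_change X Y t \<omega> = x} \<in> sets M" by simp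
  have "(\<lambda>n. expectation (\<lambda>\<omega>. I (grid_up n (Y t \<omega>)) \<omega>)) \<longlonglongrightarrow> expectation (\<lambda>\<omega>. I (Y t \<omega>) \<omega>)"
    by (rule integral_dominated_convergence[where w="\<lambda>_. 1", OF IYm Inm]) (use Ilim Ib in auto)
  moreover have "(\<lambda>n. expectation (\<lambda>\<omega>. g (grid_up n (Y t \<omega>)))) \<longlonglongrightarrow> expectation (\<lambda>\<omega>. g (Y t \<omega>))"
  proof (rule integral_dominated_convergence[where w="\<lambda>_. 1"])
    show "(\<lambda>\<omega>. g (grid_up n (Y t \<omega>))) \<in> borel_measurable M" for n
      unfolding grid_up_def by measurable
    show "AE \<omega> in M. (\<lambda>n. g (grid_up n (Y t \<omega>))) \<longlonglongrightarrow> g (Y t \<omega>)"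
    proof (rule AE_I2)
      fix \<omega> assume "\<omega> \<in> space M"
      then have "(\<lambda>n. grid_up n (Y t \<omega>)) \<longlonglongrightarrow> Y t \<omega>"
        using filterlim_grid_up[OF Yn] by (simp add: filterlim_at)
      then show "(\<lambda>n. g (grid_up n (Y t \<omega>))) \<longlonglongrightarrow> g (Y t \<omega>)"
        using g(1) by (intro isCont_tendsto_compose[of _ g]) (simp add: continuous_on_eq_continuous_at)
    qed
  qed (use g(2) in auto)
  ultimately have "expectation (\<lambda>\<omega>. I (Y t \<omega>) \<omega>) = expectation (\<lambda>\<omega>. g (Y t \<omega>))"
    unfolding step by (rule LIMSEQ_unique)
  moreover have "expectation (\<lambda>\<omega>. I (Y t \<omega>) \<omega>) = expectation (indicator {\<omega>\<in>space M. time_change X Y t \<omega> = x})"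
    by (intro Bochner_Integration.integral_cong) (auto simp: I_def time_change_def indicator_def)
  moreover have "\<dots> = measure M {\<omega>\<in>space M. time_change X Y t \<omega> = x}"
    by (simp add: Int_absorb2 subset_iff)
  ultimately show "measure M {\<omega>\<in>space M. time_change X Y t \<omega> = x} = integral\<^sup>L M (\<lambda>\<omega>. g (Y t \<omega>))" by simp
qed

section \<open>The series solution\<close>

lemma has_sum_finite_sum:
  fixes f :: "'y \<Rightarrow> 'i \<Rightarrow> 'b::topological_comm_monoid_add"
  assumes "finite F" "\<And>y. y \<in> F \<Longrightarrow> (f y has_sum s y) A"
  shows "((\<lambda>i. \<Sum>y\<in>F. f y i) has_sum (\<Sum>y\<in>F. s y)) A"
  using assms by (induction F rule: finite_induct) (auto intro!: has_sum_add)

text \<open>A double geometric series, enumerated by a single index; it dominates all the series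
  over (n, m) below.\<close>

lemma summable_half_power_decode:
  "summable (\<lambda>i. (1/2::real) ^ (fst (prod_decode i) + snd (prod_decode i)))"
proof -
  have half: "((\<lambda>n. (1/2::real) ^ n) has_sum 2) UNIV"
    using geometric_sums[of "1/2::real"] by (intro sums_nonneg_imp_has_sum) auto
  have "(\<lambda>(n, m). (1/2::real) ^ (n + m)) summable_on UNIV \<times> UNIV"
  proof (rule summable_on_SigmaI)
    show "((\<lambda>m. case (n, m) of (n, m) \<Rightarrow> (1/2::real) ^ (n + m)) has_sum (1/2) ^ n * 2) UNIV" for n
      using has_sum_cmult_right[OF half, of "(1/2)^n"] by (simp add: power_add)
    show "(\<lambda>n. (1/2::real) ^ n * 2) summable_on UNIV"
      using has_sum_cmult_left[OF half, of 2] by (auto simp: summable_on_def)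
  qed auto
  then have "(\<lambda>p. (1/2::real) ^ (fst p + snd p)) summable_on UNIV"
    by (simp add: case_prod_unfold)
  then have "(\<lambda>i. (1/2::real) ^ (fst (prod_decode i) + snd (prod_decode i))) summable_on UNIV"
    by (subst summable_on_reindex_bij_betw[OF bij_prod_decode])
  then show ?thesis by (rule summable_on_imp_summable)
qed

text \<open>\<open>r y x\<close> is the coefficient of the value at y in the equation at x, and
  \<open>N x\<close> collects the relevant y. The row sums bounded by \<open>K\<close> make
  \<open>A\<close> a bounded operator for the supremum norm.\<close>

locale forward_operator =
  fixes S :: "'s set" and N :: "'s \<Rightarrow> 's set" and r :: "'s \<Rightarrow> 's \<Rightarrow> real" and K :: real
    and a b c d :: real and x0 :: 's
  assumes N: "\<And>x. x \<in> S \<Longrightarrow> finite (N x)" "\<And>x. x \<in> S \<Longrightarrow> N x \<subseteq> S"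
    and r_bound: "\<And>x. x \<in> S \<Longrightarrow> (\<Sum>y\<in>N x. \<bar>r y x\<bar>) \<le> K"
    and K_nonneg: "0 \<le> K"
    and orders: "0 < b" "b < a" "a < 1" and weights: "0 < c" "0 \<le> d"
begin

definition A :: "('s \<Rightarrow> real) \<Rightarrow> 's \<Rightarrow> real" where
  "A v x = (\<Sum>y\<in>N x. r y x * v y)"

lemma A_bound:
  assumes "x \<in> S" "\<And>y. y \<in> S \<Longrightarrow> \<bar>v y\<bar> \<le> C" "0 \<le> C"
  shows "\<bar>A v x\<bar> \<le> K * C"
proof -
  have "\<bar>A v x\<bar> \<le> (\<Sum>y\<in>N x. \<bar>r y x\<bar> * \<bar>v y\<bar>)"
    unfolding A_def abs_mult[symmetric] by (rule sum_abs)
  also have "\<dots> \<le> (\<Sum>y\<in>N x. \<bar>r y x\<bar> * C)"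
    using assms N(2) by (intro sum_mono mult_left_mono) auto
  also have "\<dots> \<le> K * C"
    unfolding sum_distrib_right[symmetric] using assms r_bound by (intro mult_right_mono) auto
  finally show ?thesis .
qed

text \<open>Coefficients of \<open>t powr (n a + m (a - b)) / Gamma (1 + n a + m (a - b))\<close> in the series solution of
  \<open>c D\<^sup>a F + d D\<^sup>b F = A F\<close>: differentiation of order \<open>a\<close> shifts \<open>(n + 1, m)\<close> to \<open>(n, m)\<close>, and that of order
  \<open>b\<close> shifts \<open>(n + 1, m)\<close> to \<open>(n, m + 1)\<close>.\<close>

fun coef :: "nat \<Rightarrow> nat \<Rightarrow> 's \<Rightarrow> real" where
  "coef 0 0 = (\<lambda>x. of_bool (x = x0))"
| "coef 0 (Suc m) = (\<lambda>x. 0)"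
| "coef (Suc n) 0 = (\<lambda>x. A (coef n 0) x / c)"
| "coef (Suc n) (Suc m) = (\<lambda>x. (A (coef n (Suc m)) x - d * coef (Suc n) m x) / c)"

text \<open>The growth rate for which the induction closes: one step of the recursion multiplies by
  at most (K + d) / c.\<close>

definition R :: real where "R = 1 + (K + d) / c"

lemma R_ge: "1 \<le> R" "K + d \<le> c * R"
  using weights K_nonneg by (auto simp: R_def field_simps)

lemma coef_bound: "x \<in> S \<Longrightarrow> \<bar>coef n m x\<bar> \<le> R ^ (n + m)"
proof (induction n m arbitrary: x rule: coef.induct)
  case 1 then show ?case by simp
next
  case (2 m) then show ?case using R_ge by simp
next
  case (3 n)
  have "\<bar>A (coef n 0) x\<bar> \<le> K * R ^ n"
    using 3 R_ge by (intro A_bound) auto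
  also have "\<dots> \<le> (c * R) * R ^ n" using R_ge weights by (intro mult_right_mono) auto
  finally show ?case using weights by (simp add: field_simps)
next
  case (4 n m)
  have "\<bar>A (coef n (Suc m)) x\<bar> \<le> K * R ^ (n + Suc m)"
    using 4 R_ge by (intro A_bound) auto
  moreover have "\<bar>d * coef (Suc n) m x\<bar> \<le> d * R ^ (n + Suc m)"
    using "4.IH"(2)[OF 4(3)] weights by (simp add: abs_mult mult_left_mono)
  ultimately have "\<bar>A (coef n (Suc m)) x - d * coef (Suc n) m x\<bar> \<le> (K + d) * R ^ (n + Suc m)"
    by (simp add: distrib_right)
  also have "\<dots> \<le> (c * R) * R ^ (n + Suc m)" using R_ge weights by (intro mult_right_mono) auto
  finally show ?case using weights by (simp add: field_simps)
qed

definition ex :: "nat \<times> nat \<Rightarrow> real" where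
  "ex p = real (fst p) * a + real (snd p) * (a - b)"

text \<open>Chosen so that B^(-(a - b)) = 1 / (2 R). Every unit of n + m lowers the power by at
  least this factor against a growth of \<open>R\<close>, which leaves 1/2.\<close>

definition B :: real where "B = (2 * R) powr (1 / (a - b))"

abbreviation w :: "'s \<Rightarrow> nat \<Rightarrow> real" where
  "w x i \<equiv> coef (fst (prod_decode i)) (snd (prod_decode i)) x"

abbreviation \<gamma> :: "nat \<Rightarrow> real" where
  "\<gamma> i \<equiv> ex (prod_decode i)"

lemma ex_nonneg: "0 \<le> ex p" using orders by (simp add: ex_def)

lemma ex_eq_0: "ex p = 0 \<longleftrightarrow> p = (0, 0)"
  using orders by (cases p) (auto simp: ex_def add_nonneg_eq_0_iff)

lemma B_ge_1: "1 \<le> B"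
  unfolding B_def using R_ge orders by (intro ge_one_powr_ge_zero) auto

lemma weight_bound:
  assumes "x \<in> S" "B \<le> z"
  shows "\<bar>w x i\<bar> * z powr (- \<gamma> i) \<le> (1/2) ^ (fst (prod_decode i) + snd (prod_decode i))"
proof -
  obtain n m where nm: "prod_decode i = (n, m)" by fastforce
  have "z powr (- \<gamma> i) \<le> B powr (- \<gamma> i)"
    using assms B_ge_1 ex_nonneg by (intro powr_mono2') auto
  also have "\<dots> \<le> B powr (- (real (n + m) * (a - b)))"
  proof (rule powr_mono)
    have "real n * (a - b) \<le> real n * a" using orders by (intro mult_left_mono) auto
    then show "- \<gamma> i \<le> - (real (n + m) * (a - b))" by (simp add: nm ex_def algebra_simps)
  qed (rule B_ge_1)
  also have "\<dots> = (2 * R) powr (- real (n + m))"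
    unfolding B_def using orders by (simp add: powr_powr)
  also have "\<dots> = inverse ((2 * R) ^ (n + m))"
    using R_ge by (subst powr_minus, subst powr_realpow) auto
  finally have "\<bar>w x i\<bar> * z powr (- \<gamma> i) \<le> R ^ (n + m) * inverse ((2 * R) ^ (n + m))"
    using coef_bound[OF assms(1), of n m] R_ge by (intro mult_mono) (auto simp: nm)
  also have "\<dots> = (1/2) ^ (n + m)"
    using R_ge by (simp add: power_mult_distrib power_divide field_simps)
  finally show ?thesis by (simp add: nm)
qed

lemma fractional_series_w: "x \<in> S \<Longrightarrow> fractional_series (w x) \<gamma> B"
proof
  assume x: "x \<in> S"
  show "summable (\<lambda>i. \<bar>w x i\<bar> * B powr (- \<gamma> i))"
    by (rule summable_comparison_test'[OF summable_half_power_decode])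
       (use weight_bound[OF x order_refl] in auto)
qed (use ex_nonneg B_ge_1 in auto)

text \<open>One algebraic identity for two uses: with U(s) = t^s / Gamma (1 + s) it becomes the
  fractional equation, with U(s) = z^(-s) its Laplace transform. Either way an operator of order
  \<delta> lowers exponents by \<delta>.\<close>

lemma coef_recursion:
  fixes U :: "real \<Rightarrow> real"
  assumes "x \<in> S"
    and s1: "((\<lambda>i. if \<gamma> i = 0 then 0 else w x i * U (\<gamma> i - a)) has_sum s1) UNIV"
    and s2: "((\<lambda>i. if \<gamma> i = 0 then 0 else w x i * U (\<gamma> i - b)) has_sum s2) UNIV"
    and s: "\<And>y. y \<in> S \<Longrightarrow> ((\<lambda>i. w y i * U (\<gamma> i)) has_sum s y) UNIV"
  shows "c * s1 + d * s2 = A s x"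
proof -
  have shift: "((\<lambda>(n, m). coef (Suc n) m x * U (ex (Suc n, m) - \<delta>)) has_sum s') UNIV"
    if "((\<lambda>i. if \<gamma> i = 0 then 0 else w x i * U (\<gamma> i - \<delta>)) has_sum s') UNIV" for \<delta> s'
  proof -
    let ?F = "\<lambda>p. if ex p = 0 then 0 else coef (fst p) (snd p) x * U (ex p - \<delta>)"
    have "(?F has_sum s') UNIV"
      using that by (rule has_sum_reindex_bij_betw[OF bij_prod_decode, THEN iffD1])
    \<comment> \<open>Indices with n = 0 contribute nothing: (0, 0) has exponent 0, and the other
      coefficients with n = 0 vanish.\<close>
    then have "(?F has_sum s') ((\<lambda>(n, m). (Suc n, m)) ` UNIV)"
    proof (rule has_sum_cong_neutral[THEN iffD1, rotated -1])
      fix p :: "nat \<times> nat" assume p: "p \<in> UNIV - (\<lambda>(n, m). (Suc n, m)) ` UNIV"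
      obtain n m where nm: "p = (n, m)" by fastforce
      have "n = 0" using p unfolding nm by (cases n) (auto intro: image_eqI[of _ _ "(n - 1, m)"])
      then show "?F p = 0" by (cases m) (auto simp: nm ex_eq_0)
    qed auto
    then have "((?F \<circ> (\<lambda>(n, m). (Suc n, m))) has_sum s') UNIV"
      by (subst (asm) has_sum_reindex) (auto simp: inj_on_def)
    then show ?thesis by (simp add: o_def case_prod_unfold ex_eq_0)
  qed
  have e1: "ex (Suc n, m) - a = ex (n, m)" for n m by (simp add: ex_def algebra_simps)
  have e2: "ex (Suc n, m) - b = ex (n, Suc m)" for n m by (simp add: ex_def algebra_simps)
  \<comment> \<open>After the shifts both sums carry the same factor at (n, m). The order b part
    reaches only m > 0, so \<open>?G2\<close> is padded with 0 at m = 0.\<close>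
  let ?G1 = "\<lambda>(n, m). coef (Suc n) m x * U (ex (n, m))"
  let ?G2 = "\<lambda>(n, m). (case m of 0 \<Rightarrow> 0 | Suc m' \<Rightarrow> coef (Suc n) m' x) * U (ex (n, m))"
  have g1: "(?G1 has_sum s1) UNIV" using shift[OF s1] by (simp add: e1)
  have "((?G2 \<circ> (\<lambda>(n, m). (n, Suc m))) has_sum s2) UNIV"
    using shift[OF s2] by (simp add: e2 o_def case_prod_unfold)
  then have "(?G2 has_sum s2) ((\<lambda>(n, m). (n, Suc m)) ` UNIV)"
    by (subst has_sum_reindex) (auto simp: inj_on_def)
  then have g2: "(?G2 has_sum s2) UNIV"
  proof (rule has_sum_cong_neutral[THEN iffD1, rotated -1])
    fix p :: "nat \<times> nat" assume p: "p \<in> UNIV - (\<lambda>(n, m). (n, Suc m)) ` UNIV"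
    obtain n m where nm: "p = (n, m)" by fastforce
    have "m = 0" using p unfolding nm by (cases m) (auto intro: image_eqI[of _ _ "(n, m - 1)"])
    then show "?G2 p = 0" by (simp add: nm)
  qed auto
  have h1: "((\<lambda>p. c * ?G1 p + d * ?G2 p) has_sum c * s1 + d * s2) UNIV"
    by (intro has_sum_add has_sum_cmult_right g1 g2)
  have eq: "c * ?G1 p + d * ?G2 p = (\<Sum>y\<in>N x. r y x * (coef (fst p) (snd p) y * U (ex p)))" for p
  proof -
    obtain n m where nm: "p = (n, m)" by fastforce
    have "c * coef (Suc n) m x + d * (case m of 0 \<Rightarrow> 0 | Suc m' \<Rightarrow> coef (Suc n) m' x) = A (coef n m) x"
      using weights by (cases m) auto
    then have "(c * coef (Suc n) m x + d * (case m of 0 \<Rightarrow> 0 | Suc m' \<Rightarrow> coef (Suc n) m' x)) * U (ex (n, m))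
        = A (coef n m) x * U (ex (n, m))" by simp
    then show ?thesis
      unfolding nm A_def by (simp add: sum_distrib_left algebra_simps)
  qed
  have h2: "((\<lambda>p. \<Sum>y\<in>N x. r y x * (coef (fst p) (snd p) y * U (ex p))) has_sum A s x) UNIV"
    unfolding A_def
  proof (intro has_sum_finite_sum has_sum_cmult_right N assms(1))
    fix y assume "y \<in> N x"
    then have "y \<in> S" using N(2)[OF assms(1)] by auto
    from s[OF this] show "((\<lambda>p. coef (fst p) (snd p) y * U (ex p)) has_sum s y) UNIV"
      by (rule has_sum_reindex_bij_betw[OF bij_prod_decode, THEN iffD1])
  qed
  show ?thesis by (rule has_sum_unique[OF h1[unfolded eq] h2])
qed

definition F :: "'s \<Rightarrow> real \<Rightarrow> real" where
  "F x = fractional_series.fsum (w x) \<gamma>"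

lemma F_caputo_differentiable:
  "x \<in> S \<Longrightarrow> 0 < t \<Longrightarrow> 0 < \<alpha> \<Longrightarrow> \<alpha> < 1 \<Longrightarrow> caputo_differentiable \<alpha> (F x) t"
  unfolding F_def by (rule fractional_series.caputo_fsum(1)[OF fractional_series_w])

lemma isCont_F: "x \<in> S \<Longrightarrow> 0 < t \<Longrightarrow> isCont (F x) t"
  unfolding F_def by (rule fractional_series.isCont_fsum[OF fractional_series_w])

lemma F_equation:
  assumes x: "x \<in> S" and t: "0 < t"
  shows "c * caputo_deriv a (F x) t + d * caputo_deriv b (F x) t = A (\<lambda>y. F y t) x"
proof (rule coef_recursion[OF x, where U="\<lambda>s. t powr s * inverse (Gamma (1 + s))"])
  have "((\<lambda>i. if \<gamma> i = 0 then 0 else w x i * (t powr (\<gamma> i - \<alpha>) * inverse (Gamma (1 + \<gamma> i - \<alpha>))))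
      has_sum caputo_deriv \<alpha> (F x) t) UNIV" if "0 < \<alpha>" "\<alpha> < 1" for \<alpha>
    unfolding F_def using fractional_series_w[OF x] t that
    by (intro norm_summable_imp_has_sum fractional_series.summable_caputo_terms fractional_series.caputo_fsum(2))
  from this[of a] this[of b] orders
  show "((\<lambda>i. if \<gamma> i = 0 then 0 else w x i * (t powr (\<gamma> i - a) * inverse (Gamma (1 + (\<gamma> i - a)))))
      has_sum caputo_deriv a (F x) t) UNIV"
    and "((\<lambda>i. if \<gamma> i = 0 then 0 else w x i * (t powr (\<gamma> i - b) * inverse (Gamma (1 + (\<gamma> i - b)))))
      has_sum caputo_deriv b (F x) t) UNIV"
    unfolding add_diff_eq by simp_all
  fix y assume "y \<in> S"
  then interpret fractional_series "w y" \<gamma> B by (rule fractional_series_w)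
  have "summable (\<lambda>i. norm (w y i * (t powr \<gamma> i * inverse (Gamma (\<gamma> i + 1)))))"
    using summable_norm_term[of t 1] t by simp
  moreover from this have "(\<lambda>i. w y i * (t powr \<gamma> i * inverse (Gamma (\<gamma> i + 1)))) sums F y t"
    unfolding F_def fsum_def by (rule summable_sums[OF summable_norm_cancel])
  ultimately show "((\<lambda>i. w y i * (t powr \<gamma> i * inverse (Gamma (1 + \<gamma> i)))) has_sum F y t) UNIV"
    unfolding add.commute[of 1] by (rule norm_summable_imp_has_sum)
qed

lemma F_laplace_integrable:
  "x \<in> S \<Longrightarrow> B \<le> z \<Longrightarrow> set_integrable lborel {0<..} (\<lambda>t. exp (- z * t) * F x t)"
  unfolding F_def by (rule fractional_series.laplace_fsum(1)[OF fractional_series_w])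

definition LF :: "real \<Rightarrow> 's \<Rightarrow> real" where
  "LF z x = z * (LINT t:{0<..}|lborel. exp (- z * t) * F x t)"

lemma LF_sums: "x \<in> S \<Longrightarrow> B \<le> z \<Longrightarrow> (\<lambda>i. w x i * z powr (- \<gamma> i)) sums LF z x"
  unfolding LF_def F_def by (rule fractional_series.laplace_fsum(2)[OF fractional_series_w])

text \<open>The bound has to be uniform in the state, since uniqueness is argued in the supremum
  norm.\<close>

lemma LF_bounded:
  assumes "B \<le> z"
  obtains C where "0 \<le> C" "\<And>x. x \<in> S \<Longrightarrow> \<bar>LF z x\<bar> \<le> C"
proof
  define C where "C = (\<Sum>i. (1/2::real) ^ (fst (prod_decode i) + snd (prod_decode i)))"
  show "0 \<le> C" unfolding C_def by (intro suminf_nonneg summable_half_power_decode) auto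
  fix x assume x: "x \<in> S"
  have b: "norm (w x i * z powr (- \<gamma> i)) \<le> (1/2) ^ (fst (prod_decode i) + snd (prod_decode i))" for i
    using weight_bound[OF x assms, of i] by (simp add: abs_mult)
  have "\<bar>LF z x\<bar> = norm (\<Sum>i. w x i * z powr (- \<gamma> i))"
    using sums_unique[OF LF_sums[OF x assms]] by simp
  also have "\<dots> \<le> C"
    unfolding C_def by (rule norm_suminf_le[OF b summable_half_power_decode])
  finally show "\<bar>LF z x\<bar> \<le> C" .
qed

lemma LF_equation:
  assumes x: "x \<in> S" and z: "B \<le> z"
  defines "\<phi> \<equiv> c * z powr a + d * z powr b"
  shows "\<phi> * LF z x = \<phi> * of_bool (x = x0) + A (LF z) x"
proof -
  have z0: "0 < z" using z B_ge_1 by simp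
  have hs: "((\<lambda>i. w y i * z powr (- \<gamma> i)) has_sum LF z y) UNIV" if "y \<in> S" for y
    using fractional_series.summable_laplace_terms[OF fractional_series_w[OF that] z] LF_sums[OF that z]
    by (rule norm_summable_imp_has_sum)
  have i0: "prod_encode (0, 0) = 0" by (simp add: prod_encode_def)
  \<comment> \<open>This is the rule that a Caputo derivative of order \<delta> multiplies the
    transform by z^\<delta> after subtraction of the initial value, which is the coefficient of
    exponent 0.\<close>
  have shift: "((\<lambda>i. if \<gamma> i = 0 then 0 else w x i * z powr (- (\<gamma> i - \<delta>))) has_sum
      z powr \<delta> * (LF z x - of_bool (x = x0))) UNIV" for \<delta>
  proof -
    have g0: "\<gamma> i = 0 \<longleftrightarrow> i = 0" for i
      using ex_eq_0[of "prod_decode i"] prod_decode_inverse[of i] i0 by (metis prod_encode_inverse)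
    have d0: "prod_decode 0 = (0, 0)" using i0 prod_encode_inverse by metis
    have "((\<lambda>i. w x i * z powr (- \<gamma> i)) has_sum w x 0) {0}"
      using has_sum_finite[of "{0}" "\<lambda>i. w x i * z powr (- \<gamma> i)"] z0 by (simp add: d0 ex_def)
    from has_sum_Diff[OF hs[OF x] this]
    have "((\<lambda>i. w x i * z powr (- \<gamma> i)) has_sum (LF z x - of_bool (x = x0))) (UNIV - {0})"
      by (simp add: d0)
    then have "((\<lambda>i. if \<gamma> i = 0 then 0 else w x i * z powr (- \<gamma> i)) has_sum (LF z x - of_bool (x = x0))) UNIV"
      by (rule has_sum_cong_neutral[THEN iffD1, rotated -1]) (auto simp: g0)
    from has_sum_cmult_right[OF this, of "z powr \<delta>"]
    show ?thesis
      by (rule has_sum_cong[THEN iffD1, rotated]) (auto simp: powr_add[symmetric] mult.left_commute)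
  qed
  have "c * (z powr a * (LF z x - of_bool (x = x0))) + d * (z powr b * (LF z x - of_bool (x = x0))) = A (LF z) x"
    by (rule coef_recursion[OF x, where U="\<lambda>s. z powr (- s)"]) (use shift hs in auto)
  then show ?thesis by (simp add: \<phi>_def algebra_simps)
qed

text \<open>Iterating v = A v / \<phi> n times bounds v by (K / \<phi>)^n C, which tends to
  0.\<close>

lemma bounded_eigenvector_zero:
  assumes v: "\<And>x. x \<in> S \<Longrightarrow> \<phi> * v x = A v x" and bd: "\<And>x. x \<in> S \<Longrightarrow> \<bar>v x\<bar> \<le> C"
    and \<phi>: "K < \<phi>" and x: "x \<in> S"
  shows "v x = 0"
proof -
  have \<phi>0: "0 < \<phi>" using \<phi> K_nonneg by simp
  have C: "0 \<le> C" using bd[OF x] by linarith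
  have "\<bar>v x\<bar> \<le> (K / \<phi>) ^ n * C" if "x \<in> S" for n x
    using that
  proof (induction n arbitrary: x)
    case (Suc n)
    have "\<phi> * \<bar>v x\<bar> = \<bar>A v x\<bar>"
      unfolding v[OF Suc.prems, symmetric] using \<phi>0 by (simp add: abs_mult)
    also have "\<dots> \<le> K * ((K / \<phi>) ^ n * C)"
      using Suc C K_nonneg \<phi>0 by (intro A_bound) auto
    finally show ?case using \<phi>0 by (simp add: field_simps)
  qed (use bd in simp)
  moreover have "(\<lambda>n. (K / \<phi>) ^ n * C) \<longlonglongrightarrow> 0 * C"
    using \<phi> \<phi>0 K_nonneg by (intro tendsto_mult_right LIMSEQ_realpow_zero) auto
  ultimately have "\<bar>v x\<bar> \<le> 0 * C"
    using x by (intro LIMSEQ_le_const) auto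
  then show ?thesis by simp
qed

end

section \<open>Identification of the time-changed chain\<close>

locale time_changed_chain =
  subordinator M D \<phi> + bounded_transition_function S q P qb + forward_operator S N r K a b c d x0
  for M :: "'a measure" and D \<phi> and S :: "'s set" and q P qb N r K a b c d x0 +
  fixes X :: "real \<Rightarrow> 'a \<Rightarrow> 's"
  assumes \<phi>_eq: "\<And>z. 0 < z \<Longrightarrow> \<phi> z = c * z powr a + d * z powr b"
    and r_eq: "\<And>x y. x \<in> S \<Longrightarrow> y \<in> N x \<Longrightarrow> r y x = (if y = x then - exit x else q y x)"
    and self_in_N: "\<And>x. x \<in> S \<Longrightarrow> x \<in> N x"
    and not_in_N: "\<And>x l. x \<in> S \<Longrightarrow> l \<in> S - N x \<Longrightarrow> q l x = 0"
    and x0_in: "x0 \<in> S"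
    and X_measurable: "\<And>t. 0 \<le> t \<Longrightarrow> X t \<in> measurable M (count_space UNIV)"
    and X_right_const: "\<And>\<omega> t. \<omega> \<in> space M \<Longrightarrow> 0 \<le> t \<Longrightarrow> eventually (\<lambda>u. X u \<omega> = X t \<omega>) (at_right t)"
    and X_prob: "\<And>t x. 0 \<le> t \<Longrightarrow> x \<in> S \<Longrightarrow> prob {\<omega>\<in>space M. X t \<omega> = x} = P t x0 x"
    and indep: "independent_processes M X (inverse_subordinator D)"
begin

text \<open>The law of the chain before the time change, continued constantly to negative times so
  as to be continuous on the whole line.\<close>

definition g :: "'s \<Rightarrow> real \<Rightarrow> real" where
  "g x s = P (max 0 s) x0 x"

lemma g_bound: "x \<in> S \<Longrightarrow> \<bar>g x s\<bar> \<le> 1"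
  using P_nonneg[of "max 0 s" x0 x] P_le_1[of "max 0 s" x0 x] x0_in by (simp add: g_def)

lemma continuous_on_g: "x \<in> S \<Longrightarrow> continuous_on T (g x)"
  unfolding g_def using x0_in
  by (intro continuous_on_compose2[OF continuous_on_P]) (auto intro!: continuous_intros)

lemma g_measurable: "x \<in> S \<Longrightarrow> g x \<in> borel_measurable borel"
  by (rule borel_measurable_continuous_onI[OF continuous_on_g])

lemma g_forward:
  assumes x: "x \<in> S" and t: "0 < t"
  shows "(g x has_real_derivative A (\<lambda>y. g y t) x) (at t)"
proof -
  have "((\<lambda>t. P t x0 x) has_real_derivative (\<Sum>l\<in>N x - {x}. P t x0 l * q l x) - P t x0 x * exit x) (at t)"
    using N[OF x] by (intro forward_equation[OF t x0_in x] not_in_N x) auto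
  also have "(\<Sum>l\<in>N x - {x}. P t x0 l * q l x) - P t x0 x * exit x = A (\<lambda>y. g y t) x"
  proof -
    have "A (\<lambda>y. g y t) x = r x x * g x t + (\<Sum>l\<in>N x - {x}. r l x * g l t)"
      unfolding A_def using N(1)[OF x] self_in_N[OF x] by (rule sum.remove)
    also have "(\<Sum>l\<in>N x - {x}. r l x * g l t) = (\<Sum>l\<in>N x - {x}. P t x0 l * q l x)"
      using t by (intro sum.cong) (auto simp: r_eq[OF x] g_def)
    finally show ?thesis using t by (simp add: r_eq[OF x self_in_N[OF x]] g_def)
  qed
  finally have "((\<lambda>t. P t x0 x) has_real_derivative A (\<lambda>y. g y t) x) (at t)" .
  then show ?thesis
    by (rule has_field_derivative_transform_within_open[where S="{0<..}"]) (use t in \<open>auto simp: g_def\<close>)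
qed

definition Lg :: "real \<Rightarrow> 's \<Rightarrow> real" where
  "Lg u x = (LINT s:{0<..}|lborel. exp (- u * s) * g x s)"

text \<open>The Laplace transform of the forward equation. \<open>A\<close> passes through the
  integral because each of its rows is a finite sum.\<close>

lemma Lg_equation:
  assumes x: "x \<in> S" and u: "0 < u"
  shows "u * Lg u x = of_bool (x = x0) + A (Lg u) x"
proof -
  have bound: "\<bar>A (\<lambda>y. g y t) x\<bar> \<le> K" for t
    using A_bound[OF x, of "\<lambda>y. g y t" 1] g_bound by simp
  have cont: "continuous_on {0..} (\<lambda>t. A (\<lambda>y. g y t) x)"
    unfolding A_def using N(2)[OF x] by (intro continuous_intros continuous_on_g) auto
  have "u * Lg u x = g x 0 + (LINT t:{0<..}|lborel. exp (- u * t) * A (\<lambda>y. g y t) x)"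
    unfolding Lg_def
    by (rule laplace_derivative[OF u continuous_on_g[OF x] g_forward[OF x] cont g_bound[OF x] bound])
  also have "(LINT t:{0<..}|lborel. exp (- u * t) * A (\<lambda>y. g y t) x) =
      (LINT t:{0<..}|lborel. (\<Sum>y\<in>N x. r y x * (exp (- u * t) * g y t)))"
    unfolding A_def sum_distrib_left by (simp add: mult.left_commute)
  also have "\<dots> = (\<Sum>y\<in>N x. (LINT t:{0<..}|lborel. r y x * (exp (- u * t) * g y t)))"
    unfolding set_lebesgue_integral_def scaleR_sum_right
  proof (rule Bochner_Integration.integral_sum)
    fix y assume "y \<in> N x"
    then have y: "y \<in> S" using N(2)[OF x] by auto
    have "set_integrable lborel {0<..} (\<lambda>t. exp (- u * t) * g y t)"
      by (rule integrable_exp_bounded[OF u g_measurable[OF y] g_bound[OF y]])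
    then have "set_integrable lborel {0<..} (\<lambda>t. r y x * (exp (- u * t) * g y t))"
      by (rule set_integrable_mult_right)
    then show "integrable lborel (\<lambda>t. indicator {0<..} t *\<^sub>R (r y x * (exp (- u * t) * g y t)))"
      by (simp only: set_integrable_def)
  qed
  also have "\<dots> = A (Lg u) x"
    unfolding A_def Lg_def set_integral_mult_right ..
  also have "g x 0 = of_bool (x = x0)"
    using P_0[OF x0_in x] by (auto simp: g_def)
  finally show ?thesis .
qed

lemma Lg_bound:
  assumes "x \<in> S" "0 < u"
  shows "\<bar>u * Lg u x\<bar> \<le> 1"
proof -
  let ?E = "density lborel (exponential_density u)"
  interpret E: prob_space ?E by (rule prob_space_exponential_density[OF assms(2)])
  have i: "integrable ?E (g x)"
    using g_bound[OF assms(1)] g_measurable[OF assms(1)] by (intro E.integrable_const_bound[where B=1]) auto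
  have "u * Lg u x = integral\<^sup>L ?E (g x)"
    unfolding Lg_def using assms by (intro integral_exponential_density[symmetric] g_measurable)
  also have "\<bar>\<dots>\<bar> \<le> (\<integral>s. \<bar>g x s\<bar> \<partial>?E)" by (rule integral_abs_bound)
  also have "\<dots> \<le> (\<integral>s. 1 \<partial>?E)"
    using i g_bound[OF assms(1)] by (intro integral_mono) auto
  finally show ?thesis using E.prob_space by simp
qed

lemma prob_time_change_eq:
  assumes "x \<in> S" "0 \<le> t"
  shows "prob {\<omega>\<in>space M. time_change X Y t \<omega> = x} = expectation (\<lambda>\<omega>. g x (Y t \<omega>))"
proof (rule prob_time_change(2)[OF prob_space_axioms indep X_measurable X_right_const Y_nonneg assms(2)])
  show "measure M {\<omega>\<in>space M. X s \<omega> = x} = g x s" if "0 \<le> s" for s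
    using X_prob[OF that assms(1)] that by (simp add: g_def)
qed (use assms in \<open>auto intro: g_bound continuous_on_g\<close>)

lemma time_change_eq_series:
  assumes x: "x \<in> S" and t: "0 < t"
  shows "prob {\<omega>\<in>space M. time_change X Y t \<omega> = x} = F x t"
proof -
  define f where "f x t = expectation (\<lambda>\<omega>. g x (Y t \<omega>))" for x t
  \<comment> \<open>From \<open>B\<close> on the transformed series converges; the second entry
    forces c z^a to be at least K + 1, hence \<phi>(z) > K as uniqueness requires.\<close>
  define z0 where "z0 = max B (((K + 1) / c) powr (1 / a))"
  have z0: "B \<le> z" "0 < z" "K < \<phi> z" if "z0 \<le> z" for z
  proof -
    show "B \<le> z" using that by (simp add: z0_def)
    then show z: "0 < z" using B_ge_1 by simp
    have "(K + 1) / c = (((K + 1) / c) powr (1 / a)) powr a"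
      using orders weights K_nonneg by (simp add: powr_powr)
    also have "\<dots> \<le> z powr a"
      using that orders by (intro powr_mono2) (auto simp: z0_def)
    finally have "K + 1 \<le> c * z powr a" using weights by (simp add: field_simps)
    moreover have "0 \<le> d * z powr b" using weights by simp
    ultimately show "K < \<phi> z" using \<phi>_eq[OF z] by simp
  qed
  have Lf: "set_integrable lborel {0<..} (\<lambda>t. exp (- z * t) * f y t)"
    "z * (LINT t:{0<..}|lborel. exp (- z * t) * f y t) = \<phi> z * Lg (\<phi> z) y" if "0 < z" "y \<in> S" for z y
    unfolding f_def Lg_def using laplace_Y[OF that(1) g_measurable g_bound] that(2) by auto
  have eq: "LF z x = \<phi> z * Lg (\<phi> z) x" if z: "z0 \<le> z" for z
  proof -
    obtain C where C: "0 \<le> C" "\<And>x. x \<in> S \<Longrightarrow> \<bar>LF z x\<bar> \<le> C"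
      using LF_bounded[OF z0(1)[OF z]] by blast
    define v where "v y = LF z y - \<phi> z * Lg (\<phi> z) y" for y
    have "v x = 0"
    proof (rule bounded_eigenvector_zero[where \<phi>="\<phi> z" and C="C + 1"])
      fix y assume y: "y \<in> S"
      have "\<phi> z * LF z y = \<phi> z * of_bool (y = x0) + A (LF z) y"
        using LF_equation[OF y z0(1)[OF z]] \<phi>_eq[OF z0(2)[OF z]] by simp
      moreover have "\<phi> z * Lg (\<phi> z) y = of_bool (y = x0) + A (Lg (\<phi> z)) y"
        by (rule Lg_equation[OF y \<phi>_pos[OF z0(2)[OF z]]])
      moreover have "A v y = A (LF z) y - \<phi> z * A (Lg (\<phi> z)) y"
        by (simp add: A_def v_def sum_subtractf sum_distrib_left algebra_simps)
      ultimately show "\<phi> z * v y = A v y" by (simp add: v_def algebra_simps)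
      show "\<bar>v y\<bar> \<le> C + 1"
        using C(2)[OF y] Lg_bound[OF y \<phi>_pos[OF z0(2)[OF z]]] by (simp add: v_def)
    qed (use x z0(3)[OF z] in auto)
    then show ?thesis by (simp add: v_def)
  qed
  have "F x t - f x t = 0"
  proof (rule laplace_unique[where z=z0 and h="\<lambda>t. F x t - f x t"])
    have i: "set_integrable lborel {0<..} (\<lambda>t. exp (- z * t) * F x t)"
      "set_integrable lborel {0<..} (\<lambda>t. exp (- z * t) * f x t)" if "z0 \<le> z" for z
      using F_laplace_integrable[OF x z0(1)[OF that]] Lf(1)[OF z0(2)[OF that] x] by auto
    show "set_integrable lborel {0<..} (\<lambda>t. exp (- z0 * t) * (F x t - f x t))"
      unfolding right_diff_distrib using i[of z0] by (intro set_integral_diff(1)) auto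
    fix n :: nat
    have zn: "z0 \<le> z0 + real n" by simp
    have "(LINT t:{0<..}|lborel. exp (- (z0 + real n) * t) * (F x t - f x t)) =
      (LINT t:{0<..}|lborel. exp (- (z0 + real n) * t) * F x t) - (LINT t:{0<..}|lborel. exp (- (z0 + real n) * t) * f x t)"
      unfolding right_diff_distrib using i[OF zn] by (intro set_integral_diff(2)) auto
    also have "\<dots> = 0"
    proof -
      have "(z0 + real n) * (LINT t:{0<..}|lborel. exp (- (z0 + real n) * t) * F x t) =
          (z0 + real n) * (LINT t:{0<..}|lborel. exp (- (z0 + real n) * t) * f x t)"
        by (rule trans[OF eq[OF zn, unfolded LF_def] Lf(2)[OF z0(2)[OF zn] x, symmetric]])
      then show ?thesis
        unfolding mult_cancel_left using z0(2)[OF zn] by simp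
    qed
    finally show "(LINT t:{0<..}|lborel. exp (- (z0 + real n) * t) * (F x t - f x t)) = 0" .
  next
    fix s :: real assume s: "0 < s"
    have "continuous (at_right s) (F x)" using isCont_F[OF x s] by (rule continuous_within_subset) simp
    moreover have "continuous (at_right s) (f x)"
      unfolding f_def by (rule expectation_Y_right_cont[OF continuous_on_g[OF x] g_bound[OF x] s])
    ultimately show "continuous (at_right s) (\<lambda>t. F x t - f x t)" by (rule continuous_diff)
  qed (rule t)
  then show ?thesis using prob_time_change_eq[OF x, of t] t by (simp add: f_def)
qed

end

text \<open>The Markov property is applied to the history consisting of time 0 only. Since the start
  at \<open>x0\<close> is sure, the conditional probability is the unconditional one.\<close>

lemma markov_jump_process_prob:
  assumes "prob_space M" "markov_jump_process M S q x0 X" "x0 \<in> S"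
  obtains P where "transition_function S q P"
    "\<And>t x. 0 \<le> t \<Longrightarrow> x \<in> S \<Longrightarrow> measure M {\<omega>\<in>space M. X t \<omega> = x} = P t x0 x"
proof -
  interpret prob_space M by fact
  have X0: "X 0 \<omega> = x0" if "\<omega> \<in> space M" for \<omega>
    using assms(2) that unfolding markov_jump_process_def by blast
  obtain P where P: "transition_function S q P"
    and mk: "\<And>(n::nat) (t :: nat \<Rightarrow> real) x j. j \<in> S \<Longrightarrow>
          0 \<le> t 0 \<Longrightarrow> strict_mono t \<Longrightarrow> (\<And>i. i \<le> n \<Longrightarrow> x i \<in> S) \<Longrightarrow>
          \<P>(\<omega> in M. \<forall>i\<le>n. X (t i) \<omega> = x i) > 0 \<Longrightarrow>
          \<P>(\<omega> in M. X (t (Suc n)) \<omega> = j \<bar> \<forall>i\<le>n. X (t i) \<omega> = x i)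
            = P (t (Suc n) - t n) (x n) j"
    using assms(2) unfolding markov_jump_process_def by blast
  have all: "{\<omega>\<in>space M. X 0 \<omega> = x0} = space M" using X0 by auto
  show ?thesis
  proof (rule that[OF P])
    fix t :: real and x assume t: "0 \<le> t" and x: "x \<in> S"
    show "prob {\<omega>\<in>space M. X t \<omega> = x} = P t x0 x"
    \<comment> \<open>The observation times are the multiples of t, which are strictly increasing
      only for t > 0.\<close>
    proof (cases "t = 0")
      case True
      have "{\<omega>\<in>space M. X 0 \<omega> = x} = (if x0 = x then space M else {})" using X0 by auto
      then show ?thesis
        using True P assms(3) x by (auto simp: transition_function_def prob_space)
    next
      case False
      have "\<P>(\<omega> in M. X (real (Suc 0) * t) \<omega> = x \<bar> \<forall>i\<le>0. X (real i * t) \<omega> = x0)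
        = P (real (Suc 0) * t - real 0 * t) x0 x"
        using t False assms(3)
        by (intro mk[of x "\<lambda>i. real i * t" 0 "\<lambda>_. x0"] x) (auto simp: strict_mono_def all prob_space)
      moreover have "{\<omega>\<in>space M. X t \<omega> = x \<and> X 0 \<omega> = x0} = {\<omega>\<in>space M. X t \<omega> = x}"
        using X0 by auto
      ultimately show ?thesis
        by (simp add: cond_prob_def all prob_space)
    qed
  qed
qed

section \<open>The Erlang queue\<close>

definition erlang_exit_set :: "nat \<Rightarrow> nat \<times> nat \<Rightarrow> (nat \<times> nat) set" where
  "erlang_exit_set k x = (case x of (n, s) \<Rightarrow>
     if n = 0 then {(1, k)}
     else {(n + 1, s), if 2 \<le> s then (n, s - 1) else if 2 \<le> n then (n - 1, k) else (0, 0)})"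

text \<open>The states with a direct jump into x. Phases count down, so phase s < k is entered from
  s + 1, and phase k by completing the previous customer's phase 1. An arrival at the empty system
  leads to (1, k) only.\<close>

definition erlang_entry_set :: "nat \<Rightarrow> nat \<times> nat \<Rightarrow> (nat \<times> nat) set" where
  "erlang_entry_set k x = (case x of (n, s) \<Rightarrow>
     if n = 0 then {(1, 1)}
     else {if s < k then (n, s + 1) else (n + 1, 1)} \<union>
       (if 2 \<le> n then {(n - 1, s)} else if s = k then {(0, 0)} else {}))"

lemma erlang_statesE:
  assumes "x \<in> erlang_states k"
  obtains "x = (0, 0)" | n s where "x = (n, s)" "1 \<le> n" "1 \<le> s" "s \<le> k"
  using assms by (auto simp: erlang_states_def)

lemma erlang_exit_rate:
  assumes "1 \<le> k" "x \<in> erlang_states k"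
  shows "(\<Sum>\<^sub>\<infinity>j\<in>erlang_states k - {x}. erlang_rate \<Lambda> \<mu> k x j) = (if x = (0, 0) then \<Lambda> else \<Lambda> + real k * \<mu>)"
proof -
  have "(\<Sum>\<^sub>\<infinity>j\<in>erlang_states k - {x}. erlang_rate \<Lambda> \<mu> k x j) =
      (\<Sum>\<^sub>\<infinity>j\<in>erlang_exit_set k x. erlang_rate \<Lambda> \<mu> k x j)"
    using assms by (intro infsum_cong_neutral)
      (auto simp: erlang_exit_set_def erlang_rate_def erlang_states_def split: if_splits)
  also have "\<dots> = (\<Sum>j\<in>erlang_exit_set k x. erlang_rate \<Lambda> \<mu> k x j)"
    by (rule infsum_finite) (auto simp: erlang_exit_set_def split: prod.splits)
  also have "\<dots> = (if x = (0, 0) then \<Lambda> else \<Lambda> + real k * \<mu>)"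
    using assms(2)
  proof (cases rule: erlang_statesE)
    case 1
    then show ?thesis by (simp add: erlang_exit_set_def erlang_rate_def)
  next
    case (2 n s)
    \<comment> \<open>For k = 1 both targets have phase 1; this keeps them distinct, so the two
      rates are added.\<close>
    moreover have "Suc n \<noteq> n - Suc 0" by simp
    ultimately show ?thesis by (auto simp: erlang_exit_set_def erlang_rate_def)
  qed
  finally show ?thesis .
qed

lemma erlang_entry_set:
  assumes "1 \<le> k" "x \<in> erlang_states k"
  shows "finite (erlang_entry_set k x)" "erlang_entry_set k x \<subseteq> erlang_states k - {x}"
    and "\<And>l. l \<in> erlang_states k \<Longrightarrow> l \<noteq> x \<Longrightarrow> l \<notin> erlang_entry_set k x \<Longrightarrow> erlang_rate \<Lambda> \<mu> k l x = 0"
proof -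
  show "finite (erlang_entry_set k x)" by (auto simp: erlang_entry_set_def split: prod.splits)
  show "erlang_entry_set k x \<subseteq> erlang_states k - {x}"
    using assms by (auto simp: erlang_entry_set_def erlang_states_def split: if_splits)
  show "erlang_rate \<Lambda> \<mu> k l x = 0"
    if "l \<in> erlang_states k" "l \<noteq> x" "l \<notin> erlang_entry_set k x" for l
    using assms(2)
  proof (cases rule: erlang_statesE)
    case 1
    from that(1) show ?thesis
      by (cases rule: erlang_statesE) (use that 1 in \<open>auto simp: erlang_entry_set_def erlang_rate_def\<close>)
  next
    case (2 n s)
    from that(1) show ?thesis
      by (cases rule: erlang_statesE)
        (use that 2 in \<open>auto simp: erlang_entry_set_def erlang_rate_def split: if_splits\<close>)
  qed
qed

lemma erlang_entry_sum:
  fixes v :: "nat \<times> nat \<Rightarrow> real"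
  assumes "1 \<le> k" "x \<in> erlang_states k"
  shows "(\<Sum>l\<in>erlang_entry_set k x. erlang_rate \<Lambda> \<mu> k l x * v l) = (case x of (n, s) \<Rightarrow>
     if n = 0 then real k * \<mu> * v (1, 1)
     else real k * \<mu> * v (if s < k then (n, s + 1) else (n + 1, 1)) +
       (if 2 \<le> n then \<Lambda> * v (n - 1, s) else if s = k then \<Lambda> * v (0, 0) else 0))"
  using assms(2)
proof (cases rule: erlang_statesE)
  case 1
  then show ?thesis by (simp add: erlang_entry_set_def erlang_rate_def)
next
  case (2 n s)
  moreover have "Suc n \<noteq> n - Suc 0" by simp
  ultimately show ?thesis by (auto simp: erlang_entry_set_def erlang_rate_def)
qed

section \<open>The time-changed Erlang queue\<close>

locale erlang_time_change = prob_space M for M :: "'a measure" +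
  fixes Q :: "real \<Rightarrow> 'a \<Rightarrow> nat \<times> nat" and D :: "real \<Rightarrow> 'a \<Rightarrow> real"
    and \<Lambda> \<mu> \<alpha>1 \<alpha>2 c1 c2 :: real and k :: nat
  assumes rates: "0 < \<Lambda>" "0 < \<mu>" "1 \<le> k"
    and orders: "0 < \<alpha>2" "\<alpha>2 < \<alpha>1" "\<alpha>1 < 1"
    and weights: "0 \<le> c1" "0 \<le> c2" "c1 + c2 = 1"
    and queue: "erlang_queue M \<Lambda> \<mu> k Q"
    and subordinator: "mixed_stable_subordinator M c1 \<alpha>1 c2 \<alpha>2 D"
    and independent: "independent_processes M Q (inverse_subordinator D)"
begin

abbreviation p :: "nat \<times> nat \<Rightarrow> real \<Rightarrow> real" where
  "p \<equiv> state_prob M (time_change Q (inverse_subordinator D))"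

lemma Q_0: "\<omega> \<in> space M \<Longrightarrow> Q 0 \<omega> = (0, 0)"
  using queue by (simp add: erlang_queue_def markov_jump_process_def)

lemma time_change_0: "\<omega> \<in> space M \<Longrightarrow> time_change Q (inverse_subordinator D) 0 \<omega> = (0, 0)"
  by (simp add: time_change_def inverse_subordinator_def Q_0)

text \<open>Conditioning on the initial state has no effect, because \<open>Y\<close> is 0 at time 0
  and the start at (0, 0) is sure.\<close>

lemma p_eq_prob: "p x t = prob {\<omega>\<in>space M. time_change Q (inverse_subordinator D) t \<omega> = x}"
proof -
  have "{\<omega>\<in>space M. time_change Q (inverse_subordinator D) 0 \<omega> = (0, 0)} = space M"
    using time_change_0 by auto
  moreover have "{\<omega>\<in>space M. time_change Q (inverse_subordinator D) t \<omega> = x \<and>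
      time_change Q (inverse_subordinator D) 0 \<omega> = (0, 0)} =
      {\<omega>\<in>space M. time_change Q (inverse_subordinator D) t \<omega> = x}"
    using time_change_0 by auto
  ultimately show ?thesis by (simp add: state_prob_def cond_prob_def prob_space)
qed

lemma p_0: "p x 0 = of_bool (x = (0, 0))"
proof -
  have "{\<omega>\<in>space M. time_change Q (inverse_subordinator D) 0 \<omega> = x} = (if x = (0, 0) then space M else {})"
    using time_change_0 by auto
  then show ?thesis by (simp add: p_eq_prob prob_space)
qed

lemma subordinator_D: "subordinator M D (\<lambda>z. c1 * z powr \<alpha>1 + c2 * z powr \<alpha>2)"
proof
  show "0 < c1 * z powr \<alpha>1 + c2 * z powr \<alpha>2" if "0 < z" for z
  proof (cases "c1 = 0")
    case True
    then show ?thesis using weights that by simp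
  next
    case False
    then have "0 < c1 * z powr \<alpha>1" using weights that by simp
    then show ?thesis using weights by (intro add_pos_nonneg) auto
  qed
  \<comment> \<open>Independence makes the sigma-algebra generated by \<open>Y\<close> consist of
    events, which includes measurability.\<close>
  show "inverse_subordinator D t \<in> borel_measurable M" if "0 \<le> t" for t
    using independent_processesD(2)[OF prob_space_axioms independent that that, of UNIV] by simp
qed (use subordinator in \<open>auto simp: mixed_stable_subordinator_def levy_process_def\<close>)

text \<open>Stated for any representation of the same Laplace exponent with a positive leading
  weight, because the series divides by \<open>c\<close> whereas \<open>c1\<close> may
  vanish.\<close>

lemma p_solves:
  assumes abcd: "0 < b" "b < a" "a < 1" "0 < c" "0 \<le> d"
    and \<phi>: "\<And>z. 0 < z \<Longrightarrow> c1 * z powr \<alpha>1 + c2 * z powr \<alpha>2 = c * z powr a + d * z powr b"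
    and x: "x \<in> erlang_states k" and t: "0 < t"
  shows "0 < \<alpha> \<Longrightarrow> \<alpha> < 1 \<Longrightarrow> caputo_differentiable \<alpha> (p x) t"
    and "c * caputo_deriv a (p x) t + d * caputo_deriv b (p x) t =
      - (if x = (0, 0) then \<Lambda> else \<Lambda> + real k * \<mu>) * p x t +
      (\<Sum>l\<in>erlang_entry_set k x. erlang_rate \<Lambda> \<mu> k l x * p l t)"
proof -
  let ?S = "erlang_states k" and ?q = "erlang_rate \<Lambda> \<mu> k"
  define e where "e x = (if x = (0, 0) then \<Lambda> else \<Lambda> + real k * \<mu>)" for x :: "nat \<times> nat"
  define N where "N x = insert x (erlang_entry_set k x)" for x
  define r where "r y x = (if y = x then - e x else ?q y x)" for x y
  have k\<mu>: "0 < real k * \<mu>" using rates by simp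
  note entry = erlang_entry_set[OF rates(3)]
  \<comment> \<open>Used with \<open>f\<close> the absolute value for the norm of the operator, and
    with the identity for the equation itself.\<close>
  have sum_N: "(\<Sum>y\<in>N x. f (r y x) * v y) = f (- e x) * v x + (\<Sum>l\<in>erlang_entry_set k x. f (?q l x) * v l)"
    if "x \<in> ?S" for x and f :: "real \<Rightarrow> real" and v :: "nat \<times> nat \<Rightarrow> real"
  proof -
    have "x \<notin> erlang_entry_set k x" using entry(2)[OF that] by auto
    moreover have "(\<Sum>l\<in>erlang_entry_set k x. f (r l x) * v l) = (\<Sum>l\<in>erlang_entry_set k x. f (?q l x) * v l)"
      using calculation by (intro sum.cong) (auto simp: r_def)
    ultimately show ?thesis using entry(1)[OF that] by (simp add: N_def) (simp add: r_def)
  qed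
  have q_nonneg: "0 \<le> ?q l x" for l x
    using rates k\<mu> by (auto simp: erlang_rate_def split: prod.splits)
  have e_le: "\<bar>e x\<bar> \<le> \<Lambda> + real k * \<mu>" for x using rates k\<mu> by (auto simp: e_def)
  obtain P where P: "transition_function ?S ?q P"
    "\<And>t x. 0 \<le> t \<Longrightarrow> x \<in> ?S \<Longrightarrow> measure M {\<omega>\<in>space M. Q t \<omega> = x} = P t (0, 0) x"
    using markov_jump_process_prob[OF prob_space_axioms queue[unfolded erlang_queue_def]]
    by (auto simp: erlang_states_def)
  interpret S: subordinator M D "\<lambda>z. c1 * z powr \<alpha>1 + c2 * z powr \<alpha>2" by (rule subordinator_D)
  interpret T: bounded_transition_function ?S ?q P "\<Lambda> + real k * \<mu>"
    by unfold_locales (use P(1) rates k\<mu> erlang_exit_rate[OF rates(3)] in auto)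
  \<comment> \<open>One half of the bound covers the exit rate on the diagonal. The other covers the
    inflow: at most one arrival and one phase completion lead into a state.\<close>
  interpret W: forward_operator ?S N r "2 * (\<Lambda> + real k * \<mu>)" a b c d "(0, 0)"
  proof
    fix x assume x: "x \<in> ?S"
    show "finite (N x)" "N x \<subseteq> ?S" using entry[OF x] x by (auto simp: N_def)
    have "(\<Sum>y\<in>N x. \<bar>r y x\<bar>) = \<bar>e x\<bar> + (\<Sum>l\<in>erlang_entry_set k x. ?q l x * 1)"
      using sum_N[OF x, of abs "\<lambda>_. 1"] q_nonneg by simp
    also have "(\<Sum>l\<in>erlang_entry_set k x. ?q l x * 1) \<le> \<Lambda> + real k * \<mu>"
      unfolding erlang_entry_sum[OF rates(3) x, of \<Lambda> \<mu> "\<lambda>_. 1"] using rates k\<mu>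
      by (auto split: prod.splits)
    finally show "(\<Sum>y\<in>N x. \<bar>r y x\<bar>) \<le> 2 * (\<Lambda> + real k * \<mu>)" using e_le[of x] by simp
  qed (use abcd rates k\<mu> in auto)
  interpret C: time_changed_chain M D "\<lambda>z. c1 * z powr \<alpha>1 + c2 * z powr \<alpha>2" ?S ?q P "\<Lambda> + real k * \<mu>"
    N r "2 * (\<Lambda> + real k * \<mu>)" a b c d "(0, 0)" Q
  proof unfold_locales
    show "r y x = (if y = x then - (\<Sum>\<^sub>\<infinity>j\<in>?S - {x}. ?q x j) else ?q y x)" if "x \<in> ?S" for x y
      unfolding erlang_exit_rate[OF rates(3) that] by (simp add: r_def e_def)
    show "?q l x = 0" if "x \<in> ?S" "l \<in> ?S - N x" for x l
      using entry(3)[OF that(1)] that(2) by (auto simp: N_def)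
  qed (use \<phi> P(2) independent queue in \<open>auto simp: N_def erlang_states_def erlang_queue_def markov_jump_process_def\<close>)
  have pF: "p y s = W.F y s" if "y \<in> ?S" "0 < s" for y s
    unfolding p_eq_prob by (rule C.time_change_eq_series[OF that])
  have cong: "caputo_deriv \<beta> (p x) t = caputo_deriv \<beta> (W.F x) t"
    "caputo_differentiable \<beta> (p x) t \<longleftrightarrow> caputo_differentiable \<beta> (W.F x) t" for \<beta>
    by (rule caputo_cong[OF pF[OF x]], assumption)+
  show "caputo_differentiable \<alpha> (p x) t" if "0 < \<alpha>" "\<alpha> < 1"
    unfolding cong(2) by (rule W.F_caputo_differentiable[OF x t that])
  have "c * caputo_deriv a (p x) t + d * caputo_deriv b (p x) t = W.A (\<lambda>y. W.F y t) x"
    unfolding cong(1) by (rule W.F_equation[OF x t])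
  also have "\<dots> = W.A (\<lambda>y. p y t) x"
    unfolding W.A_def using W.N(2)[OF x] pF[OF _ t] by (intro sum.cong) auto
  also have "\<dots> = - e x * p x t + (\<Sum>l\<in>erlang_entry_set k x. ?q l x * p l t)"
    unfolding W.A_def using sum_N[OF x, of "\<lambda>y. y" "\<lambda>y. p y t"] by simp
  finally show "c * caputo_deriv a (p x) t + d * caputo_deriv b (p x) t =
      - (if x = (0, 0) then \<Lambda> else \<Lambda> + real k * \<mu>) * p x t + (\<Sum>l\<in>erlang_entry_set k x. ?q l x * p l t)"
    by (simp add: e_def)
qed

text \<open>If \<open>c1 = 0\<close>, the leading order is \<open>\<alpha>2\<close>, and \<open>\<alpha>2 / 2\<close> with weight \<open>0\<close> is a dummy second order.\<close>

lemma p_fractional_equation: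
  assumes x: "x \<in> erlang_states k" and t: "0 < t"
  shows "0 < \<alpha> \<Longrightarrow> \<alpha> < 1 \<Longrightarrow> caputo_differentiable \<alpha> (p x) t"
    and "c1 * caputo_deriv \<alpha>1 (p x) t + c2 * caputo_deriv \<alpha>2 (p x) t =
      - (if x = (0, 0) then \<Lambda> else \<Lambda> + real k * \<mu>) * p x t +
      (case x of (n, s) \<Rightarrow>
        if n = 0 then real k * \<mu> * p (1, 1) t
        else real k * \<mu> * p (if s < k then (n, s + 1) else (n + 1, 1)) t +
          (if 2 \<le> n then \<Lambda> * p (n - 1, s) t else if s = k then \<Lambda> * p (0, 0) t else 0))"
proof -
  have "(0 < \<alpha> \<longrightarrow> \<alpha> < 1 \<longrightarrow> caputo_differentiable \<alpha> (p x) t) \<and>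
    c1 * caputo_deriv \<alpha>1 (p x) t + c2 * caputo_deriv \<alpha>2 (p x) t =
      - (if x = (0, 0) then \<Lambda> else \<Lambda> + real k * \<mu>) * p x t +
      (\<Sum>l\<in>erlang_entry_set k x. erlang_rate \<Lambda> \<mu> k l x * p l t)" for \<alpha>
  proof (cases "c1 = 0")
    case True
    then have "c2 = 1" using weights by simp
    have o: "0 < \<alpha>2 / 2" "\<alpha>2 / 2 < \<alpha>2" "\<alpha>2 < 1" using orders by auto
    have "c1 * z powr \<alpha>1 + c2 * z powr \<alpha>2 = 1 * z powr \<alpha>2 + 0 * z powr (\<alpha>2 / 2)" for z
      using True \<open>c2 = 1\<close> by simp
    from p_solves[OF o zero_less_one order_refl this x t]
    show ?thesis using True \<open>c2 = 1\<close> by simp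
  next
    case False
    then have "0 < c1" using weights by simp
    from p_solves[OF orders this weights(2) refl x t] show ?thesis by simp
  qed
  then show "0 < \<alpha> \<Longrightarrow> \<alpha> < 1 \<Longrightarrow> caputo_differentiable \<alpha> (p x) t"
    and "c1 * caputo_deriv \<alpha>1 (p x) t + c2 * caputo_deriv \<alpha>2 (p x) t =
      - (if x = (0, 0) then \<Lambda> else \<Lambda> + real k * \<mu>) * p x t +
      (case x of (n, s) \<Rightarrow>
        if n = 0 then real k * \<mu> * p (1, 1) t
        else real k * \<mu> * p (if s < k then (n, s + 1) else (n + 1, 1)) t +
          (if 2 \<le> n then \<Lambda> * p (n - 1, s) t else if s = k then \<Lambda> * p (0, 0) t else 0))"
    unfolding erlang_entry_sum[OF rates(3) x, of \<Lambda> \<mu> "\<lambda>l. p l t"] by blast+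
qed

end

theorem theorem3p1:
  fixes M :: "'a measure"
    and Q :: "real \<Rightarrow> 'a \<Rightarrow> nat \<times> nat"
    and D :: "real \<Rightarrow> 'a \<Rightarrow> real"
    and \<Lambda> \<mu> \<alpha>1 \<alpha>2 c1 c2 :: real
    and k :: nat
    and p0 :: "real \<Rightarrow> real"
    and p :: "nat \<Rightarrow> nat \<Rightarrow> real \<Rightarrow> real"
    and L :: "(real \<Rightarrow> real) \<Rightarrow> real \<Rightarrow> real"
  assumes "prob_space M"
    and "0 < \<Lambda>" and "0 < \<mu>" and "1 \<le> k"
    and "0 < \<alpha>2" and "\<alpha>2 < \<alpha>1" and "\<alpha>1 < 1"
    and "0 \<le> c1" and "0 \<le> c2" and "c1 + c2 = 1"
    and "erlang_queue M \<Lambda> \<mu> k Q"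
    and "mixed_stable_subordinator M c1 \<alpha>1 c2 \<alpha>2 D"
    and "independent_processes M Q (inverse_subordinator D)"
    and p0_eq: "p0 = state_prob M (time_change Q (inverse_subordinator D)) (0, 0)"
    and p_eq: "p = (\<lambda>n s. state_prob M (time_change Q (inverse_subordinator D)) (n, s))"
    and L_eq: "L = (\<lambda>g t. c1 * caputo_deriv \<alpha>1 g t + c2 * caputo_deriv \<alpha>2 g t)"
  shows "(\<forall>t>0. \<forall>\<alpha>\<in>{\<alpha>1, \<alpha>2}. caputo_differentiable \<alpha> p0 t \<and>
            (\<forall>n\<ge>1. \<forall>s\<in>{1..k}. caputo_differentiable \<alpha> (p n s) t)) \<and>
         (\<forall>t>0. L p0 t = - \<Lambda> * p0 t + real k * \<mu> * p 1 1 t) \<and>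
         (\<forall>t>0. \<forall>s. 1 \<le> s \<and> s \<le> k - 1 \<longrightarrow>
            L (p 1 s) t = - (\<Lambda> + real k * \<mu>) * p 1 s t + real k * \<mu> * p 1 (s + 1) t) \<and>
         (\<forall>t>0. L (p 1 k) t =
            - (\<Lambda> + real k * \<mu>) * p 1 k t + real k * \<mu> * p 2 1 t + \<Lambda> * p0 t) \<and>
         (\<forall>t>0. \<forall>n s. 2 \<le> n \<and> 1 \<le> s \<and> s \<le> k - 1 \<longrightarrow>
            L (p n s) t =
              - (\<Lambda> + real k * \<mu>) * p n s t + real k * \<mu> * p n (s + 1) t + \<Lambda> * p (n - 1) s t) \<and>
         (\<forall>t>0. \<forall>n\<ge>2. L (p n k) t =
              - (\<Lambda> + real k * \<mu>) * p n k t + real k * \<mu> * p (n + 1) 1 t + \<Lambda> * p (n - 1) k t) \<and>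
         p0 0 = 1 \<and>
         (\<forall>n\<ge>1. \<forall>s\<in>{1..k}. p n s 0 = 0)"
proof -
  interpret E: erlang_time_change M Q D \<Lambda> \<mu> \<alpha>1 \<alpha>2 c1 c2 k
    by (rule erlang_time_change.intro[OF assms(1) erlang_time_change_axioms.intro[OF assms(2-13)]])
  have p: "p n s = E.p (n, s)" for n s by (simp add: p_eq)
  have p0: "p0 = E.p (0, 0)" by (rule p0_eq)
  have S: "(0, 0) \<in> erlang_states k" "\<And>n s. 1 \<le> n \<Longrightarrow> 1 \<le> s \<Longrightarrow> s \<le> k \<Longrightarrow> (n, s) \<in> erlang_states k"
    by (auto simp: erlang_states_def)
  have L: "L (E.p x) t = - (if x = (0, 0) then \<Lambda> else \<Lambda> + real k * \<mu>) * E.p x t +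
      (case x of (n, s) \<Rightarrow>
        if n = 0 then real k * \<mu> * E.p (1, 1) t
        else real k * \<mu> * E.p (if s < k then (n, s + 1) else (n + 1, 1)) t +
          (if 2 \<le> n then \<Lambda> * E.p (n - 1, s) t else if s = k then \<Lambda> * E.p (0, 0) t else 0))"
    if "x \<in> erlang_states k" "0 < t" for x t
    unfolding L_eq by (rule E.p_fractional_equation(2)[OF that])
  have k: "1 \<le> k" by fact
  show ?thesis
    unfolding p p0
  proof (intro conjI allI impI ballI)
    fix t :: real and \<alpha> assume "0 < t" "\<alpha> \<in> {\<alpha>1, \<alpha>2}"
    then have \<alpha>: "0 < \<alpha>" "\<alpha> < 1" using E.orders by auto
    show "caputo_differentiable \<alpha> (E.p (0, 0)) t"
      by (rule E.p_fractional_equation(1)[OF S(1) \<open>0 < t\<close> \<alpha>])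
    fix n s :: nat assume "1 \<le> n" "s \<in> {1..k}"
    then show "caputo_differentiable \<alpha> (E.p (n, s)) t"
      by (intro E.p_fractional_equation(1)[OF S(2) \<open>0 < t\<close> \<alpha>]) auto
  next
    fix t :: real assume t: "0 < t"
    show "L (E.p (0, 0)) t = - \<Lambda> * E.p (0, 0) t + real k * \<mu> * E.p (1, 1) t"
      using L[OF S(1) t] by simp
    show "L (E.p (1, k)) t = - (\<Lambda> + real k * \<mu>) * E.p (1, k) t + real k * \<mu> * E.p (2, 1) t + \<Lambda> * E.p (0, 0) t"
      using L[OF S(2)[of 1 k] t] k by (simp add: numeral_2_eq_2)
    show "L (E.p (1, s)) t = - (\<Lambda> + real k * \<mu>) * E.p (1, s) t + real k * \<mu> * E.p (1, s + 1) t"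
      if "1 \<le> s \<and> s \<le> k - 1" for s
    proof -
      have "s < k" using that k by linarith
      then show ?thesis using L[OF S(2)[of 1 s] t] that by simp
    qed
    show "L (E.p (n, s)) t = - (\<Lambda> + real k * \<mu>) * E.p (n, s) t + real k * \<mu> * E.p (n, s + 1) t + \<Lambda> * E.p (n - 1, s) t"
      if "2 \<le> n \<and> 1 \<le> s \<and> s \<le> k - 1" for n s
    proof -
      have "s < k" using that k by linarith
      then show ?thesis using L[OF S(2)[of n s] t] that by simp
    qed
    show "L (E.p (n, k)) t = - (\<Lambda> + real k * \<mu>) * E.p (n, k) t + real k * \<mu> * E.p (n + 1, 1) t + \<Lambda> * E.p (n - 1, k) t"
      if "2 \<le> n" for n
      using L[OF S(2)[of n k] t] that k by simp
  next
    show "E.p (0, 0) 0 = 1" by (simp add: E.p_0)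
    show "E.p (n, s) 0 = 0" if "1 \<le> n" "s \<in> {1..k}" for n s :: nat
      using that by (simp add: E.p_0)
  qed
qed

end
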